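(* Let $G$ be a non-standard finite group, let $X\subseteq G^{n}$ and $Y\subseteq G^{m}$ be internal subsets and let $S\subseteq X\times Y$ be an internal relation, all defined over a countable rich subset $M$ of $G$. If $S$ is almost surely $k$-stable for some $k\ge 1$, then for every two dense types $\operatorname{tp}(a/M)$ and $\operatorname{tp}(b/M)$, with $a\in G^n$ and $b\in G^m$, the set $\operatorname{GP}(\operatorname{tp}(a/M),\operatorname{tp}(b/M))$ is either contained in $S$ or disjoint from $S$.
   Context: Non-standard finite groups. A non-standard finite group is an ultraproduct $G=\prod_{n\to\mathfrak U}G_n$ of finite groups with $|G_n|<|G_{n+1}|$ for all $n\in\mathbb N$, where $\mathfrak U$ is a non-principal ultrafilter on $\mathbb N$. A Cartesian power $G^k$ is identified with $\prod_{n\to\mathfrak U}G_n^k$ and is again a non-standard finite group. A subset $X\subseteq G^k$ is internal if $X=\prod_{n\to\mathfrak U}X_n$ for some $X_n\subseteq G_n^k$, i.e. $X$ is the set of classes of sequences $(g_n)$ with $g_n\in X_n$ for $\mathfrak U$-almost all $n$. Its density (Loeb measure) is $\mu_{G^k}(X)=\lim_{n\to\mathfrak U}|X_n|/|G_n|^k$; $\mu_{G^k}$ extends uniquely to a $\sigma$-additive measure on the $\sigma$-algebra generated by the internal sets. Tame families. A family $\mathcal F=\bigcup_n\mathcal F_n$, with $\mathcal F_n$ consisting of internal subsets of $G^n$, is tame if: (I) for every group word $w$ in $n$ variables, $\{\bar g\in G^n: w(\bar g)=1_G\}\in\mathcal F_n$; (II) $\mathcal F$ is closed under finite Cartesian products,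 Boolean combinations, projections and permutations of coordinates; (III) if $Z\in\mathcal F_n$, then $\{(x,y)\in G^n\times G^n: x\cdot y\in Z\}\in\mathcal F_{2n}$; (IV) if $Z\in\mathcal F_{k+m}$ and $q\in[0,1]$ is rational, there is $Y_q\in\mathcal F_m$ with $\{y\in G^m:\mu_{G^k}(Z_y)>q\}\subseteq Y_q\subseteq\{y\in G^m:\mu_{G^k}(Z_y)\ge q\}$, where $Z_y=\{x\in G^k:(x,y)\in Z\}$. Throughout, a countable tame family $\mathcal F$ is fixed, and all internal (and $\omega$-internal) sets considered belong to it. For $A\subseteq G$, $\mathcal F(A)$ is the collection of all fibres $Y_a\subseteq G^n$, where $n\in\mathbb N$, $a$ is a finite tuple from $A$ and $Y\in\mathcal F_{n+|a|}$; its members are the internal sets defined over $A$. An $\omega$-internal set (defined over $A$) is a countable intersection of internal sets (defined over $A$). A subset $M\subseteq G$ is rich if every non-empty set in $\mathcal F(M)$, say in $G^n$, contains a tuple of $M^n$. Types and density. For $A\subseteq G$ countable and a finite tuple $b$ from $G$, $\operatorname{tp}(b/A)$ is the intersection of all $X\in\mathcal F(A)$ (of the appropriate arity) containing $b$. An $\omega$-internal set is dense if it is not contained in any internal set of density $0$. A tuple $b$ is dense over $A$ if $\operatorname{tp}(b/A)$ is dense. A tuple $(b_1,\ldots,b_r)$ is in good position over $A$ if each $b_i$ is dense over $A\cup\{b_j:j<i\}$ (the $b_i$ may themselves be finite tuples, in which case their coordinates are added to the parameters). $\operatorname{GP}(\operatorname{tp}(a/M),\operatorname{tp}(b/M))$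 is the set of all pairs $(a',b')$ with $a'\in\operatorname{tp}(a/M)$ and $b'\in\operatorname{tp}(b/M)$ such that $(a',b')$ or $(b',a')$ is in good position over $M$. Almost sure stability. A half-graph of height $k$ induced by $S\subseteq X\times Y$ is a sequence $(a_1,b_1,\ldots,a_k,b_k)$ with $a_i\in X$, $b_i\in Y$ such that $(a_i,b_j)\in S$ if and only if $i\le j$; the set of all of these is $\mathcal H_k(S)$. For internal $X\subseteq G^n$, $Y\subseteq G^m$, an internal relation $S\subseteq X\times Y$ is almost surely $k$-stable if $\mu_{G^{(n+m)k}}(\mathcal H_k(S))=0$. *)

theory Defs
  imports Complex_Main "HOL-Algebra.Coset" "HOL-Combinatorics.Permutations" "HOL-Library.Countable_Set"
begin

section \<open>Non-standard finite groups\<close>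

definition ultrafilter :: "'i filter \<Rightarrow> bool" where
  "ultrafilter U \<longleftrightarrow> U \<noteq> bot \<and>
     (\<forall>P. eventually P U \<or> eventually (\<lambda>i. \<not> P i) U)"

definition nonprincipal :: "'i filter \<Rightarrow> bool" where
  "nonprincipal U \<longleftrightarrow> (\<forall>i. U \<noteq> principal {i})"

definition nonstandard_finite_group :: "nat filter \<Rightarrow> (nat \<Rightarrow> 'a monoid) \<Rightarrow> bool" where
  "nonstandard_finite_group U Gs \<longleftrightarrow>
     ultrafilter U \<and> nonprincipal U \<and>
     (\<forall>n. group (Gs n) \<and> finite (carrier (Gs n))) \<and>
     (\<forall>n. order (Gs n) < order (Gs (Suc n)))"

definition sequences :: "(nat \<Rightarrow> 'a monoid) \<Rightarrow> (nat \<Rightarrow> 'a) set" where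
  "sequences Gs = {g. \<forall>n. g n \<in> carrier (Gs n)}"

definition ultra_rel :: "nat filter \<Rightarrow> (nat \<Rightarrow> 'a monoid) \<Rightarrow> (nat \<Rightarrow> 'a) rel" where
  "ultra_rel U Gs = {(g, h). g \<in> sequences Gs \<and> h \<in> sequences Gs \<and> (\<forall>\<^sub>F n in U. g n = h n)}"

definition ultra_class :: "nat filter \<Rightarrow> (nat \<Rightarrow> 'a monoid) \<Rightarrow> (nat \<Rightarrow> 'a) \<Rightarrow> (nat \<Rightarrow> 'a) set" where
  "ultra_class U Gs g = ultra_rel U Gs `` {g}"

type_synonym 'a ultra = "(nat \<Rightarrow> 'a) set"

definition ultraproduct :: "nat filter \<Rightarrow> (nat \<Rightarrow> 'a monoid) \<Rightarrow> 'a ultra monoid" where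
  "ultraproduct U Gs =
     \<lparr> carrier = sequences Gs // ultra_rel U Gs,
       monoid.mult = (\<lambda>x y. \<Union>g\<in>x. \<Union>h\<in>y. ultra_class U Gs (\<lambda>n. g n \<otimes>\<^bsub>Gs n\<^esub> h n)),
       one = ultra_class U Gs (\<lambda>n. \<one>\<^bsub>Gs n\<^esub>) \<rparr>"

text \<open>Elements of a Cartesian power are lists of the given length, so that the
  pair of a tuple \<open>x\<close> and a tuple \<open>y\<close> is the list \<open>x @ y\<close>. The arity \<open>0\<close> is allowed: the
  power is then the one-point set \<open>{[]}\<close>.\<close>

definition tuples :: "'g monoid \<Rightarrow> nat \<Rightarrow> 'g list set" where
  "tuples G k = {x. length x = k \<and> set x \<subseteq> carrier G}"

definition pairs :: "'g list set \<Rightarrow> 'g list set \<Rightarrow> 'g list set" where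
  "pairs X Y = {x @ y | x y. x \<in> X \<and> y \<in> Y}"

section \<open>Internal sets and their density\<close>

text \<open>The ultraproduct of the sets \<open>Xs n \<subseteq> (Gs n)\<^sup>k\<close>, under the identification of a
  class of sequences of \<open>k\<close>-tuples with a \<open>k\<close>-tuple of classes of sequences.\<close>

definition internal_set ::
    "nat filter \<Rightarrow> (nat \<Rightarrow> 'a monoid) \<Rightarrow> nat \<Rightarrow> (nat \<Rightarrow> 'a list set) \<Rightarrow> 'a ultra list set" where
  "internal_set U Gs k Xs =
     {map (ultra_class U Gs) gs | gs.
        length gs = k \<and> set gs \<subseteq> sequences Gs \<and> (\<forall>\<^sub>F n in U. map (\<lambda>g. g n) gs \<in> Xs n)}"

definition internal :: "nat filter \<Rightarrow> (nat \<Rightarrow> 'a monoid) \<Rightarrow> nat \<Rightarrow> 'a ultra list set \<Rightarrow> bool" where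
  "internal U Gs k X \<longleftrightarrow>
     (\<exists>Xs. (\<forall>n. Xs n \<subseteq> tuples (Gs n) k) \<and> X = internal_set U Gs k Xs)"

text \<open>On internal sets the Loeb measure is the limit of the normalised counting measures;
  \<open>density_tendsto\<close> below shows that this limit exists and does not depend on the
  representing sequence. Only densities of internal sets are used.\<close>

definition density ::
    "nat filter \<Rightarrow> (nat \<Rightarrow> 'a monoid) \<Rightarrow> nat \<Rightarrow> 'a ultra list set \<Rightarrow> real" where
  "density U Gs k X =
     (THE r. \<exists>Xs. (\<forall>n. Xs n \<subseteq> tuples (Gs n) k) \<and> X = internal_set U Gs k Xs \<and>
        ((\<lambda>n. real (card (Xs n)) / real (order (Gs n)) ^ k) \<longlongrightarrow> r) U)"

section \<open>Tame families\<close>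

text \<open>A word is the list of its factors: \<open>(i, e)\<close> stands for the \<open>e\<close>-th power of the
  \<open>i\<close>-th variable.\<close>

definition word_value :: "'g monoid \<Rightarrow> (nat \<times> int) list \<Rightarrow> 'g list \<Rightarrow> 'g" where
  "word_value G w x = foldr (\<lambda>(i, e) z. ((x ! i) [^]\<^bsub>G\<^esub> e) \<otimes>\<^bsub>G\<^esub> z) w \<one>\<^bsub>G\<^esub>"

definition fibre :: "'g monoid \<Rightarrow> nat \<Rightarrow> 'g list set \<Rightarrow> 'g list \<Rightarrow> 'g list set" where
  "fibre G k Z y = {x \<in> tuples G k. x @ y \<in> Z}"

text \<open>\<open>F n\<close> is the part of the family that consists of subsets of the \<open>n\<close>-th power. Projections
  to an initial segment of the coordinates, combined with permutations, give all projections.\<close>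

locale tame_family =
  fixes U :: "nat filter" and Gs :: "nat \<Rightarrow> 'a monoid" and F :: "nat \<Rightarrow> 'a ultra list set set"
  assumes internal: "X \<in> F n \<Longrightarrow> internal U Gs n X"
    and words: "(\<forall>(i, e) \<in> set w. i < n) \<Longrightarrow>
      {x \<in> tuples (ultraproduct U Gs) n.
         word_value (ultraproduct U Gs) w x = \<one>\<^bsub>ultraproduct U Gs\<^esub>} \<in> F n"
    and product: "X \<in> F n \<Longrightarrow> Y \<in> F m \<Longrightarrow> pairs X Y \<in> F (n + m)"
    and inter: "X \<in> F n \<Longrightarrow> Y \<in> F n \<Longrightarrow> X \<inter> Y \<in> F n"
    and union: "X \<in> F n \<Longrightarrow> Y \<in> F n \<Longrightarrow> X \<union> Y \<in> F n"
    and complement: "X \<in> F n \<Longrightarrow> tuples (ultraproduct U Gs) n - X \<in> F n"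
    and projection: "X \<in> F (n + m) \<Longrightarrow> take n ` X \<in> F n"
    and permutation: "X \<in> F n \<Longrightarrow> p permutes {..<n} \<Longrightarrow> permute_list p ` X \<in> F n"
    and multiplication: "Z \<in> F n \<Longrightarrow>
      {x @ y | x y. x \<in> tuples (ultraproduct U Gs) n \<and> y \<in> tuples (ultraproduct U Gs) n \<and>
         map2 (\<lambda>s t. s \<otimes>\<^bsub>ultraproduct U Gs\<^esub> t) x y \<in> Z} \<in> F (2 * n)"
    and measure: "Z \<in> F (k + m) \<Longrightarrow> q \<in> \<rat> \<Longrightarrow> 0 \<le> q \<Longrightarrow> q \<le> 1 \<Longrightarrow>
      \<exists>Y \<in> F m.
        {y \<in> tuples (ultraproduct U Gs) m.
           density U Gs k (fibre (ultraproduct U Gs) k Z y) > q} \<subseteq> Y \<and>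
        Y \<subseteq> {y \<in> tuples (ultraproduct U Gs) m.
           density U Gs k (fibre (ultraproduct U Gs) k Z y) \<ge> q}"

definition defined_over ::
    "'g monoid \<Rightarrow> (nat \<Rightarrow> 'g list set set) \<Rightarrow> 'g set \<Rightarrow> nat \<Rightarrow> 'g list set set" where
  "defined_over G F A n = {fibre G n Y a | Y a. set a \<subseteq> A \<and> Y \<in> F (n + length a)}"

definition rich :: "'g monoid \<Rightarrow> (nat \<Rightarrow> 'g list set set) \<Rightarrow> 'g set \<Rightarrow> bool" where
  "rich G F M \<longleftrightarrow> M \<subseteq> carrier G \<and>
     (\<forall>n. \<forall>X \<in> defined_over G F M n. X \<noteq> {} \<longrightarrow> (\<exists>x \<in> X. set x \<subseteq> M))"

section \<open>Types, density and good position\<close>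

definition tp :: "'g monoid \<Rightarrow> (nat \<Rightarrow> 'g list set set) \<Rightarrow> 'g set \<Rightarrow> 'g list \<Rightarrow> 'g list set" where
  "tp G F A b = \<Inter> {X \<in> defined_over G F A (length b). b \<in> X}"

text \<open>The internal sets that are considered are those of the tame family, with arbitrary
  parameters. For \<open>P\<close> an intersection of countably many sets defined over \<open>A\<close>, it makes no
  difference, by saturation, whether arbitrary internal sets, or only those defined over
  \<open>A\<close>, are allowed instead.\<close>

definition dense_set ::
    "nat filter \<Rightarrow> (nat \<Rightarrow> 'a monoid) \<Rightarrow> (nat \<Rightarrow> 'a ultra list set set) \<Rightarrow> nat \<Rightarrow>
     'a ultra list set \<Rightarrow> bool" where
  "dense_set U Gs F n P \<longleftrightarrow>
     \<not> (\<exists>X \<in> defined_over (ultraproduct U Gs) F (carrier (ultraproduct U Gs)) n.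
          density U Gs n X = 0 \<and> P \<subseteq> X)"

definition dense_over ::
    "nat filter \<Rightarrow> (nat \<Rightarrow> 'a monoid) \<Rightarrow> (nat \<Rightarrow> 'a ultra list set set) \<Rightarrow> 'a ultra set \<Rightarrow>
     'a ultra list \<Rightarrow> bool" where
  "dense_over U Gs F A b \<longleftrightarrow> dense_set U Gs F (length b) (tp (ultraproduct U Gs) F A b)"

definition good_position ::
    "nat filter \<Rightarrow> (nat \<Rightarrow> 'a monoid) \<Rightarrow> (nat \<Rightarrow> 'a ultra list set set) \<Rightarrow> 'a ultra set \<Rightarrow>
     'a ultra list list \<Rightarrow> bool" where
  "good_position U Gs F A bs \<longleftrightarrow>
     (\<forall>i < length bs. dense_over U Gs F (A \<union> (\<Union>j<i. set (bs ! j))) (bs ! i))"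

definition GP ::
    "nat filter \<Rightarrow> (nat \<Rightarrow> 'a monoid) \<Rightarrow> (nat \<Rightarrow> 'a ultra list set set) \<Rightarrow> 'a ultra set \<Rightarrow>
     'a ultra list set \<Rightarrow> 'a ultra list set \<Rightarrow> 'a ultra list set" where
  "GP U Gs F M P Q =
     {a @ b | a b. a \<in> P \<and> b \<in> Q \<and>
        (good_position U Gs F M [a, b] \<or> good_position U Gs F M [b, a])}"

section \<open>Almost sure stability\<close>

definition half_graphs ::
    "nat \<Rightarrow> 'g list set \<Rightarrow> 'g list set \<Rightarrow> 'g list set \<Rightarrow> 'g list set" where
  "half_graphs k X Y S =
     {concat (map2 (@) as bs) | as bs.
        length as = k \<and> length bs = k \<and> set as \<subseteq> X \<and> set bs \<subseteq> Y \<and>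
        (\<forall>i<k. \<forall>j<k. as ! i @ bs ! j \<in> S \<longleftrightarrow> i \<le> j)}"

definition almost_surely_stable ::
    "nat filter \<Rightarrow> (nat \<Rightarrow> 'a monoid) \<Rightarrow> nat \<Rightarrow> nat \<Rightarrow> nat \<Rightarrow>
     'a ultra list set \<Rightarrow> 'a ultra list set \<Rightarrow> 'a ultra list set \<Rightarrow> bool" where
  "almost_surely_stable U Gs k n m X Y S \<longleftrightarrow>
     density U Gs ((n + m) * k) (half_graphs k X Y S) = 0"

section \<open>The density is well defined\<close>

lemma internal_set_subsetD:
  assumes ns: "nonstandard_finite_group U Gs"
    and Xs: "\<And>n. Xs n \<subseteq> tuples (Gs n) k"
    and sub: "internal_set U Gs k Xs \<subseteq> internal_set U Gs k Ys"
  shows "\<forall>\<^sub>F n in U. Xs n \<subseteq> Ys n"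
proof (rule ccontr)
  have uf: "eventually P U \<or> (\<forall>\<^sub>F n in U. \<not> P n)" for P
    using ns by (auto simp: nonstandard_finite_group_def ultrafilter_def)
  have nb: "U \<noteq> bot" and grp: "\<And>n. group (Gs n)"
    using ns by (auto simp: nonstandard_finite_group_def ultrafilter_def)
  assume "\<not> ?thesis"
  then have ev: "\<forall>\<^sub>F n in U. \<not> Xs n \<subseteq> Ys n" using uf by blast
  define t where "t n = (if Xs n \<subseteq> Ys n then replicate k \<one>\<^bsub>Gs n\<^esub>
                         else SOME x. x \<in> Xs n - Ys n)" for n
  have t1: "t n \<in> Xs n - Ys n" if "\<not> Xs n \<subseteq> Ys n" for n
    using that someI_ex[of "\<lambda>x. x \<in> Xs n - Ys n"] by (auto simp: t_def)
  have t2: "t n \<in> tuples (Gs n) k" for n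
  proof (cases "Xs n \<subseteq> Ys n")
    case True
    then show ?thesis
      using group.is_monoid[OF grp[of n], THEN monoid.one_closed] by (auto simp: t_def tuples_def)
  next
    case False
    then show ?thesis using t1[of n] Xs[of n] by auto
  qed
  define gs where "gs = map (\<lambda>i n. t n ! i) [0..<k]"
  have at: "map (\<lambda>g. g n) gs = t n" for n
    using t2[of n] by (auto simp: gs_def tuples_def intro: nth_equalityI)
  have seq: "set gs \<subseteq> sequences Gs"
    using t2 nth_mem by (fastforce simp: gs_def sequences_def tuples_def)
  have len: "length gs = k" by (simp add: gs_def)
  have "\<forall>\<^sub>F n in U. t n \<in> Xs n" using ev by eventually_elim (use t1 in blast)
  then have "\<forall>\<^sub>F n in U. map (\<lambda>g. g n) gs \<in> Xs n" by (simp only: at)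
  with seq len have "map (ultra_class U Gs) gs \<in> internal_set U Gs k Xs"
    unfolding internal_set_def by blast
  then obtain hs where hs: "map (ultra_class U Gs) gs = map (ultra_class U Gs) hs"
      "length hs = k" "set hs \<subseteq> sequences Gs" "\<forall>\<^sub>F n in U. map (\<lambda>g. g n) hs \<in> Ys n"
    using sub unfolding internal_set_def by blast
  have "\<forall>\<^sub>F n in U. (gs ! i) n = (hs ! i) n" if "i < k" for i
  proof -
    have cls: "ultra_class U Gs (gs ! i) = ultra_class U Gs (hs ! i)"
      using arg_cong[OF hs(1), of "\<lambda>xs. xs ! i"] that len hs(2) by simp
    have "hs ! i \<in> ultra_class U Gs (hs ! i)"
      using hs(2,3) that by (auto simp: ultra_class_def ultra_rel_def)
    then show ?thesis using cls by (auto simp: ultra_class_def ultra_rel_def)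
  qed
  then have "\<forall>\<^sub>F n in U. \<forall>i\<in>{..<k}. (gs ! i) n = (hs ! i) n"
    by (intro eventually_ball_finite) auto
  with hs(4) ev have "\<forall>\<^sub>F n in U. False"
  proof eventually_elim
    case (elim n)
    have "map (\<lambda>g. g n) gs = map (\<lambda>g. g n) hs"
      using elim(3) len hs(2) by (auto intro: nth_equalityI)
    then show False using at[of n] elim(1,2) t1[of n] by auto
  qed
  then show False using nb by simp
qed

lemma density_tendsto:
  assumes ns: "nonstandard_finite_group U Gs"
    and Xs: "\<And>n. Xs n \<subseteq> tuples (Gs n) k"
  shows "((\<lambda>n. real (card (Xs n)) / real (order (Gs n)) ^ k)
           \<longlongrightarrow> density U Gs k (internal_set U Gs k Xs)) U"
proof -
  let ?f = "\<lambda>Xs n. real (card (Xs n)) / real (order (Gs n)) ^ k"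
  have uf: "eventually P U \<or> (\<forall>\<^sub>F n in U. \<not> P n)" for P
    using ns by (auto simp: nonstandard_finite_group_def ultrafilter_def)
  have nb: "U \<noteq> bot" and grp: "\<And>n. group (Gs n)" and fin: "\<And>n. finite (carrier (Gs n))"
    using ns by (auto simp: nonstandard_finite_group_def ultrafilter_def)
  have "?f Xs n \<in> {0..1}" for n
  proof -
    have "tuples (Gs n) k = {x. set x \<subseteq> carrier (Gs n) \<and> length x = k}"
      by (auto simp: tuples_def)
    then have "card (Xs n) \<le> order (Gs n) ^ k"
      using card_mono[OF _ Xs[of n]] card_lists_length_eq[OF fin[of n], of k]
        finite_lists_length_eq[OF fin[of n], of k] by (simp add: order_def)
    then have "real (card (Xs n)) \<le> real (order (Gs n)) ^ k"
      by (metis of_nat_le_iff of_nat_power)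
    then show ?thesis by (auto simp: divide_le_eq_1)
  qed
  then have bounds: "\<And>n. ?f Xs n \<in> {0..1}" .
  have "\<exists>r. (?f Xs \<longlongrightarrow> r) U"
  proof (rule ccontr)
    assume "\<not> ?thesis"
    then have "\<exists>S. open S \<and> r \<in> S \<and> \<not> (\<forall>\<^sub>F n in U. ?f Xs n \<in> S)" for r
      using topological_tendstoI[of r "?f Xs" U] by blast
    then have "\<exists>S. \<forall>r. open (S r) \<and> r \<in> S r \<and> \<not> (\<forall>\<^sub>F n in U. ?f Xs n \<in> S r)"
      by (intro choice allI)
    then obtain S where S: "\<And>r. open (S r)" "\<And>r. r \<in> S r"
        "\<And>r. \<not> (\<forall>\<^sub>F n in U. ?f Xs n \<in> S r)" by blast
    obtain D where D: "finite D" "{0..1} \<subseteq> (\<Union>r\<in>D. S r)"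
    proof (rule compactE_image[OF compact_Icc[of "0::real" 1], of "{0..1}" S])
      show "{0..1} \<subseteq> (\<Union>r\<in>{0..1}. S r)" using S(2) by blast
    qed (use S(1) in auto)
    have "\<forall>\<^sub>F n in U. \<forall>r\<in>D. ?f Xs n \<notin> S r"
      using D(1)
    proof (rule eventually_ball_finite)
      have "\<forall>\<^sub>F n in U. ?f Xs n \<notin> S r" for r
        using uf[of "\<lambda>n. ?f Xs n \<in> S r"] S(3)[of r] by simp
      then show "\<forall>r\<in>D. \<forall>\<^sub>F n in U. ?f Xs n \<notin> S r" by simp
    qed
    then have "\<forall>\<^sub>F n in U. False"
    proof eventually_elim
      case (elim n)
      then show False using bounds[of n] D(2) by blast
    qed
    then show False using nb by simp
  qed
  then obtain r where lim: "(?f Xs \<longlongrightarrow> r) U" by blast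
  have "density U Gs k (internal_set U Gs k Xs) = r"
    unfolding density_def
  proof (rule the_equality)
    show "\<exists>Ys. (\<forall>n. Ys n \<subseteq> tuples (Gs n) k) \<and>
        internal_set U Gs k Xs = internal_set U Gs k Ys \<and> (?f Ys \<longlongrightarrow> r) U"
      using Xs lim by blast
  next
    fix s assume "\<exists>Ys. (\<forall>n. Ys n \<subseteq> tuples (Gs n) k) \<and>
        internal_set U Gs k Xs = internal_set U Gs k Ys \<and> (?f Ys \<longlongrightarrow> s) U"
    then obtain Ys where Ys: "\<And>n. Ys n \<subseteq> tuples (Gs n) k"
        "internal_set U Gs k Xs = internal_set U Gs k Ys" "(?f Ys \<longlongrightarrow> s) U" by blast
    have "\<forall>\<^sub>F n in U. Xs n \<subseteq> Ys n"
      by (rule internal_set_subsetD[OF ns Xs]) (simp add: Ys(2))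
    moreover have "\<forall>\<^sub>F n in U. Ys n \<subseteq> Xs n"
      by (rule internal_set_subsetD[OF ns Ys(1)]) (simp add: Ys(2))
    ultimately have "\<forall>\<^sub>F n in U. ?f Ys n = ?f Xs n"
      by eventually_elim simp
    then have "(?f Xs \<longlongrightarrow> s) U" using Ys(3) by (rule Lim_transform_eventually[rotated])
    then show "s = r" using lim nb tendsto_unique by blast
  qed
  then show ?thesis using lim by simp
qed

end

theory Submission
  imports Defs "HOL-Library.Multiset"
begin

text \<open>Elements are always chosen dense over \<open>M\<close> and the previously chosen ones. By Fubini such a
  choice is jointly dense over \<open>M\<close>, in any order, so it cannot contain a half-graph of height \<open>k\<close>.
  In particular \<open>X\<close> carries no tall binary trees of positive measure, and cutting along sections
  \<open>S\<^sup>b\<close> must end in pieces \<open>\<epsilon>\<close>-homogeneous for all \<open>b\<close> outside null sets. Exhausting \<open>X\<close> by such pieces,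
  with arbitrary parameters, makes the family of sections totally bounded in measure, so by richness
  sections are approximated by sets over \<open>M\<close>, and then the homogeneous pieces exist over \<open>M\<close> too.

  If \<open>GP\<close> meets both \<open>S\<close> and its complement then, up to exchanging the two sides,
  \<open>S\<^sub>a\<close> meets every set of \<open>tp(b/M)\<close> and the complement of \<open>S\<^sup>b\<close> meets every set of \<open>tp(a/M)\<close> in
  positive measure. Homogeneous pieces \<open>Q\<^sub>1, P\<^sub>1, Q\<^sub>2, P\<^sub>2, \<dots>\<close> over \<open>M\<close>, each taken inside sets of the types that
  have already decided the previous pieces, are such that \<open>P\<^sub>i \<times> Q\<^sub>j\<close> lies in \<open>S\<close> for \<open>j \<le> i\<close> and in the
  complement otherwise, up to small relative measure; choosing one element in each gives a half-graph.\<close>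

section \<open>Finitely additive measures\<close>

text \<open>A type over \<open>M\<close> tells of \<open>b\<close> only to which sets over
  \<open>M\<close> it belongs. A typical \<open>b\<close> is therefore sure to avoid the exceptional
  null set of a homogeneous piece only if that null set is over \<open>M\<close>, whereas cutting
  along a section brings in a foreign parameter. This is why the same cutting argument is run twice:
  with all parameters, where a section may be used as it stands, and over \<open>M\<close>, where a
  close set replaces it. The factor 2 in the constants \<open>(\<epsilon> / 2) ^ d\<close> pays for
  the replacement. A tame family defines the condition of having density above \<open>q\<close> only
  up to its boundary. Hence a cut-off is always a pair \<open>q < q'\<close>, nothing is claimed
  between the two values, and several constants are halved or doubled for this reason alone. The
  passage from trees to half-graphs is the combinatorics of Hodges for binary trees and ladders,
  where a node is not a point but a set of positive measure. All estimates rest on finite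
  additivity; countable saturation enters where a generic element is chosen.\<close>

locale content =
  fixes \<Omega> :: "'a set" and \<A> :: "'a set set" and \<mu> :: "'a set \<Rightarrow> real"
  assumes space: "\<Omega> \<in> \<A>"
    and subset_space: "P \<in> \<A> \<Longrightarrow> P \<subseteq> \<Omega>"
    and Int: "P \<in> \<A> \<Longrightarrow> Q \<in> \<A> \<Longrightarrow> P \<inter> Q \<in> \<A>"
    and Diff: "P \<in> \<A> \<Longrightarrow> Q \<in> \<A> \<Longrightarrow> P - Q \<in> \<A>"
    and nonneg: "P \<in> \<A> \<Longrightarrow> 0 \<le> \<mu> P"
    and split: "P \<in> \<A> \<Longrightarrow> Q \<in> \<A> \<Longrightarrow> \<mu> P = \<mu> (P \<inter> Q) + \<mu> (P - Q)"
begin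

lemma empty: "{} \<in> \<A>"
  using Diff[OF space space] by simp

lemma measure_empty [simp]: "\<mu> {} = 0"
  using split[OF space space] by simp

lemma Un: "P \<in> \<A> \<Longrightarrow> Q \<in> \<A> \<Longrightarrow> P \<union> Q \<in> \<A>"
proof -
  assume a: "P \<in> \<A>" "Q \<in> \<A>"
  have "P \<union> Q = \<Omega> - ((\<Omega> - P) \<inter> (\<Omega> - Q))"
    using subset_space a by blast
  then show ?thesis using a by (simp add: Int Diff space)
qed

lemma mono: "P \<in> \<A> \<Longrightarrow> Q \<in> \<A> \<Longrightarrow> P \<subseteq> Q \<Longrightarrow> \<mu> P \<le> \<mu> Q"
  using split[of Q P] nonneg[OF Diff[of Q P]] by (simp add: Int_absorb1)

lemma measure_Un_le: "P \<in> \<A> \<Longrightarrow> Q \<in> \<A> \<Longrightarrow> \<mu> (P \<union> Q) \<le> \<mu> P + \<mu> Q"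
  using split[OF Un[of P Q], of P] mono[of "P \<union> Q - P" Q, OF Diff[OF Un]]
  by (auto simp: Int_absorb1)

lemma measure_le_Un:
  "P \<in> \<A> \<Longrightarrow> Q \<in> \<A> \<Longrightarrow> Q' \<in> \<A> \<Longrightarrow> P \<subseteq> Q \<union> Q' \<Longrightarrow> \<mu> P \<le> \<mu> Q + \<mu> Q'"
  using mono[of P "Q \<union> Q'"] measure_Un_le[of Q Q'] Un by force

lemma positive_split:
  assumes "P \<in> \<A>" "Q \<in> \<A>" "Q' \<in> \<A>" "P \<subseteq> Q \<union> Q'" "0 < \<mu> P"
  shows "0 < \<mu> (P \<inter> Q) \<or> 0 < \<mu> (P \<inter> Q')"
  using measure_le_Un[of P "P \<inter> Q" "P \<inter> Q'"] assms Int by fastforce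

lemma measure_Diff_UN_ge:
  assumes "finite I" "P \<in> \<A>" "\<And>i. i \<in> I \<Longrightarrow> Q i \<in> \<A>" "\<And>i. i \<in> I \<Longrightarrow> \<mu> (P \<inter> Q i) \<le> c"
  shows "P - (\<Union>i\<in>I. Q i) \<in> \<A> \<and> \<mu> P - real (card I) * c \<le> \<mu> (P - (\<Union>i\<in>I. Q i))"
  using assms(1,3,4)
proof (induction I rule: finite_induct)
  case empty
  then show ?case using assms(2) by simp
next
  case (insert i I)
  let ?D = "P - (\<Union>i\<in>I. Q i)"
  have IH: "?D \<in> \<A>" "\<mu> P - real (card I) * c \<le> \<mu> ?D"
    using insert by auto
  have eq: "P - (\<Union>i\<in>insert i I. Q i) = ?D - Q i" by blast
  have "\<mu> (?D \<inter> Q i) \<le> \<mu> (P \<inter> Q i)"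
    by (rule mono) (use IH insert.prems assms(2) Int in auto)
  also have "\<dots> \<le> c" using insert.prems by simp
  finally have "\<mu> ?D - c \<le> \<mu> (?D - Q i)"
    using split[of ?D "Q i"] IH insert.prems by simp
  moreover have "real (card (insert i I)) * c = real (card I) * c + c"
    using insert.hyps by (simp add: algebra_simps)
  ultimately show ?case unfolding eq using IH insert.prems Diff by simp
qed

lemma Ball:
  assumes "finite I" "\<And>i. i \<in> I \<Longrightarrow> Q i \<in> \<A>"
  shows "{z \<in> \<Omega>. \<forall>i\<in>I. z \<in> Q i} \<in> \<A>"
  using assms
proof (induction I rule: finite_induct)
  case empty
  then show ?case by (simp add: space)
next
  case (insert i I)
  have "{z \<in> \<Omega>. \<forall>j\<in>insert i I. z \<in> Q j} = Q i \<inter> {z \<in> \<Omega>. \<forall>j\<in>I. z \<in> Q j}" by auto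
  then show ?case using insert Int by auto
qed

text \<open>Remove pieces one after another. Each takes at least the fraction \<open>c\<close>, so
  after \<open>t\<close> rounds a part of relative measure at most \<open>(1 - c) ^ t\<close>
  remains, and only for that part nothing is known about \<open>H\<close>. Letting \<open>t\<close>
  grow takes the place of a countable union. The pieces come from the smaller algebra
  \<open>\<B>\<close>, while \<open>H\<close> is any set of \<open>\<A>\<close>.\<close>

lemma exhaustion:
  assumes sub: "\<B> \<subseteq> \<A>" and dB: "\<And>P Q. P \<in> \<B> \<Longrightarrow> Q \<in> \<B> \<Longrightarrow> P - Q \<in> \<B>"
    and H: "H \<in> \<A>" and c: "0 < c" "c \<le> 1" and e: "0 \<le> e"
    and piece: "\<And>P. P \<in> \<B> \<Longrightarrow> P \<subseteq> P\<^sub>0 \<Longrightarrow> 0 < \<mu> P \<Longrightarrow>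
      \<exists>P'\<in>\<B>. P' \<subseteq> P \<and> c * \<mu> P \<le> \<mu> P' \<and> \<mu> (P' - H) \<le> e * \<mu> P'"
    and P0: "P\<^sub>0 \<in> \<B>"
  shows "\<mu> (P\<^sub>0 - H) \<le> e * \<mu> P\<^sub>0"
proof -
  have step: "\<mu> (P - H) \<le> (e + (1 - c) ^ t) * \<mu> P" if "P \<in> \<B>" "P \<subseteq> P\<^sub>0" for P t
    using that
  proof (induction t arbitrary: P)
    case 0
    have "\<mu> (P - H) \<le> \<mu> P" by (rule mono) (use 0 sub H Diff in auto)
    moreover have "0 \<le> e * \<mu> P" using e nonneg 0 sub by auto
    ultimately show ?case by (simp add: algebra_simps)
  next
    case (Suc t)
    have PA: "P \<in> \<A>" using Suc sub by blast
    show ?case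
    proof (cases "0 < \<mu> P")
      case True
      from piece[OF Suc.prems True] obtain P' where P': "P' \<in> \<B>" "P' \<subseteq> P" "c * \<mu> P \<le> \<mu> P'"
        "\<mu> (P' - H) \<le> e * \<mu> P'" by blast
      have P'A: "P' \<in> \<A>" using P' sub by blast
      have "\<mu> (P - P' - H) \<le> (e + (1 - c) ^ t) * \<mu> (P - P')"
        by (rule Suc.IH) (use Suc.prems P' dB in auto)
      moreover have "\<mu> (P - H) \<le> \<mu> (P' - H) + \<mu> (P - P' - H)"
        by (rule measure_le_Un) (use PA P'A H Diff in auto)
      moreover have m: "\<mu> (P - P') = \<mu> P - \<mu> P'"
        using split[OF PA P'A] P'(2) by (simp add: Int_absorb1)
      moreover have "(1 - c) ^ t * (\<mu> P - \<mu> P') \<le> (1 - c) ^ t * ((1 - c) * \<mu> P)"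
        by (rule mult_left_mono) (use P' c in \<open>auto simp: algebra_simps\<close>)
      ultimately show ?thesis using P'(4) by (simp add: algebra_simps)
    next
      case False
      then have "\<mu> P = 0" using nonneg[OF PA] by simp
      moreover have "\<mu> (P - H) \<le> \<mu> P" by (rule mono) (use PA H Diff in auto)
      ultimately show ?thesis by simp
    qed
  qed
  have "(\<lambda>t. (e + (1 - c) ^ t) * \<mu> P\<^sub>0) \<longlonglongrightarrow> (e + 0) * \<mu> P\<^sub>0"
    by (intro tendsto_intros LIMSEQ_realpow_zero) (use c in auto)
  then show ?thesis
    by (intro LIMSEQ_le_const[of _ "e * \<mu> P\<^sub>0"]) (use step P0 in auto)
qed

end

section \<open>Relations without half-graphs\<close>

text \<open>A relation is studied through the sections \<open>sect b\<close>. \<open>Gen as bs\<close> abstracts that the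
  joint tuple formed by the lists \<open>as\<close> and \<open>bs\<close> is dense over the base model; \<open>XM\<close> and \<open>YM\<close>
  are the sets defined over that model.\<close>

locale measured_relation =
  X: content SX \<X> \<mu> + Y: content SY \<Y> \<nu> + XM: content SX XM \<mu> + YM: content SY YM \<nu>
  for SX :: "'x set" and \<X> \<mu> XM and SY :: "'y set" and \<Y> \<nu> YM +
  fixes R :: "'x \<Rightarrow> 'y \<Rightarrow> bool" and sect :: "'y \<Rightarrow> 'x set"
    and Gen :: "'x list \<Rightarrow> 'y list \<Rightarrow> bool" and k :: nat
  assumes sect_def: "sect b = {x \<in> SX. R x b}"
    and XM_subset: "XM \<subseteq> \<X>" and YM_subset: "YM \<subseteq> \<Y>"
    and sect: "b \<in> SY \<Longrightarrow> sect b \<in> \<X>"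
    and cosect: "a \<in> SX \<Longrightarrow> {y \<in> SY. R a y} \<in> \<Y>"
    and definable: "P \<in> \<X> \<Longrightarrow> q < q' \<Longrightarrow>
      \<exists>E\<in>\<Y>. (\<forall>b\<in>E. q \<le> \<mu> (P \<inter> sect b)) \<and> (\<forall>b\<in>SY. q' \<le> \<mu> (P \<inter> sect b) \<longrightarrow> b \<in> E)"
    and definable_M: "P \<in> XM \<Longrightarrow> q < q' \<Longrightarrow>
      \<exists>E\<in>YM. (\<forall>b\<in>E. q \<le> \<mu> (P \<inter> sect b)) \<and> (\<forall>b\<in>SY. q' \<le> \<mu> (P \<inter> sect b) \<longrightarrow> b \<in> E)"
    and rich: "B \<in> YM \<Longrightarrow> D \<in> \<Y> \<Longrightarrow> D \<subseteq> B \<Longrightarrow> 0 < \<nu> D \<Longrightarrow> b \<in> SY \<Longrightarrow> 0 < \<eta> \<Longrightarrow>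
      (\<And>y. y \<in> D \<Longrightarrow> \<mu> (sect y - sect b) + \<mu> (sect b - sect y) \<le> \<eta>) \<Longrightarrow>
      \<exists>V\<in>YM. V \<subseteq> B \<and> 0 < \<nu> V \<and>
        (\<exists>P\<in>XM. \<forall>y\<in>V. \<mu> (sect y - P) + \<mu> (P - sect y) \<le> 2 * \<eta>)"
    and Gen_Nil: "Gen [] []"
    and Gen_X: "Gen as bs \<Longrightarrow> P \<in> \<X> \<Longrightarrow> 0 < \<mu> P \<Longrightarrow> \<exists>a\<in>P. Gen (a # as) bs"
    and Gen_Y: "Gen as bs \<Longrightarrow> Q \<in> \<Y> \<Longrightarrow> 0 < \<nu> Q \<Longrightarrow> \<exists>b\<in>Q. Gen as (b # bs)"
    and no_half_graph: "Gen as bs \<Longrightarrow> set as' \<subseteq> set as \<Longrightarrow> set bs' \<subseteq> set bs \<Longrightarrow>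
      length as' = k \<Longrightarrow> length bs' = k \<Longrightarrow> \<not> (\<forall>i<k. \<forall>j<k. R (as' ! i) (bs' ! j) \<longleftrightarrow> i \<le> j)"
begin

text \<open>Complete binary trees of depth \<open>d\<close> of sections with nodes in \<open>B\<close>, where each node ranges over a
  set of positive measure depending on its predecessors and each leaf has measure at least \<open>\<theta>\<close>.\<close>

primrec split_tree :: "real \<Rightarrow> nat \<Rightarrow> 'x set \<Rightarrow> 'y set \<Rightarrow> bool" where
  "split_tree \<theta> 0 P B \<longleftrightarrow> \<theta> \<le> \<mu> P"
| "split_tree \<theta> (Suc d) P B \<longleftrightarrow> (\<exists>D\<in>\<Y>. D \<subseteq> B \<and> 0 < \<nu> D \<and>
     (\<forall>b\<in>D. split_tree \<theta> d (P \<inter> sect b) B \<and> split_tree \<theta> d (P - sect b) B))"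

text \<open>A leaf is the root cut by sections and their complements, so changing the root takes at
  most \<open>P - P'\<close> from any leaf, and the same node sets \<open>D\<close> serve
  again.\<close>

lemma split_tree_approx:
  "split_tree \<theta> d P B \<Longrightarrow> P \<in> \<X> \<Longrightarrow> P' \<in> \<X> \<Longrightarrow> \<mu> (P - P') \<le> \<eta> \<Longrightarrow> split_tree (\<theta> - \<eta>) d P' B"
proof (induction d arbitrary: P P')
  case 0
  have "\<mu> P \<le> \<mu> P' + \<mu> (P - P')"
    by (rule X.measure_le_Un) (use 0 X.Diff in auto)
  then show ?case using 0 by simp
next
  case (Suc d)
  then obtain D where D: "D \<in> \<Y>" "D \<subseteq> B" "0 < \<nu> D"
    "\<And>b. b \<in> D \<Longrightarrow> split_tree \<theta> d (P \<inter> sect b) B \<and> split_tree \<theta> d (P - sect b) B" by auto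
  have "split_tree (\<theta> - \<eta>) d (P' \<inter> sect b) B \<and> split_tree (\<theta> - \<eta>) d (P' - sect b) B"
    if b: "b \<in> D" for b
  proof -
    have bX: "sect b \<in> \<X>" using b D(1) Y.subset_space sect by blast
    have "\<mu> (P \<inter> sect b - P' \<inter> sect b) \<le> \<mu> (P - P')" "\<mu> (P - sect b - (P' - sect b)) \<le> \<mu> (P - P')"
      by (rule X.mono; use Suc.prems bX X.Diff X.Int in \<open>auto\<close>)+
    then show ?thesis
      using Suc.IH[of "P \<inter> sect b" "P' \<inter> sect b"] Suc.IH[of "P - sect b" "P' - sect b"]
        D(4)[OF b] Suc.prems bX X.Diff X.Int by simp
  qed
  then show ?case using D by auto
qed

lemma split_tree_mono:
  "split_tree \<theta> d P B \<Longrightarrow> P \<in> \<X> \<Longrightarrow> P' \<in> \<X> \<Longrightarrow> P \<subseteq> P' \<Longrightarrow> split_tree \<theta> d P' B"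
  using split_tree_approx[of \<theta> d P B P' 0] by (simp add: Diff_eq_empty_iff[THEN iffD2])

lemma split_tree_antimono:
  "split_tree \<theta> d P B \<Longrightarrow> P \<in> \<X> \<Longrightarrow> \<theta>' \<le> \<theta> \<Longrightarrow> split_tree \<theta>' d P B"
  using split_tree_approx[of \<theta> d P B P "\<theta> - \<theta>'"] by simp

lemma split_tree_measure:
  "split_tree \<theta> d P B \<Longrightarrow> P \<in> \<X> \<Longrightarrow> \<theta> \<le> \<mu> P"
proof (induction d arbitrary: P)
  case (Suc d)
  then obtain D where D: "D \<in> \<Y>" "0 < \<nu> D" "\<And>b. b \<in> D \<Longrightarrow> split_tree \<theta> d (P \<inter> sect b) B" by auto
  from D(2) obtain b where b: "b \<in> D" by fastforce
  then have bX: "sect b \<in> \<X>" using D(1) Y.subset_space sect by blast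
  have "\<theta> \<le> \<mu> (P \<inter> sect b)" using Suc b D bX X.Int by blast
  also have "\<dots> \<le> \<mu> P" by (rule X.mono) (use Suc bX X.Int in auto)
  finally show ?case .
qed simp

text \<open>Pigeonhole for binary trees. One of \<open>D \<inter> B\<^sub>1\<close> and
  \<open>D \<inter> B\<^sub>2\<close> has positive measure, say the former. If \<open>P\<close>
  carries no tree of depth \<open>j\<close> with nodes in \<open>B\<^sub>2\<close>, then neither do
  its subsets on the two branches, so by induction both branches carry trees of depth
  \<open>i - 1\<close> in \<open>B\<^sub>1\<close>, to be joined under the root set
  \<open>D \<inter> B\<^sub>1\<close>.\<close>

lemma split_tree_Un:
  "split_tree \<theta> (i + j) P B \<Longrightarrow> P \<in> \<X> \<Longrightarrow> B\<^sub>1 \<in> \<Y> \<Longrightarrow> B\<^sub>2 \<in> \<Y> \<Longrightarrow> B \<subseteq> B\<^sub>1 \<union> B\<^sub>2 \<Longrightarrow>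
   split_tree \<theta> i P B\<^sub>1 \<or> split_tree \<theta> j P B\<^sub>2"
proof (induction "i + j" arbitrary: i j P)
  case 0
  then show ?case by simp
next
  case (Suc d)
  show ?case
  proof (cases "i = 0 \<or> j = 0")
    case True
    then show ?thesis using split_tree_measure[OF Suc.prems(1,2)] by auto
  next
    case False
    then obtain i' j' where ij: "i = Suc i'" "j = Suc j'" by (meson not0_implies_Suc)
    from Suc.prems(1) obtain D where D: "D \<in> \<Y>" "D \<subseteq> B" "0 < \<nu> D"
      "\<And>b. b \<in> D \<Longrightarrow> split_tree \<theta> d (P \<inter> sect b) B \<and> split_tree \<theta> d (P - sect b) B"
      unfolding Suc(2)[symmetric] by auto
    have S: "P \<inter> sect b \<in> \<X>" "P - sect b \<in> \<X>" if "b \<in> D" for b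
      using that D(1) Y.subset_space sect Suc.prems(2) X.Int X.Diff by blast+
    have D1: "D \<inter> B\<^sub>1 \<in> \<Y>" and D2: "D \<inter> B\<^sub>2 \<in> \<Y>" using D Suc.prems Y.Int by auto
    have "0 < \<nu> (D \<inter> B\<^sub>1) \<or> 0 < \<nu> (D \<inter> B\<^sub>2)"
      by (rule Y.positive_split) (use D Suc.prems in auto)
    then show ?thesis
    proof
      assume pos: "0 < \<nu> (D \<inter> B\<^sub>1)"
      show ?thesis
      proof (cases "split_tree \<theta> j P B\<^sub>2")
        case False
        have "split_tree \<theta> i' (P \<inter> sect b) B\<^sub>1 \<and> split_tree \<theta> i' (P - sect b) B\<^sub>1" if b: "b \<in> D" for b
        proof -
          have "d = i' + j" using Suc(2) ij by simp
          then have "split_tree \<theta> i' (P \<inter> sect b) B\<^sub>1 \<or> split_tree \<theta> j (P \<inter> sect b) B\<^sub>2"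
            "split_tree \<theta> i' (P - sect b) B\<^sub>1 \<or> split_tree \<theta> j (P - sect b) B\<^sub>2"
            using Suc.hyps(1)[of i' j] D(4)[OF b] S[OF b] Suc.prems by auto
          then show ?thesis using False split_tree_mono S[OF b] Suc.prems(2)
            by (meson Diff_subset Int_lower1)
        qed
        then show ?thesis using D1 pos ij by auto
      qed simp
    next
      assume pos: "0 < \<nu> (D \<inter> B\<^sub>2)"
      show ?thesis
      proof (cases "split_tree \<theta> i P B\<^sub>1")
        case False
        have "split_tree \<theta> j' (P \<inter> sect b) B\<^sub>2 \<and> split_tree \<theta> j' (P - sect b) B\<^sub>2" if b: "b \<in> D" for b
        proof -
          have "d = i + j'" using Suc(2) ij by simp
          then have "split_tree \<theta> i (P \<inter> sect b) B\<^sub>1 \<or> split_tree \<theta> j' (P \<inter> sect b) B\<^sub>2"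
            "split_tree \<theta> i (P - sect b) B\<^sub>1 \<or> split_tree \<theta> j' (P - sect b) B\<^sub>2"
            using Suc.hyps(1)[of i j'] D(4)[OF b] S[OF b] Suc.prems by auto
          then show ?thesis using False split_tree_mono S[OF b] Suc.prems(2)
            by (meson Diff_subset Int_lower1)
        qed
        then show ?thesis using D2 pos ij by auto
      qed simp
    qed
  qed
qed

section \<open>From binary trees to half-graphs\<close>

text \<open>The closed form is \<open>2 ^ (r + 1) - 2\<close>. Each step towards a half-graph halves
  the tree by the pigeonhole and then uses up its root.\<close>

primrec depth :: "nat \<Rightarrow> nat" where
  "depth 0 = 0"
| "depth (Suc r) = Suc (depth r) + Suc (depth r)"

text \<open>The pattern is a parameter because three of them occur: \<open>\<le>\<close> and
  \<open>>\<close> are produced by the two branches of a tree, \<open>\<ge>\<close> by the final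
  choice of elements.\<close>

definition chain :: "(nat \<Rightarrow> nat \<Rightarrow> bool) \<Rightarrow> nat \<Rightarrow> 'x list \<Rightarrow> 'y list \<Rightarrow> bool" where
  "chain rel u as bs \<longleftrightarrow> length as = u \<and> length bs = u \<and>
     (\<forall>i<u. \<forall>j<u. R (as ! i) (bs ! j) \<longleftrightarrow> rel i j)"

lemma chain_Nil: "chain rel 0 [] []"
  by (simp add: chain_def)

lemma chain_le_Cons:
  "chain (\<le>) u as bs \<Longrightarrow> \<forall>y\<in>set (b # bs). R a y \<Longrightarrow> \<forall>x\<in>set as. \<not> R x b \<Longrightarrow>
   chain (\<le>) (Suc u) (a # as) (b # bs)"
  unfolding chain_def by (auto simp: nth_Cons all_set_conv_all_nth split: nat.splits)

lemma chain_greater_Cons: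
  "chain (>) u as bs \<Longrightarrow> \<forall>y\<in>set (b # bs). \<not> R a y \<Longrightarrow> \<forall>x\<in>set as. R x b \<Longrightarrow>
   chain (>) (Suc u) (a # as) (b # bs)"
  unfolding chain_def by (auto simp: nth_Cons all_set_conv_all_nth split: nat.splits)

lemma chain_ge_Cons:
  "chain (\<ge>) u as bs \<Longrightarrow> \<forall>y\<in>set bs. \<not> R a y \<Longrightarrow> \<forall>x\<in>set (a # as). R x b \<Longrightarrow>
   chain (\<ge>) (Suc u) (a # as) (b # bs)"
  unfolding chain_def by (auto simp: nth_Cons all_set_conv_all_nth split: nat.splits)

text \<open>A leaf \<open>a\<close> splits the nodes of a tree into those related to it and the others, and one of the
  two classes supports a large subtree. The root \<open>b\<close> of that subtree, together with \<open>a\<close>, becomes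
  the next step of a half-graph.\<close>

lemma split_tree_chain:
  assumes "split_tree \<theta> (depth (u + v)) P B" "0 < \<theta>" "P \<in> \<X>" "B \<in> \<Y>" "Gen as\<^sub>0 bs\<^sub>0"
  shows "\<exists>as bs as' bs'. Gen as bs \<and> set as\<^sub>0 \<subseteq> set as \<and> set bs\<^sub>0 \<subseteq> set bs \<and>
    set as' \<subseteq> set as \<inter> P \<and> set bs' \<subseteq> set bs \<inter> B \<and>
    (chain (\<le>) u as' bs' \<or> chain (>) v as' bs')"
  using assms
proof (induction "u + v" arbitrary: u v P B as\<^sub>0 bs\<^sub>0)
  case 0
  then show ?case
    by (intro exI[of _ as\<^sub>0] exI[of _ bs\<^sub>0] exI[of _ "[]"]) (auto simp: chain_Nil)
next
  case (Suc r)
  show ?case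
  proof (cases "u = 0 \<or> v = 0")
    case True
    then show ?thesis using Suc.prems(5)
      by (intro exI[of _ as\<^sub>0] exI[of _ bs\<^sub>0] exI[of _ "[]"]) (auto simp: chain_Nil)
  next
    case False
    then obtain u' v' where uv: "u = Suc u'" "v = Suc v'" by (meson not0_implies_Suc)
    have "0 < \<mu> P" using split_tree_measure[OF Suc.prems(1)] Suc.prems by simp
    then obtain a where a: "a \<in> P" "Gen (a # as\<^sub>0) bs\<^sub>0" using Gen_X Suc.prems by blast
    define B\<^sub>1 where "B\<^sub>1 = B \<inter> {y \<in> SY. R a y}"
    define B\<^sub>2 where "B\<^sub>2 = B - {y \<in> SY. R a y}"
    have "{y \<in> SY. R a y} \<in> \<Y>" using a(1) Suc.prems(3) X.subset_space cosect by blast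
    then have B12: "B\<^sub>1 \<in> \<Y>" "B\<^sub>2 \<in> \<Y>" "B \<subseteq> B\<^sub>1 \<union> B\<^sub>2"
      using Suc.prems(4) Y.Int Y.Diff by (auto simp: B\<^sub>1_def B\<^sub>2_def)
    have SY: "B \<subseteq> SY" using Suc.prems(4) Y.subset_space by blast
    have "split_tree \<theta> (Suc (depth r)) P B\<^sub>1 \<or> split_tree \<theta> (Suc (depth r)) P B\<^sub>2"
      using Suc.prems(1,3) B12 unfolding Suc(2)[symmetric] depth.simps by (intro split_tree_Un)
    then show ?thesis
    proof
      \<comment> \<open>On the branch \<open>P - sect b\<close> all later left elements are
        unrelated to \<open>b\<close>, while nodes in \<open>B\<^sub>1\<close> are related to
        \<open>a\<close>: this is what a new initial pair of a \<open>\<le>\<close>-chain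
        requires.\<close>
      assume "split_tree \<theta> (Suc (depth r)) P B\<^sub>1"
      then obtain D where D: "D \<in> \<Y>" "D \<subseteq> B\<^sub>1" "0 < \<nu> D"
        "\<And>b. b \<in> D \<Longrightarrow> split_tree \<theta> (depth r) (P - sect b) B\<^sub>1" by auto
      obtain b where b: "b \<in> D" "Gen (a # as\<^sub>0) (b # bs\<^sub>0)" using Gen_Y a(2) D by blast
      have PX: "P - sect b \<in> \<X>" using b(1) D(1) Y.subset_space sect Suc.prems(3) X.Diff by blast
      have r: "r = u' + v" using Suc(2) uv by simp
      obtain as bs as' bs' where IH: "Gen as bs" "set (a # as\<^sub>0) \<subseteq> set as" "set (b # bs\<^sub>0) \<subseteq> set bs"
        "set as' \<subseteq> set as \<inter> (P - sect b)" "set bs' \<subseteq> set bs \<inter> B\<^sub>1"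
        "chain (\<le>) u' as' bs' \<or> chain (>) v as' bs'"
        using Suc.hyps(1)[OF r, of "P - sect b" B\<^sub>1] D(4)[OF b(1)] r Suc.prems(2) PX B12(1) b(2)
        by metis
      from IH(6) show ?thesis
      proof
        assume "chain (\<le>) u' as' bs'"
        then have "chain (\<le>) u (a # as') (b # bs')"
          unfolding uv(1)
        proof (rule chain_le_Cons)
          show "\<forall>y\<in>set (b # bs'). R a y" using IH(5) D(2) b(1) by (auto simp: B\<^sub>1_def)
          show "\<forall>x\<in>set as'. \<not> R x b" using IH(4) X.subset_space[OF Suc.prems(3)] by (auto simp: sect_def)
        qed
        moreover have "set (a # as') \<subseteq> set as \<inter> P" "set (b # bs') \<subseteq> set bs \<inter> B"
          using IH a b D(2) by (auto simp: B\<^sub>1_def)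
        ultimately show ?thesis using IH(1-3) by (metis set_subset_Cons subset_trans)
      next
        assume "chain (>) v as' bs'"
        moreover have "set as' \<subseteq> set as \<inter> P" "set bs' \<subseteq> set bs \<inter> B"
          using IH by (auto simp: B\<^sub>1_def)
        ultimately show ?thesis using IH(1-3) by (metis set_subset_Cons subset_trans)
      qed
    next
      \<comment> \<open>Here nodes are unrelated to \<open>a\<close>, so the branch inside
        \<open>sect b\<close> is followed and the new pair extends a \<open>>\<close>-chain.\<close>
      assume "split_tree \<theta> (Suc (depth r)) P B\<^sub>2"
      then obtain D where D: "D \<in> \<Y>" "D \<subseteq> B\<^sub>2" "0 < \<nu> D"
        "\<And>b. b \<in> D \<Longrightarrow> split_tree \<theta> (depth r) (P \<inter> sect b) B\<^sub>2" by auto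
      obtain b where b: "b \<in> D" "Gen (a # as\<^sub>0) (b # bs\<^sub>0)" using Gen_Y a(2) D by blast
      have PX: "P \<inter> sect b \<in> \<X>" using b(1) D(1) Y.subset_space sect Suc.prems(3) X.Int by blast
      have r: "r = u + v'" using Suc(2) uv by simp
      obtain as bs as' bs' where IH: "Gen as bs" "set (a # as\<^sub>0) \<subseteq> set as" "set (b # bs\<^sub>0) \<subseteq> set bs"
        "set as' \<subseteq> set as \<inter> (P \<inter> sect b)" "set bs' \<subseteq> set bs \<inter> B\<^sub>2"
        "chain (\<le>) u as' bs' \<or> chain (>) v' as' bs'"
        using Suc.hyps(1)[OF r, of "P \<inter> sect b" B\<^sub>2] D(4)[OF b(1)] r Suc.prems(2) PX B12(2) b(2)
        by metis
      from IH(6) show ?thesis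
      proof
        assume "chain (>) v' as' bs'"
        then have "chain (>) v (a # as') (b # bs')"
          unfolding uv(2)
        proof (rule chain_greater_Cons)
          show "\<forall>y\<in>set (b # bs'). \<not> R a y" using IH(5) D(2) b(1) SY by (auto simp: B\<^sub>2_def)
          show "\<forall>x\<in>set as'. R x b" using IH(4) by (auto simp: sect_def)
        qed
        moreover have "set (a # as') \<subseteq> set as \<inter> P" "set (b # bs') \<subseteq> set bs \<inter> B"
          using IH a b D(2) by (auto simp: B\<^sub>2_def)
        ultimately show ?thesis using IH(1-3) by (metis set_subset_Cons subset_trans)
      next
        assume "chain (\<le>) u as' bs'"
        moreover have "set as' \<subseteq> set as \<inter> P" "set bs' \<subseteq> set bs \<inter> B"
          using IH by (auto simp: B\<^sub>2_def)
        ultimately show ?thesis using IH(1-3) by (metis set_subset_Cons subset_trans)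
      qed
    qed
  qed
qed

lemma no_chain_le:
  "Gen as bs \<Longrightarrow> set as' \<subseteq> set as \<Longrightarrow> set bs' \<subseteq> set bs \<Longrightarrow> \<not> chain (\<le>) k as' bs'"
  using no_half_graph[of as bs as' bs'] by (auto simp: chain_def)

text \<open>Reversing both lists turns \<open>\<ge>\<close> into \<open>\<le>\<close>.\<close>

lemma no_chain_ge:
  assumes "Gen as bs" "set as' \<subseteq> set as" "set bs' \<subseteq> set bs"
  shows "\<not> chain (\<ge>) k as' bs'"
proof
  assume c: "chain (\<ge>) k as' bs'"
  have "chain (\<le>) k (rev as') (rev bs')"
    using c by (auto simp: chain_def rev_nth)
  then show False using no_chain_le[of as bs "rev as'" "rev bs'"] assms by simp
qed

text \<open>Dropping the head of \<open>as'\<close> and the last entry of \<open>bs'\<close> shifts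
  one index, and \<open>i + 1 > j\<close> means \<open>i \<ge> j\<close>; this costs one step of
  height.\<close>

lemma no_chain_greater:
  assumes "Gen as bs" "set as' \<subseteq> set as" "set bs' \<subseteq> set bs"
  shows "\<not> chain (>) (Suc k) as' bs'"
proof
  assume c: "chain (>) (Suc k) as' bs'"
  have "chain (\<ge>) k (tl as') (butlast bs')"
    using c by (auto simp: chain_def nth_tl nth_butlast)
  moreover have "set (tl as') \<subseteq> set as" using assms(2) by (cases as') auto
  moreover have "set (butlast bs') \<subseteq> set bs" using assms(3) by (auto dest: in_set_butlastD)
  ultimately show False using no_chain_ge assms(1) by blast
qed

text \<open>The summand \<open>Suc k\<close> allows for the step that a \<open>>\<close>-chain loses
  on becoming a \<open>\<ge>\<close>-chain.\<close>

definition height :: nat where "height = depth (k + Suc k)"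

lemma no_split_tree:
  assumes "0 < \<theta>" "P \<in> \<X>"
  shows "\<not> split_tree \<theta> height P SY"
proof
  assume "split_tree \<theta> height P SY"
  from split_tree_chain[OF this[unfolded height_def] assms Y.space Gen_Nil]
  obtain as bs as' bs' where "Gen as bs" "set as' \<subseteq> set as" "set bs' \<subseteq> set bs"
    "chain (\<le>) k as' bs' \<or> chain (>) (Suc k) as' bs'" by blast
  then show False using no_chain_le no_chain_greater by blast
qed

section \<open>Homogeneous pieces\<close>

definition bad :: "real \<Rightarrow> 'x set \<Rightarrow> 'y \<Rightarrow> bool" where
  "bad \<epsilon> P b \<longleftrightarrow> \<epsilon> * \<mu> P \<le> \<mu> (P \<inter> sect b) \<and> \<epsilon> * \<mu> P \<le> \<mu> (P - sect b)"

text \<open>The bad points need not form a set of \<open>\<D>\<close>, so nullity is asked of every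
  member of \<open>\<D>\<close> consisting of bad points.\<close>

definition good :: "'y set set \<Rightarrow> real \<Rightarrow> 'x set \<Rightarrow> bool" where
  "good \<D> \<epsilon> P \<longleftrightarrow> (\<forall>B\<in>\<D>. (\<forall>b\<in>B. bad \<epsilon> P b) \<longrightarrow> \<nu> B = 0)"

lemma not_split_treeD:
  assumes "\<not> split_tree \<theta> (Suc d) P SY" "V \<in> \<Y>" "0 < \<nu> V"
  obtains b where "b \<in> V" "\<not> split_tree \<theta> d (P \<inter> sect b) SY \<or> \<not> split_tree \<theta> d (P - sect b) SY"
  using assms Y.subset_space by auto

text \<open>Cutting a piece that is not good along an approximation of a section loses only a bounded
  factor of the measure and decreases the height of the trees, so this stops.\<close>

lemma good_piece_aux:
  assumes C: "content SX \<C> \<mu>" "\<C> \<subseteq> \<X>" and D: "\<D> \<subseteq> \<Y>"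
    and approx: "\<And>B \<eta>. B \<in> \<D> \<Longrightarrow> 0 < \<nu> B \<Longrightarrow> 0 < \<eta> \<Longrightarrow> \<exists>V\<in>\<Y>. V \<subseteq> B \<and> 0 < \<nu> V \<and>
      (\<forall>y\<in>V. \<exists>Q\<in>\<C>. \<mu> (sect y - Q) + \<mu> (Q - sect y) \<le> \<eta>)"
    and e: "0 < \<epsilon>" "\<epsilon> \<le> 1"
    and P: "P \<in> \<C>" "0 < \<mu> P" "\<not> split_tree ((\<epsilon> / 2) ^ d * \<mu> P) d P SY"
  shows "\<exists>P'\<in>\<C>. P' \<subseteq> P \<and> good \<D> \<epsilon> P' \<and> (\<epsilon> / 2) ^ d * \<mu> P \<le> \<mu> P'"
  using P
proof (induction d arbitrary: P)
  case 0
  then show ?case by simp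
next
  case (Suc d)
  interpret C: content SX \<C> \<mu> by fact
  have PX: "P \<in> \<X>" using Suc C by blast
  let ?c = "(\<epsilon> / 2) ^ d" and ?\<theta> = "(\<epsilon> / 2) ^ Suc d * \<mu> P"
  have c: "0 < ?c" "?c \<le> 1" using e by (auto intro!: power_le_one)
  have \<theta>: "0 < ?\<theta>" "?\<theta> \<le> \<mu> P"
    using e Suc.prems by (auto intro!: mult_le_cancel_right2[THEN iffD2] power_le_one simp del: power_Suc)
  show ?case
  proof (cases "good \<D> \<epsilon> P")
    case True
    then show ?thesis using Suc.prems \<theta> by auto
  next
    case False
    then obtain B where B: "B \<in> \<D>" "\<And>b. b \<in> B \<Longrightarrow> bad \<epsilon> P b" "\<nu> B \<noteq> 0"
      by (auto simp: good_def)
    have "0 < \<nu> B" using B D Y.nonneg by (simp add: order_less_le subset_iff)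
    then obtain V where V: "V \<in> \<Y>" "V \<subseteq> B" "0 < \<nu> V"
      "\<And>y. y \<in> V \<Longrightarrow> \<exists>Q\<in>\<C>. \<mu> (sect y - Q) + \<mu> (Q - sect y) \<le> ?\<theta> / 2"
      using approx[OF B(1), of "?\<theta> / 2"] \<theta> by auto
    \<comment> \<open>Otherwise \<open>V\<close> could serve as the root of a tree of depth
      \<open>Suc d\<close>.\<close>
    obtain b where b: "b \<in> V"
      "\<not> split_tree ?\<theta> d (P \<inter> sect b) SY \<or> \<not> split_tree ?\<theta> d (P - sect b) SY"
      using not_split_treeD[OF Suc.prems(3) V(1,3)] by blast
    obtain Q where Q: "Q \<in> \<C>" "\<mu> (sect b - Q) + \<mu> (Q - sect b) \<le> ?\<theta> / 2" using V(4) b by blast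
    have QX: "Q \<in> \<X>" using Q C by blast
    have bX: "sect b \<in> \<X>" using b V(1) Y.subset_space sect by blast
    have Q': "\<mu> (sect b - Q) \<le> ?\<theta> / 2" "\<mu> (Q - sect b) \<le> ?\<theta> / 2"
      using Q(2) X.nonneg[OF X.Diff[OF bX QX]] X.nonneg[OF X.Diff[OF QX bX]] by linarith+
    have bad: "\<epsilon> * \<mu> P \<le> \<mu> (P \<inter> sect b)" "\<epsilon> * \<mu> P \<le> \<mu> (P - sect b)"
      using B V b by (auto simp: bad_def)
    \<comment> \<open>\<open>T\<close> is the branch without tall trees and \<open>W\<close> its
      approximation in \<open>\<C>\<close>. The bound
      \<open>\<epsilon> * \<mu> P \<le> \<mu> T\<close> provides, after multiplication by
      \<open>?c\<close>, the amount \<open>2 * ?\<theta>\<close>. The surplus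
      \<open>?\<theta>\<close> pays for two errors of at most \<open>?\<theta> / 2\<close>: one in
      the measure of \<open>W\<close>, one in carrying a tree from \<open>W\<close> over to
      \<open>T\<close>.\<close>
    have step: ?thesis
      if W: "W \<in> \<C>" "W \<subseteq> P" and T: "T \<in> \<X>" "\<epsilon> * \<mu> P \<le> \<mu> T" "\<not> split_tree ?\<theta> d T SY"
        and WT: "\<mu> (W - T) \<le> ?\<theta> / 2" "\<mu> (T - W) \<le> ?\<theta> / 2" for W T
    proof -
      have WX: "W \<in> \<X>" using W C by blast
      have "\<mu> T \<le> \<mu> W + \<mu> (T - W)"
        by (rule X.measure_le_Un) (use WX T X.Diff in auto)
      then have "\<epsilon> * \<mu> P - ?\<theta> / 2 \<le> \<mu> W" using T WT by linarith
      then have "?c * (\<epsilon> * \<mu> P - ?\<theta> / 2) \<le> ?c * \<mu> W" using c by simp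
      moreover have "?c * (?\<theta> / 2) \<le> 1 * (?\<theta> / 2)"
        by (rule mult_right_mono) (use c \<theta> in auto)
      moreover have "?c * (\<epsilon> * \<mu> P) = 2 * ?\<theta>" by simp
      ultimately have cW: "?\<theta> + ?\<theta> / 2 \<le> ?c * \<mu> W" by (simp only: right_diff_distrib)
      have "0 < ?c * \<mu> W" using cW \<theta> by linarith
      then have "0 < \<mu> W" using c by (simp only: zero_less_mult_pos)
      moreover have "\<not> split_tree (?c * \<mu> W) d W SY"
      proof
        assume "split_tree (?c * \<mu> W) d W SY"
        then have "split_tree (?c * \<mu> W - ?\<theta> / 2) d T SY"
          using split_tree_approx WX T WT by blast
        then show False using T split_tree_antimono cW
          by (metis add_le_cancel_right diff_add_cancel)
      qed
      ultimately obtain P' where "P' \<in> \<C>" "P' \<subseteq> W" "good \<D> \<epsilon> P'" "?c * \<mu> W \<le> \<mu> P'"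
        using Suc.IH W by blast
      moreover from this have "?\<theta> \<le> \<mu> P'" using cW \<theta> by linarith
      ultimately show ?thesis using W by blast
    qed
    show ?thesis using b(2)
    proof
      assume nt: "\<not> split_tree ?\<theta> d (P \<inter> sect b) SY"
      have "\<mu> (P \<inter> Q - P \<inter> sect b) \<le> \<mu> (Q - sect b)" "\<mu> (P \<inter> sect b - P \<inter> Q) \<le> \<mu> (sect b - Q)"
        by (rule X.mono; use PX QX bX X.Int X.Diff in auto)+
      then show ?thesis using Q' nt bad PX bX Q(1) Suc.prems
        by (intro step[of "P \<inter> Q" "P \<inter> sect b"]) (auto intro: C.Int X.Int)
    next
      assume nt: "\<not> split_tree ?\<theta> d (P - sect b) SY"
      have "\<mu> (P - Q - (P - sect b)) \<le> \<mu> (sect b - Q)" "\<mu> (P - sect b - (P - Q)) \<le> \<mu> (Q - sect b)"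
        by (rule X.mono; use PX QX bX X.Int X.Diff in auto)+
      then show ?thesis using Q' nt bad PX bX Q(1) Suc.prems
        by (intro step[of "P - Q" "P - sect b"]) (auto intro: C.Diff X.Diff)
    qed
  qed
qed

text \<open>The fraction \<open>(\<epsilon> / 2) ^ height\<close> is the same for all
  \<open>P\<close>, which is what an exhaustion needs. The algebras \<open>\<C>\<close> and
  \<open>\<D>\<close> stand for \<open>\<X>\<close> and \<open>\<Y>\<close>, where each section
  approximates itself, and later for \<open>XM\<close> and \<open>YM\<close>.\<close>

lemma good_piece:
  assumes C: "content SX \<C> \<mu>" "\<C> \<subseteq> \<X>" and D: "\<D> \<subseteq> \<Y>"
    and approx: "\<And>B \<eta>. B \<in> \<D> \<Longrightarrow> 0 < \<nu> B \<Longrightarrow> 0 < \<eta> \<Longrightarrow> \<exists>V\<in>\<Y>. V \<subseteq> B \<and> 0 < \<nu> V \<and>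
      (\<forall>y\<in>V. \<exists>Q\<in>\<C>. \<mu> (sect y - Q) + \<mu> (Q - sect y) \<le> \<eta>)"
    and e: "0 < \<epsilon>" "\<epsilon> \<le> 1"
    and P: "P \<in> \<C>" "0 < \<mu> P"
  shows "\<exists>P'\<in>\<C>. P' \<subseteq> P \<and> good \<D> \<epsilon> P' \<and> (\<epsilon> / 2) ^ height * \<mu> P \<le> \<mu> P'"
  by (rule good_piece_aux[OF C D approx e P no_split_tree]) (use C P e in auto)

text \<open>\<open>E\<^sub>1\<close> collects points whose section meets \<open>P\<close>
  noticeably, \<open>E\<^sub>2\<close> points whose section misses a noticeable part of
  \<open>P\<close>. Points in both are bad, so the intersection is null. The bound
  \<open>2 * \<epsilon>\<close> in place of \<open>\<epsilon>\<close> reflects the gap between the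
  cut-offs.\<close>

lemma good_split:
  assumes D: "content SY \<D> \<nu>" and good: "good \<D> \<epsilon> P" and P: "P \<in> \<X>" "0 < \<mu> P" and e: "0 < \<epsilon>"
    and def: "\<And>q q'. q < q' \<Longrightarrow> \<exists>E\<in>\<D>. (\<forall>b\<in>E. q \<le> \<mu> (P \<inter> sect b)) \<and>
      (\<forall>b\<in>SY. q' \<le> \<mu> (P \<inter> sect b) \<longrightarrow> b \<in> E)"
  obtains E\<^sub>1 E\<^sub>2 where "E\<^sub>1 \<in> \<D>" "E\<^sub>2 \<in> \<D>" "\<nu> (E\<^sub>1 \<inter> E\<^sub>2) = 0"
    "\<And>b. b \<in> SY - E\<^sub>1 \<Longrightarrow> \<mu> (P \<inter> sect b) \<le> 2 * \<epsilon> * \<mu> P"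
    "\<And>b. b \<in> SY - E\<^sub>2 \<Longrightarrow> \<mu> (P - sect b) \<le> 2 * \<epsilon> * \<mu> P"
proof -
  interpret D: content SY \<D> \<nu> by fact
  let ?m = "\<mu> P"
  have m: "0 < \<epsilon> * ?m" using P e by simp
  obtain E\<^sub>1 where E1: "E\<^sub>1 \<in> \<D>" "\<And>b. b \<in> E\<^sub>1 \<Longrightarrow> \<epsilon> * ?m \<le> \<mu> (P \<inter> sect b)"
    "\<And>b. b \<in> SY \<Longrightarrow> 2 * \<epsilon> * ?m \<le> \<mu> (P \<inter> sect b) \<Longrightarrow> b \<in> E\<^sub>1"
    using def[of "\<epsilon> * ?m" "2 * \<epsilon> * ?m"] m by auto
  obtain E where E: "E \<in> \<D>" "\<And>b. b \<in> E \<Longrightarrow> ?m - 2 * \<epsilon> * ?m \<le> \<mu> (P \<inter> sect b)"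
    "\<And>b. b \<in> SY \<Longrightarrow> ?m - \<epsilon> * ?m \<le> \<mu> (P \<inter> sect b) \<Longrightarrow> b \<in> E"
    using def[of "?m - 2 * \<epsilon> * ?m" "?m - \<epsilon> * ?m"] m by auto
  have sp: "?m = \<mu> (P \<inter> sect b) + \<mu> (P - sect b)" if "b \<in> SY" for b
    using X.split P sect that by blast
  have E2: "SY - E \<in> \<D>" using E D.Diff D.space by blast
  show ?thesis
  proof
    show "E\<^sub>1 \<in> \<D>" "SY - E \<in> \<D>" by fact+
    have "bad \<epsilon> P b" if b: "b \<in> E\<^sub>1 \<inter> (SY - E)" for b
    proof -
      have "\<mu> (P \<inter> sect b) < ?m - \<epsilon> * ?m" using E(3)[of b] b by force
      then show ?thesis using b E1(2) sp[of b] by (auto simp: bad_def)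
    qed
    then show "\<nu> (E\<^sub>1 \<inter> (SY - E)) = 0"
      using good E1(1) E2 D.Int by (auto simp: good_def)
    show "\<mu> (P \<inter> sect b) \<le> 2 * \<epsilon> * \<mu> P" if "b \<in> SY - E\<^sub>1" for b
      using E1(3)[of b] that by force
    show "\<mu> (P - sect b) \<le> 2 * \<epsilon> * \<mu> P" if "b \<in> SY - (SY - E)" for b
      using E(2)[of b] sp[of b] that by force
  qed
qed

section \<open>Total boundedness of the sections in measure\<close>

text \<open>On a good piece \<open>P'\<close> of \<open>P\<close> the set \<open>W\<close> is either
  empty or all of \<open>P'\<close>: as \<open>E\<^sub>1 \<inter> E\<^sub>2\<close> is null, one of
  \<open>B - E\<^sub>1\<close> and \<open>B - E\<^sub>2\<close> has positive measure, and
  \<open>B\<close> is shrunk to it. Then \<open>P - P'\<close> is treated in the same way; the power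
  with exponent \<open>t\<close> bounds the part not reached in \<open>t\<close> rounds.\<close>

lemma totally_bounded_aux:
  assumes e: "0 < \<epsilon>" "\<epsilon> \<le> 1" and P: "P \<in> \<X>" and B: "B \<in> \<Y>" "0 < \<nu> B"
  shows "\<exists>B'\<in>\<Y>. B' \<subseteq> B \<and> 0 < \<nu> B' \<and> (\<exists>W\<in>\<X>. W \<subseteq> P \<and> (\<forall>b\<in>B'.
    \<mu> (P \<inter> sect b - W) + \<mu> (W - sect b) \<le> (2 * \<epsilon> + (1 - (\<epsilon> / 2) ^ height) ^ t) * \<mu> P))"
  using P B
proof (induction t arbitrary: P B)
  case 0
  have "\<mu> (P \<inter> sect b - {}) + \<mu> ({} - sect b) \<le> (2 * \<epsilon> + 1) * \<mu> P" if "b \<in> B" for b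
  proof -
    have "sect b \<in> \<X>" using that 0 Y.subset_space sect by blast
    then have "\<mu> (P \<inter> sect b) \<le> \<mu> P" using X.mono[of "P \<inter> sect b" P] 0 X.Int by blast
    moreover have "0 \<le> 2 * \<epsilon> * \<mu> P" using e X.nonneg 0 by auto
    ultimately show ?thesis by (simp add: algebra_simps)
  qed
  then show ?case using 0 X.empty
    by (intro bexI[of _ B] conjI bexI[of _ "{}"]) auto
next
  case (Suc t)
  let ?c = "(\<epsilon> / 2) ^ height"
  have c: "0 < ?c" "?c \<le> 1" using e by (auto intro!: power_le_one)
  show ?case
  proof (cases "0 < \<mu> P")
    case False
    then have P0: "\<mu> P = 0" using X.nonneg Suc by force
    have "\<mu> (P \<inter> sect b - {}) + \<mu> ({} - sect b) \<le> (2 * \<epsilon> + (1 - ?c) ^ Suc t) * \<mu> P" if "b \<in> B" for b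
    proof -
      have "sect b \<in> \<X>" using that Suc.prems Y.subset_space sect by blast
      then have "\<mu> (P \<inter> sect b) \<le> \<mu> P" using X.mono[of "P \<inter> sect b" P] Suc.prems X.Int by blast
      then show ?thesis using P0 by simp
    qed
    then show ?thesis using Suc.prems X.empty
      by (intro bexI[of _ B] conjI bexI[of _ "{}"]) auto
  next
    case True
    have triv: "\<exists>V\<in>\<Y>. V \<subseteq> B \<and> 0 < \<nu> V \<and>
        (\<forall>y\<in>V. \<exists>Q\<in>\<X>. \<mu> (sect y - Q) + \<mu> (Q - sect y) \<le> \<eta>)"
      if "B \<in> \<Y>" "0 < \<nu> B" "0 < \<eta>" for B \<eta>
    proof (intro bexI[of _ B] conjI ballI)
      fix y assume "y \<in> B"
      then show "\<exists>Q\<in>\<X>. \<mu> (sect y - Q) + \<mu> (Q - sect y) \<le> \<eta>"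
        using that sect[of y] Y.subset_space by (intro bexI[of _ "sect y"]) auto
    qed (use that in auto)
    obtain P' where P': "P' \<in> \<X>" "P' \<subseteq> P" "good \<Y> \<epsilon> P'" "?c * \<mu> P \<le> \<mu> P'"
      using good_piece[OF X.content_axioms subset_refl subset_refl triv e Suc.prems(1) True] by blast
    have "0 < ?c * \<mu> P" using c True by simp
    then have pos: "0 < \<mu> P'" using P' by linarith
    obtain E\<^sub>1 E\<^sub>2 where E: "E\<^sub>1 \<in> \<Y>" "E\<^sub>2 \<in> \<Y>" "\<nu> (E\<^sub>1 \<inter> E\<^sub>2) = 0"
      "\<And>b. b \<in> SY - E\<^sub>1 \<Longrightarrow> \<mu> (P' \<inter> sect b) \<le> 2 * \<epsilon> * \<mu> P'"
      "\<And>b. b \<in> SY - E\<^sub>2 \<Longrightarrow> \<mu> (P' - sect b) \<le> 2 * \<epsilon> * \<mu> P'"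
      using good_split[OF Y.content_axioms P'(3) P'(1) pos e(1) definable[OF P'(1)]] by metis
    have BSY: "B \<subseteq> SY" using Suc.prems Y.subset_space by blast
    have D: "B - E\<^sub>1 \<in> \<Y>" "B - E\<^sub>2 \<in> \<Y>" "B \<inter> (E\<^sub>1 \<inter> E\<^sub>2) \<in> \<Y>"
      using E Suc.prems Y.Diff Y.Int by auto
    have "\<nu> (B \<inter> (E\<^sub>1 \<inter> E\<^sub>2)) \<le> \<nu> (E\<^sub>1 \<inter> E\<^sub>2)"
      by (rule Y.mono) (use D E Y.Int in auto)
    moreover have "\<nu> B \<le> \<nu> (B \<inter> (E\<^sub>1 \<inter> E\<^sub>2)) + \<nu> (B - E\<^sub>1 \<inter> E\<^sub>2)"
      using Y.split[of B "E\<^sub>1 \<inter> E\<^sub>2"] Suc.prems E Y.Int by simp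
    moreover have "\<nu> (B - E\<^sub>1 \<inter> E\<^sub>2) \<le> \<nu> (B - E\<^sub>1) + \<nu> (B - E\<^sub>2)"
      by (rule Y.measure_le_Un) (use D E Suc.prems Y.Int Y.Diff in auto)
    ultimately have "0 < \<nu> (B - E\<^sub>1) \<or> 0 < \<nu> (B - E\<^sub>2)" using E(3) Suc.prems(3) by linarith
    then obtain B\<^sub>1 W\<^sub>1 where B1: "B\<^sub>1 \<in> \<Y>" "B\<^sub>1 \<subseteq> B" "0 < \<nu> B\<^sub>1" "W\<^sub>1 \<in> \<X>" "W\<^sub>1 \<subseteq> P'"
      "\<And>b. b \<in> B\<^sub>1 \<Longrightarrow> \<mu> (P' \<inter> sect b - W\<^sub>1) + \<mu> (W\<^sub>1 - sect b) \<le> 2 * \<epsilon> * \<mu> P'"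
    proof
      assume "0 < \<nu> (B - E\<^sub>1)"
      then show thesis using D E(4) BSY X.empty that[of "B - E\<^sub>1" "{}"] by auto
    next
      assume *: "0 < \<nu> (B - E\<^sub>2)"
      have "P' \<inter> sect b - P' = {}" for b by blast
      then have "\<mu> (P' \<inter> sect b - P') = 0" for b by (simp only: X.measure_empty)
      then show thesis using D E(5) BSY P' * that[of "B - E\<^sub>2" P'] by auto
    qed
    obtain B\<^sub>2 W\<^sub>2 where B2: "B\<^sub>2 \<in> \<Y>" "B\<^sub>2 \<subseteq> B\<^sub>1" "0 < \<nu> B\<^sub>2" "W\<^sub>2 \<in> \<X>" "W\<^sub>2 \<subseteq> P - P'"
      "\<And>b. b \<in> B\<^sub>2 \<Longrightarrow> \<mu> ((P - P') \<inter> sect b - W\<^sub>2) + \<mu> (W\<^sub>2 - sect b)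
        \<le> (2 * \<epsilon> + (1 - ?c) ^ t) * \<mu> (P - P')"
      using Suc.IH[of "P - P'" B\<^sub>1] X.Diff P' Suc.prems(1) B1 by blast
    have m: "\<mu> (P - P') = \<mu> P - \<mu> P'"
      using X.split[OF Suc.prems(1) P'(1)] P'(2) by (simp add: Int_absorb1)
    have "\<mu> (P \<inter> sect b - (W\<^sub>1 \<union> W\<^sub>2)) + \<mu> (W\<^sub>1 \<union> W\<^sub>2 - sect b) \<le> (2 * \<epsilon> + (1 - ?c) ^ Suc t) * \<mu> P"
      if b: "b \<in> B\<^sub>2" for b
    proof -
      have bX: "sect b \<in> \<X>" using b B2(1) Y.subset_space sect by blast
      have "\<mu> (P \<inter> sect b - (W\<^sub>1 \<union> W\<^sub>2)) \<le> \<mu> (P' \<inter> sect b - W\<^sub>1) + \<mu> ((P - P') \<inter> sect b - W\<^sub>2)"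
        by (rule X.measure_le_Un) (use bX Suc.prems P' B1 B2 X.Int X.Diff X.Un in auto)
      moreover have "\<mu> (W\<^sub>1 \<union> W\<^sub>2 - sect b) \<le> \<mu> (W\<^sub>1 - sect b) + \<mu> (W\<^sub>2 - sect b)"
        by (rule X.measure_le_Un) (use bX B1 B2 X.Int X.Diff X.Un in auto)
      moreover have "\<mu> (P' \<inter> sect b - W\<^sub>1) + \<mu> (W\<^sub>1 - sect b) \<le> 2 * \<epsilon> * \<mu> P'"
        using B1(6) B2(2) b by blast
      moreover have "\<mu> ((P - P') \<inter> sect b - W\<^sub>2) + \<mu> (W\<^sub>2 - sect b)
        \<le> (2 * \<epsilon> + (1 - ?c) ^ t) * \<mu> (P - P')" using B2(6) b by blast
      moreover have "(1 - ?c) ^ t * (\<mu> P - \<mu> P') \<le> (1 - ?c) ^ t * ((1 - ?c) * \<mu> P)"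
        by (rule mult_left_mono) (use P' c in \<open>auto simp: algebra_simps\<close>)
      ultimately show ?thesis unfolding m by (simp add: algebra_simps)
    qed
    then show ?thesis using B1 B2 P' X.Un
      by (intro bexI[of _ B\<^sub>2] conjI bexI[of _ "W\<^sub>1 \<union> W\<^sub>2"]) auto
  qed
qed

text \<open>Comparing with the section of a point \<open>b\<close> of \<open>D\<close> instead of
  with the set \<open>W\<close> doubles the error, but makes closeness a condition on two
  parameters, to which richness can be applied.\<close>

lemma totally_bounded:
  assumes B: "B \<in> \<Y>" "0 < \<nu> B" and e: "0 < \<eta>"
  obtains D b where "D \<in> \<Y>" "D \<subseteq> B" "0 < \<nu> D" "b \<in> D"
    "\<And>y. y \<in> D \<Longrightarrow> \<mu> (sect y - sect b) + \<mu> (sect b - sect y) \<le> \<eta>"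
proof -
  \<comment> \<open>This makes \<open>3 * \<delta> * \<mu> SX\<close> at most
    \<open>\<eta> / 2\<close>, the error allowed for each of the two sections compared through
    \<open>W\<close>; the added 1 avoids division by zero.\<close>
  define \<delta> where "\<delta> = \<eta> / (6 * (\<mu> SX + 1))"
  have m0: "0 \<le> \<mu> SX" by (rule X.nonneg[OF X.space])
  define \<epsilon> where "\<epsilon> = min 1 \<delta>"
  have \<delta>: "0 < \<delta>" "\<delta> * \<mu> SX \<le> \<eta> / 6"
    using e m0 by (auto simp: \<delta>_def field_simps)
  have \<epsilon>: "0 < \<epsilon>" "\<epsilon> \<le> 1" "\<epsilon> \<le> \<delta>" using \<delta> by (auto simp: \<epsilon>_def)
  have "\<bar>1 - (\<epsilon> / 2) ^ height\<bar> < 1" using \<epsilon> power_le_one[of "\<epsilon> / 2" height] by (simp add: abs_if)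
  then obtain t where t: "(1 - (\<epsilon> / 2) ^ height) ^ t < \<delta>"
    using real_arch_pow_inv[OF \<delta>(1), of "1 - (\<epsilon> / 2) ^ height"] \<epsilon>(1) by force
  obtain D W where D: "D \<in> \<Y>" "D \<subseteq> B" "0 < \<nu> D" "W \<in> \<X>"
    "\<And>b. b \<in> D \<Longrightarrow> \<mu> (SX \<inter> sect b - W) + \<mu> (W - sect b)
      \<le> (2 * \<epsilon> + (1 - (\<epsilon> / 2) ^ height) ^ t) * \<mu> SX"
    using totally_bounded_aux[OF \<epsilon>(1,2) X.space B] by metis
  have "(2 * \<epsilon> + (1 - (\<epsilon> / 2) ^ height) ^ t) * \<mu> SX \<le> (2 * \<delta> + \<delta>) * \<mu> SX"
    by (rule mult_right_mono) (use t \<epsilon> m0 in auto)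
  also have "\<dots> \<le> \<eta> / 2" using \<delta>(2) by simp
  finally have W: "\<mu> (sect b - W) + \<mu> (W - sect b) \<le> \<eta> / 2" "sect b \<in> \<X>" if "b \<in> D" for b
    using D(5)[OF that] X.subset_space sect[of b] that D(1) Y.subset_space
    by (auto simp: Int_absorb1 subset_iff)
  obtain b where b: "b \<in> D" using D(3) by fastforce
  have "\<mu> (sect y - sect b) + \<mu> (sect b - sect y) \<le> \<eta>" if y: "y \<in> D" for y
  proof -
    have "\<mu> (sect y - sect b) \<le> \<mu> (sect y - W) + \<mu> (W - sect b)"
      by (rule X.measure_le_Un) (use W y b D X.Diff in auto)
    moreover have "\<mu> (sect b - sect y) \<le> \<mu> (sect b - W) + \<mu> (W - sect y)"
      by (rule X.measure_le_Un) (use W y b D X.Diff in auto)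
    ultimately show ?thesis using W(1)[OF y] W(1)[OF b] by linarith
  qed
  then show thesis using that D b by blast
qed

lemma definable_approximation:
  assumes B: "B \<in> YM" "0 < \<nu> B" and e: "0 < \<eta>"
  shows "\<exists>V\<in>YM. V \<subseteq> B \<and> 0 < \<nu> V \<and> (\<exists>P\<in>XM. \<forall>y\<in>V. \<mu> (sect y - P) + \<mu> (P - sect y) \<le> \<eta>)"
proof -
  \<comment> \<open>Half of \<open>\<eta>\<close>, since the passage to parameters in the base model
    doubles the error.\<close>
  obtain D b where D: "D \<in> \<Y>" "D \<subseteq> B" "0 < \<nu> D" "b \<in> D"
    "\<And>y. y \<in> D \<Longrightarrow> \<mu> (sect y - sect b) + \<mu> (sect b - sect y) \<le> \<eta> / 2"
    using totally_bounded[of B "\<eta> / 2"] B e YM_subset by auto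
  have "b \<in> SY" using D Y.subset_space by blast
  then show ?thesis using rich[OF B(1) D(1-3), of b "\<eta> / 2"] e D(5) by simp
qed

section \<open>Typical points and pieces over the base model\<close>

text \<open>This is what density of the type of \<open>b\<close> over the base model provides in the
  abstract setting.\<close>

definition typical :: "'y \<Rightarrow> bool" where
  "typical b \<longleftrightarrow> b \<in> SY \<and> (\<forall>Q\<in>YM. b \<in> Q \<longrightarrow> 0 < \<nu> Q)"

text \<open>If one set around \<open>a\<close> misses the section up to a null set and another is
  contained in it up to a null set, then their intersection is null although it contains
  \<open>a\<close>.\<close>

lemma dichotomy:
  assumes b: "typical b" and a: "\<And>P. P \<in> XM \<Longrightarrow> a \<in> P \<Longrightarrow> 0 < \<mu> P"
  shows "(\<forall>P\<in>XM. a \<in> P \<longrightarrow> 0 < \<mu> (P \<inter> sect b)) \<or> (\<forall>P\<in>XM. a \<in> P \<longrightarrow> 0 < \<mu> (P - sect b))"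
proof (rule ccontr)
  assume "\<not> ?thesis"
  then obtain P P' where P: "P \<in> XM" "a \<in> P" "\<mu> (P \<inter> sect b) \<le> 0"
    and P': "P' \<in> XM" "a \<in> P'" "\<mu> (P' - sect b) \<le> 0" by (auto simp: not_less)
  have bX: "sect b \<in> \<X>" using b sect by (auto simp: typical_def)
  have PX: "P \<in> \<X>" "P' \<in> \<X>" using P P' XM_subset by auto
  have "0 < \<mu> (P \<inter> P')" using a P P' XM.Int by blast
  moreover have "\<mu> (P \<inter> P') \<le> \<mu> (P \<inter> sect b) + \<mu> (P' - sect b)"
    by (rule X.measure_le_Un) (use PX bX X.Int X.Diff in auto)
  ultimately show False using P P' by linarith
qed

text \<open>The exceptional set \<open>E\<^sub>1 \<inter> E\<^sub>2\<close> of a good piece over the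
  base model is null and itself over the base model, so a typical \<open>b\<close> lies outside it.
  Goodness is used with \<open>\<epsilon> / 2\<close>, since \<open>good_split\<close> doubles the
  constant; this explains \<open>\<epsilon> / 4\<close>.\<close>

lemma decided_piece:
  assumes b: "typical b" and P: "P \<in> XM" "0 < \<mu> P" and e: "0 < \<epsilon>" "\<epsilon> \<le> 1"
  shows "\<exists>P'\<in>XM. P' \<subseteq> P \<and> (\<epsilon> / 4) ^ height * \<mu> P \<le> \<mu> P' \<and> 0 < \<mu> P' \<and>
    (\<mu> (P' \<inter> sect b) \<le> \<epsilon> * \<mu> P' \<or> \<mu> (P' - sect b) \<le> \<epsilon> * \<mu> P')"
proof -
  have approx: "\<exists>V\<in>\<Y>. V \<subseteq> B \<and> 0 < \<nu> V \<and>
      (\<forall>y\<in>V. \<exists>Q\<in>XM. \<mu> (sect y - Q) + \<mu> (Q - sect y) \<le> \<eta>)"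
    if "B \<in> YM" "0 < \<nu> B" "0 < \<eta>" for B \<eta>
    using definable_approximation[OF that] YM_subset by blast
  obtain P' where P': "P' \<in> XM" "P' \<subseteq> P" "good YM (\<epsilon> / 2) P'" "(\<epsilon> / 2 / 2) ^ height * \<mu> P \<le> \<mu> P'"
    using good_piece[OF XM.content_axioms XM_subset YM_subset approx, of "\<epsilon> / 2" P] P e by auto
  have "0 < (\<epsilon> / 2 / 2) ^ height * \<mu> P" using e P by simp
  then have pos: "0 < \<mu> P'" using P' by linarith
  have P'X: "P' \<in> \<X>" using P' XM_subset by blast
  obtain E\<^sub>1 E\<^sub>2 where E: "E\<^sub>1 \<in> YM" "E\<^sub>2 \<in> YM" "\<nu> (E\<^sub>1 \<inter> E\<^sub>2) = 0"
      "\<And>b. b \<in> SY - E\<^sub>1 \<Longrightarrow> \<mu> (P' \<inter> sect b) \<le> 2 * (\<epsilon> / 2) * \<mu> P'"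
      "\<And>b. b \<in> SY - E\<^sub>2 \<Longrightarrow> \<mu> (P' - sect b) \<le> 2 * (\<epsilon> / 2) * \<mu> P'"
    using good_split[OF YM.content_axioms P'(3) P'X pos _ definable_M[OF P'(1)]] e by auto
  have "b \<notin> E\<^sub>1 \<inter> E\<^sub>2" "b \<in> SY"
    using b E YM.Int by (auto simp: typical_def)
  then have "\<mu> (P' \<inter> sect b) \<le> \<epsilon> * \<mu> P' \<or> \<mu> (P' - sect b) \<le> \<epsilon> * \<mu> P'"
    using E(4,5)[of b] by auto
  moreover have "\<epsilon> / 2 / 2 = \<epsilon> / 4" by simp
  ultimately show ?thesis using P' pos by (intro bexI[of _ P']) auto
qed

text \<open>If all decided pieces inside \<open>P\<close> were almost contained in \<open>H\<close>,
  exhausting \<open>P\<close> by them would give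
  \<open>\<mu> (P - H) \<le> \<delta> * \<mu> P\<close>, which the choice of \<open>\<delta>\<close>
  rules out.\<close>

lemma decided_piece_outside:
  assumes b: "typical b" and P: "P \<in> XM" and H: "H = sect b \<or> H = SX - sect b"
    and pos: "0 < \<mu> (P - H)" and e: "0 < \<epsilon>"
  shows "\<exists>P'\<in>XM. P' \<subseteq> P \<and> 0 < \<mu> P' \<and> \<mu> (P' \<inter> H) \<le> \<epsilon> * \<mu> P'"
proof (rule ccontr)
  assume none: "\<not> ?thesis"
  have PX: "P \<in> \<X>" using P XM_subset by blast
  have bX: "sect b \<in> \<X>" using b sect by (auto simp: typical_def)
  then have HX: "H \<in> \<X>" using H X.Diff X.space by blast
  have le: "\<mu> (P - H) \<le> \<mu> P" by (rule X.mono) (use PX HX X.Diff in auto)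
  \<comment> \<open>The quotient keeps \<open>\<delta> * \<mu> P\<close> below or at half of
    \<open>\<mu> (P - H)\<close>.\<close>
  define \<delta> where "\<delta> = min (min 1 \<epsilon>) (\<mu> (P - H) / (2 * \<mu> P))"
  have P0: "0 < \<mu> P" using le pos by simp
  have \<delta>: "0 < \<delta>" "\<delta> \<le> 1" "\<delta> \<le> \<epsilon>" "\<delta> * \<mu> P < \<mu> (P - H)"
  proof -
    show "0 < \<delta>" "\<delta> \<le> 1" "\<delta> \<le> \<epsilon>" using e pos P0 by (auto simp: \<delta>_def)
    have "\<delta> * \<mu> P \<le> \<mu> (P - H) / (2 * \<mu> P) * \<mu> P"
      by (rule mult_right_mono) (use P0 in \<open>auto simp: \<delta>_def\<close>)
    then show "\<delta> * \<mu> P < \<mu> (P - H)" using P0 pos by simp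
  qed
  have "\<mu> (P - H) \<le> \<delta> * \<mu> P"
  proof (rule X.exhaustion[OF XM_subset XM.Diff HX, of "(\<delta> / 4) ^ height"])
    fix P' assume P': "P' \<in> XM" "P' \<subseteq> P" "0 < \<mu> P'"
    obtain P'' where P'': "P'' \<in> XM" "P'' \<subseteq> P'" "(\<delta> / 4) ^ height * \<mu> P' \<le> \<mu> P''" "0 < \<mu> P''"
      "\<mu> (P'' \<inter> sect b) \<le> \<delta> * \<mu> P'' \<or> \<mu> (P'' - sect b) \<le> \<delta> * \<mu> P''"
      using decided_piece[OF b P'(1,3) \<delta>(1,2)] by blast
    have sub: "P'' \<subseteq> SX" using P'' XM.subset_space by blast
    then have "P'' \<inter> (SX - sect b) = P'' - sect b" "P'' - (SX - sect b) = P'' \<inter> sect b" by auto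
    then have "\<mu> (P'' \<inter> H) \<le> \<delta> * \<mu> P'' \<or> \<mu> (P'' - H) \<le> \<delta> * \<mu> P''" using P''(5) H by auto
    moreover have "\<not> \<mu> (P'' \<inter> H) \<le> \<epsilon> * \<mu> P''" using none P'' P' by blast
    moreover have "\<delta> * \<mu> P'' \<le> \<epsilon> * \<mu> P''" using \<delta> P'' by simp
    ultimately show "\<exists>P''\<in>XM. P'' \<subseteq> P' \<and> (\<delta> / 4) ^ height * \<mu> P' \<le> \<mu> P'' \<and> \<mu> (P'' - H) \<le> \<delta> * \<mu> P''"
      using P'' by (intro bexI[of _ P'']) auto
  qed (use \<delta> P in \<open>auto intro!: power_le_one\<close>)
  then show False using \<delta> by simp
qed

text \<open>The set \<open>E\<close> records that the type of \<open>b\<close> has decided the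
  piece: any later point taken from \<open>E\<close> obeys the same estimate as
  \<open>b\<close>.\<close>

lemma section_small_piece:
  assumes b: "typical b" and P: "P \<in> XM" and pos: "0 < \<mu> (P - sect b)" and e: "0 < \<epsilon>"
  obtains P' E where "P' \<in> XM" "P' \<subseteq> P" "0 < \<mu> P'" "E \<in> YM" "b \<in> E"
    "\<And>y. y \<in> E \<Longrightarrow> \<mu> (P' \<inter> sect y) \<le> \<epsilon> * \<mu> P'"
proof -
  obtain P' where P': "P' \<in> XM" "P' \<subseteq> P" "0 < \<mu> P'" "\<mu> (P' \<inter> sect b) \<le> \<epsilon> / 2 * \<mu> P'"
    using decided_piece_outside[OF b P _ pos, of "\<epsilon> / 2"] e by auto
  \<comment> \<open>The lower cut-off \<open>3 / 4 * \<epsilon>\<close> lies above the value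
    \<open>\<epsilon> / 2\<close> attained at \<open>b\<close>, so \<open>b\<close> falls into the
    complement of this \<open>E\<close>, the set finally returned.\<close>
  obtain E where E: "E \<in> YM" "\<And>y. y \<in> E \<Longrightarrow> 3 / 4 * \<epsilon> * \<mu> P' \<le> \<mu> (P' \<inter> sect y)"
    "\<And>y. y \<in> SY \<Longrightarrow> \<epsilon> * \<mu> P' \<le> \<mu> (P' \<inter> sect y) \<Longrightarrow> y \<in> E"
    using definable_M[OF P'(1), of "3 / 4 * \<epsilon> * \<mu> P'" "\<epsilon> * \<mu> P'"] e P'(3) by auto
  show thesis
  proof (rule that[OF P'(1-3), of "SY - E"])
    show "SY - E \<in> YM" using E YM.Diff YM.space by blast
    have "0 < \<epsilon> * \<mu> P'" using e P' by simp
    then have "\<not> 3 / 4 * \<epsilon> * \<mu> P' \<le> \<mu> (P' \<inter> sect b)" using P'(4) by simp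
    then show "b \<in> SY - E" using E(2) b by (auto simp: typical_def)
    show "\<mu> (P' \<inter> sect y) \<le> \<epsilon> * \<mu> P'" if "y \<in> SY - E" for y using E(3)[of y] that by force
  qed
qed

lemma section_large_piece:
  assumes b: "typical b" and P: "P \<in> XM" and pos: "0 < \<mu> (P \<inter> sect b)" and e: "0 < \<epsilon>"
  obtains P' E where "P' \<in> XM" "P' \<subseteq> P" "0 < \<mu> P'" "E \<in> YM" "b \<in> E"
    "\<And>y. y \<in> E \<Longrightarrow> \<mu> (P' - sect y) \<le> \<epsilon> * \<mu> P'"
proof -
  have "P - (SX - sect b) = P \<inter> sect b" using P XM.subset_space by blast
  then obtain P' where P': "P' \<in> XM" "P' \<subseteq> P" "0 < \<mu> P'" "\<mu> (P' \<inter> (SX - sect b)) \<le> \<epsilon> / 2 * \<mu> P'"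
    using decided_piece_outside[OF b P, of "SX - sect b" "\<epsilon> / 2"] e pos by auto
  have sp: "\<mu> P' = \<mu> (P' \<inter> sect y) + \<mu> (P' - sect y)" if "y \<in> SY" for y
    using X.split sect[OF that] P'(1) XM_subset by blast
  have bSY: "b \<in> SY" using b by (simp add: typical_def)
  have "P' \<inter> (SX - sect b) = P' - sect b" using P' XM.subset_space by blast
  then have P'b: "\<mu> P' - \<epsilon> / 2 * \<mu> P' \<le> \<mu> (P' \<inter> sect b)" using P'(4) sp[OF bSY] by simp
  obtain E where E: "E \<in> YM" "\<And>y. y \<in> E \<Longrightarrow> \<mu> P' - \<epsilon> * \<mu> P' \<le> \<mu> (P' \<inter> sect y)"
    "\<And>y. y \<in> SY \<Longrightarrow> \<mu> P' - \<epsilon> / 2 * \<mu> P' \<le> \<mu> (P' \<inter> sect y) \<Longrightarrow> y \<in> E"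
    using definable_M[OF P'(1), of "\<mu> P' - \<epsilon> * \<mu> P'" "\<mu> P' - \<epsilon> / 2 * \<mu> P'"] e P'(3) by auto
  show thesis
  proof (rule that[OF P'(1-3) E(1)])
    show "b \<in> E" using E(3) bSY P'b by blast
    show "\<mu> (P' - sect y) \<le> \<epsilon> * \<mu> P'" if "y \<in> E" for y
      using E(2)[OF that] sp[of y] that E(1) YM.subset_space by force
  qed
qed

end

section \<open>Both sides together: a half-graph from pieces\<close>

locale stable_relation =
  l: measured_relation SX \<X> \<mu> XM SY \<Y> \<nu> YM R sect Gen k +
  r: measured_relation SY \<Y> \<nu> YM SX \<X> \<mu> XM "\<lambda>y x. R x y" cosect "\<lambda>bs as. Gen as bs" k
  for SX :: "'x set" and \<X> \<mu> XM and SY :: "'y set" and \<Y> \<nu> YM R sect cosect Gen k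
begin

text \<open>\<open>P'\<close> is found after \<open>Q'\<close> and inside the set \<open>E\<close>
  of points related to most of \<open>Q'\<close>, and the recursion continues within
  \<open>P \<inter> E\<close> and \<open>Q \<inter> D\<close>, so all later elements respect both
  estimates. The elements themselves are chosen from the tail backwards. Each avoids at most as many
  sets of relative measure \<open>\<epsilon>\<close> as the chain has steps, whence the bound on
  \<open>\<epsilon>\<close>.\<close>

lemma chain_of_pieces:
  assumes a: "r.typical a" and b: "l.typical b"
    and pos: "\<And>Q. Q \<in> YM \<Longrightarrow> b \<in> Q \<Longrightarrow> 0 < \<nu> (Q \<inter> cosect a)"
    and neg: "\<And>P. P \<in> XM \<Longrightarrow> a \<in> P \<Longrightarrow> 0 < \<mu> (P - sect b)"
    and e: "0 < \<epsilon>" "real (Suc u) * \<epsilon> < 1"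
    and PQ: "P \<in> XM" "a \<in> P" "Q \<in> YM" "b \<in> Q"
  shows "\<exists>as bs. Gen as bs \<and> set as \<subseteq> P \<and> set bs \<subseteq> Q \<and> l.chain (\<ge>) u as bs"
  using e(2) PQ
proof (induction u arbitrary: P Q)
  case 0
  then show ?case using l.Gen_Nil l.chain_Nil by (intro exI[of _ "[]"]) auto
next
  case (Suc u)
  obtain Q' E where Q': "Q' \<in> YM" "Q' \<subseteq> Q" "0 < \<nu> Q'" "E \<in> XM" "a \<in> E"
    "\<And>x. x \<in> E \<Longrightarrow> \<nu> (Q' - cosect x) \<le> \<epsilon> * \<nu> Q'"
    using r.section_large_piece[OF a Suc.prems(4) pos[OF Suc.prems(4,5)] e(1)] by blast
  have PE: "P \<inter> E \<in> XM" "a \<in> P \<inter> E" using Suc.prems Q' l.XM.Int by auto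
  obtain P' D where P': "P' \<in> XM" "P' \<subseteq> P \<inter> E" "0 < \<mu> P'" "D \<in> YM" "b \<in> D"
    "\<And>y. y \<in> D \<Longrightarrow> \<mu> (P' \<inter> sect y) \<le> \<epsilon> * \<mu> P'"
    using l.section_small_piece[OF b PE(1) neg[OF PE] e(1)] by blast
  have QD: "Q \<inter> D \<in> YM" "b \<in> Q \<inter> D" using Suc.prems P' l.YM.Int by auto
  have "real (Suc u) * \<epsilon> < 1" using Suc.prems(1) e(1) by (simp add: algebra_simps)
  then obtain as bs where IH: "Gen as bs" "set as \<subseteq> P \<inter> E" "set bs \<subseteq> Q \<inter> D" "l.chain (\<ge>) u as bs"
    using Suc.IH PE QD by blast
  have len: "length as = u" "length bs = u" using IH(4) by (auto simp: l.chain_def)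
  have small: "real c * \<epsilon> * x < x" if "c \<le> Suc u" "0 < x" for c x
  proof -
    have "real c * \<epsilon> \<le> real (Suc u) * \<epsilon>" using that e by (intro mult_right_mono) auto
    moreover have "real (Suc u) * \<epsilon> < 1" by fact
    ultimately have "real c * \<epsilon> < 1" by linarith
    then show ?thesis using that by simp
  qed
  have P'X: "P' \<in> \<X>" and Q'Y: "Q' \<in> \<Y>" using P' Q' l.XM_subset l.YM_subset by auto
  have D1: "P' - (\<Union>y\<in>set bs. sect y) \<in> \<X> \<and>
      \<mu> P' - real (card (set bs)) * (\<epsilon> * \<mu> P') \<le> \<mu> (P' - (\<Union>y\<in>set bs. sect y))"
  proof (rule l.X.measure_Diff_UN_ge[OF finite_set P'X])
    fix y assume "y \<in> set bs"
    then have y: "y \<in> D" using IH by blast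
    then show "sect y \<in> \<X>" using l.sect l.YM.subset_space P' by blast
    show "\<mu> (P' \<inter> sect y) \<le> \<epsilon> * \<mu> P'" using P' y by blast
  qed
  have "card (set bs) \<le> Suc u" using card_length[of bs] len by simp
  then have "0 < \<mu> (P' - (\<Union>y\<in>set bs. sect y))" using D1 small[OF _ P'(3)] by (smt (verit) mult.assoc)
  then obtain a' where a': "a' \<in> P'" "a' \<notin> (\<Union>y\<in>set bs. sect y)" "Gen (a' # as) bs"
    using l.Gen_X[OF IH(1)] D1 by blast
  have sub: "set (a' # as) \<subseteq> E" "set (a' # as) \<subseteq> SX"
    using a' P' IH(2) l.XM.subset_space[OF Q'(4)] by auto
  have cX: "cosect x \<in> \<Y>" if "x \<in> set (a' # as)" for x using sub r.sect that by blast
  have D2: "Q' - (\<Union>x\<in>set (a' # as). SY - cosect x) \<in> \<Y> \<and>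
      \<nu> Q' - real (card (set (a' # as))) * (\<epsilon> * \<nu> Q') \<le> \<nu> (Q' - (\<Union>x\<in>set (a' # as). SY - cosect x))"
  proof (rule l.Y.measure_Diff_UN_ge[OF finite_set Q'Y])
    fix x assume x: "x \<in> set (a' # as)"
    show "SY - cosect x \<in> \<Y>" using cX[OF x] l.Y.Diff l.Y.space by blast
    have "Q' \<inter> (SY - cosect x) = Q' - cosect x" using l.YM.subset_space Q'(1) by blast
    then show "\<nu> (Q' \<inter> (SY - cosect x)) \<le> \<epsilon> * \<nu> Q'" using Q'(6) x sub by auto
  qed
  have "card (set (a' # as)) \<le> Suc u" using card_length[of "a' # as"] len by simp
  then have "0 < \<nu> (Q' - (\<Union>x\<in>set (a' # as). SY - cosect x))"
    using D2 small[OF _ Q'(3)] by (smt (verit) mult.assoc)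
  \<comment> \<open>Being chosen after \<open>a'\<close>, the new \<open>b'\<close> can be related
    to \<open>a'\<close> and to the whole tail at once, which includes the diagonal in the pattern
    \<open>\<ge>\<close>.\<close>
  then obtain b' where b': "b' \<in> Q'" "b' \<notin> (\<Union>x\<in>set (a' # as). SY - cosect x)" "Gen (a' # as) (b' # bs)"
    using l.Gen_Y[OF a'(3)] D2 by blast
  have "b' \<in> SY" using b' Q'Y l.Y.subset_space by blast
  have "l.chain (\<ge>) (Suc u) (a' # as) (b' # bs)"
    using IH(4)
  proof (rule l.chain_ge_Cons)
    show "\<forall>y\<in>set bs. \<not> R a' y" using a'(2) sub by (auto simp: l.sect_def)
    show "\<forall>x\<in>set (a' # as). R x b'" using b'(2) \<open>b' \<in> SY\<close> by (auto simp: r.sect_def)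
  qed
  moreover have "set (a' # as) \<subseteq> P" "set (b' # bs) \<subseteq> Q" using a' b' P' Q' IH by auto
  ultimately show ?case using b'(3) by blast
qed

lemma no_disagreement:
  assumes a: "r.typical a" and b: "l.typical b"
    and pos: "\<And>Q. Q \<in> YM \<Longrightarrow> b \<in> Q \<Longrightarrow> 0 < \<nu> (Q \<inter> cosect a)"
    and neg: "\<And>P. P \<in> XM \<Longrightarrow> a \<in> P \<Longrightarrow> 0 < \<mu> (P - sect b)"
  shows False
proof -
  have "a \<in> SX" "b \<in> SY" using a b by (auto simp: r.typical_def l.typical_def)
  moreover have "real (Suc k) * (1 / (real k + 2)) < 1" by (simp add: field_simps)
  ultimately obtain as bs where "Gen as bs" "l.chain (\<ge>) k as bs"
    using chain_of_pieces[OF a b pos neg, of "1 / (real k + 2)" k SX SY] l.XM.space l.YM.space by auto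
  then show False using l.no_chain_ge by blast
qed

text \<open>Each hypothesis is an alternative because a pair of \<open>GP\<close> is in good
  position in one order and informs on one side only. The dichotomies supply the other side, and
  every combination contains a disagreement, as it stands or with the two sides exchanged.\<close>

lemma sections_determined:
  assumes a: "r.typical a" and b: "l.typical b"
    and 1: "(\<forall>Q\<in>YM. b \<in> Q \<longrightarrow> 0 < \<nu> (Q \<inter> cosect a)) \<or> (\<forall>P\<in>XM. a \<in> P \<longrightarrow> 0 < \<mu> (P \<inter> sect b))"
    and 2: "(\<forall>Q\<in>YM. b \<in> Q \<longrightarrow> 0 < \<nu> (Q - cosect a)) \<or> (\<forall>P\<in>XM. a \<in> P \<longrightarrow> 0 < \<mu> (P - sect b))"
  shows False
proof -
  interpret s: stable_relation SY \<Y> \<nu> YM SX \<X> \<mu> XM "\<lambda>y x. R x y" cosect sect "\<lambda>bs as. Gen as bs" k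
    by (intro stable_relation.intro l.measured_relation_axioms r.measured_relation_axioms)
  have X: "(\<forall>P\<in>XM. a \<in> P \<longrightarrow> 0 < \<mu> (P \<inter> sect b)) \<or> (\<forall>P\<in>XM. a \<in> P \<longrightarrow> 0 < \<mu> (P - sect b))"
    using l.dichotomy[OF b] a by (auto simp: r.typical_def)
  have Y: "(\<forall>Q\<in>YM. b \<in> Q \<longrightarrow> 0 < \<nu> (Q \<inter> cosect a)) \<or> (\<forall>Q\<in>YM. b \<in> Q \<longrightarrow> 0 < \<nu> (Q - cosect a))"
    using r.dichotomy[OF a] b by (auto simp: l.typical_def)
  have "\<not> ((\<forall>Q\<in>YM. b \<in> Q \<longrightarrow> 0 < \<nu> (Q \<inter> cosect a)) \<and> (\<forall>P\<in>XM. a \<in> P \<longrightarrow> 0 < \<mu> (P - sect b)))"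
    using no_disagreement[OF a b] by blast
  moreover have "\<not> ((\<forall>P\<in>XM. a \<in> P \<longrightarrow> 0 < \<mu> (P \<inter> sect b)) \<and> (\<forall>Q\<in>YM. b \<in> Q \<longrightarrow> 0 < \<nu> (Q - cosect a)))"
    using s.no_disagreement[OF b a] by blast
  ultimately show False using 1 2 X Y by blast
qed

end

section \<open>Internal sets\<close>

locale nonstandard_group =
  fixes U :: "nat filter" and Gs :: "nat \<Rightarrow> 'a monoid"
  assumes ns: "nonstandard_finite_group U Gs"
begin

abbreviation G :: "'a ultra monoid" where "G \<equiv> ultraproduct U Gs"

abbreviation dens :: "nat \<Rightarrow> 'a ultra list set \<Rightarrow> real" where "dens \<equiv> density U Gs"

lemma U_neq_bot: "U \<noteq> bot"
  using ns by (simp add: nonstandard_finite_group_def ultrafilter_def)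

lemma eventually_not_iff: "(\<forall>\<^sub>F n in U. \<not> P n) \<longleftrightarrow> \<not> (\<forall>\<^sub>F n in U. P n)"
proof
  assume "\<forall>\<^sub>F n in U. \<not> P n"
  then show "\<not> (\<forall>\<^sub>F n in U. P n)"
    using U_neq_bot eventually_conj[of P U "\<lambda>n. \<not> P n"] by (auto simp: eventually_False)
next
  assume "\<not> (\<forall>\<^sub>F n in U. P n)"
  then show "\<forall>\<^sub>F n in U. \<not> P n"
    using ns unfolding nonstandard_finite_group_def ultrafilter_def by blast
qed

lemma group_Gs: "group (Gs n)" and finite_carrier: "finite (carrier (Gs n))"
  using ns by (auto simp: nonstandard_finite_group_def)

lemma order_pos: "0 < order (Gs n)"
  using group.is_monoid[OF group_Gs[of n], THEN monoid.one_closed] finite_carrier[of n]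
  by (auto simp: order_def card_gt_0_iff)

text \<open>An ultrafilter containing a singleton is principal, so finite sets are
  negligible.\<close>

lemma eventually_ge: "\<forall>\<^sub>F n in U. j \<le> n"
proof -
  have ne: "\<forall>\<^sub>F n in U. n \<noteq> i" for i
  proof (rule ccontr)
    assume "\<not> ?thesis"
    then have ev: "\<forall>\<^sub>F n in U. n = i" using eventually_not_iff[of "\<lambda>n. n = i"] by simp
    have "eventually P U \<longleftrightarrow> P i" for P
    proof
      assume "eventually P U"
      with ev have "\<forall>\<^sub>F n in U. P i" by eventually_elim simp
      then show "P i" using U_neq_bot by (cases "P i") auto
    next
      assume "P i"
      then show "eventually P U" using ev by (auto elim: eventually_mono)
    qed
    then have "U = principal {i}" by (simp add: filter_eq_iff eventually_principal)
    then show False using ns by (simp add: nonstandard_finite_group_def nonprincipal_def)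
  qed
  have "\<forall>\<^sub>F n in U. \<forall>i\<in>{..<j}. n \<noteq> i" by (intro eventually_ball_finite) (auto simp: ne)
  then show ?thesis by eventually_elim (use linorder_not_less in auto)
qed

section \<open>Sequences of tuples and tuples of classes\<close>

definition seqs :: "nat \<Rightarrow> (nat \<Rightarrow> 'a list) set" where
  "seqs k = {xs. \<forall>n. xs n \<in> tuples (Gs n) k}"

text \<open>The identification of the ultraproduct of the powers with the power of the ultraproduct:
  choices are made index by index in \<open>seqs\<close>, while elements of powers of
  \<open>G\<close> are tuples of classes.\<close>

definition cls :: "nat \<Rightarrow> (nat \<Rightarrow> 'a list) \<Rightarrow> 'a ultra list" where
  "cls k xs = map (\<lambda>i. ultra_class U Gs (\<lambda>n. xs n ! i)) [0..<k]"

lemma seqsD: "xs \<in> seqs k \<Longrightarrow> xs n \<in> tuples (Gs n) k"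
  by (simp add: seqs_def)

lemma length_seqs: "xs \<in> seqs k \<Longrightarrow> length (xs n) = k"
  by (simp add: seqs_def tuples_def)

lemma seqs_nth: "xs \<in> seqs k \<Longrightarrow> i < k \<Longrightarrow> (\<lambda>n. xs n ! i) \<in> sequences Gs"
  using nth_mem by (fastforce simp: seqs_def tuples_def sequences_def)

lemma seqs_exists: "\<exists>xs. xs \<in> seqs k"
proof
  show "(\<lambda>n. replicate k \<one>\<^bsub>Gs n\<^esub>) \<in> seqs k"
    using group.is_monoid[OF group_Gs, THEN monoid.one_closed] by (auto simp: seqs_def tuples_def)
qed

lemma ultra_class_eq:
  assumes "g \<in> sequences Gs" "h \<in> sequences Gs"
  shows "ultra_class U Gs g = ultra_class U Gs h \<longleftrightarrow> (\<forall>\<^sub>F n in U. g n = h n)"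
proof
  assume "ultra_class U Gs g = ultra_class U Gs h"
  moreover have "h \<in> ultra_class U Gs h" using assms by (simp add: ultra_class_def ultra_rel_def)
  ultimately show "\<forall>\<^sub>F n in U. g n = h n" by (auto simp: ultra_class_def ultra_rel_def)
next
  assume eq: "\<forall>\<^sub>F n in U. g n = h n"
  have "(\<forall>\<^sub>F n in U. g n = f n) \<longleftrightarrow> (\<forall>\<^sub>F n in U. h n = f n)" for f
    by (rule eventually_cong[OF eq]) simp
  then show "ultra_class U Gs g = ultra_class U Gs h"
    using assms by (simp add: ultra_class_def ultra_rel_def)
qed

lemma length_cls [simp]: "length (cls k xs) = k"
  by (simp add: cls_def)

lemma cls_eq_iff:
  assumes "xs \<in> seqs k" "ys \<in> seqs k"
  shows "cls k xs = cls k ys \<longleftrightarrow> (\<forall>\<^sub>F n in U. xs n = ys n)"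
proof -
  have "cls k xs = cls k ys \<longleftrightarrow> (\<forall>i\<in>{..<k}. \<forall>\<^sub>F n in U. xs n ! i = ys n ! i)"
    using assms by (auto simp: cls_def list_eq_iff_nth_eq ultra_class_eq[OF seqs_nth seqs_nth])
  also have "\<dots> \<longleftrightarrow> (\<forall>\<^sub>F n in U. \<forall>i\<in>{..<k}. xs n ! i = ys n ! i)"
    by (simp add: eventually_ball_finite_distrib)
  also have "\<dots> \<longleftrightarrow> (\<forall>\<^sub>F n in U. xs n = ys n)"
    by (simp add: list_eq_iff_nth_eq length_seqs[OF assms(1)] length_seqs[OF assms(2)] Ball_def)
  finally show ?thesis .
qed

lemma carrier_G: "carrier G = ultra_class U Gs ` sequences Gs"
  by (auto simp: ultraproduct_def quotient_def ultra_class_def)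

lemma cls_in_tuples: "xs \<in> seqs k \<Longrightarrow> cls k xs \<in> tuples G k"
  using seqs_nth by (auto simp: tuples_def cls_def carrier_G)

lemma map_ultra_class:
  assumes "set gs \<subseteq> sequences Gs"
  shows "(\<lambda>n. map (\<lambda>g. g n) gs) \<in> seqs (length gs)"
    "map (ultra_class U Gs) gs = cls (length gs) (\<lambda>n. map (\<lambda>g. g n) gs)"
proof -
  show "(\<lambda>n. map (\<lambda>g. g n) gs) \<in> seqs (length gs)"
    using assms by (auto simp: seqs_def tuples_def sequences_def)
  show "map (ultra_class U Gs) gs = cls (length gs) (\<lambda>n. map (\<lambda>g. g n) gs)"
    by (rule nth_equalityI) (auto simp: cls_def)
qed

lemma tuples_cases:
  assumes "x \<in> tuples G k"
  obtains xs where "xs \<in> seqs k" "x = cls k xs"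
proof -
  have "\<forall>y\<in>set x. \<exists>g\<in>sequences Gs. y = ultra_class U Gs g"
    using assms by (auto simp: tuples_def carrier_G)
  then obtain f where f: "\<And>y. y \<in> set x \<Longrightarrow> f y \<in> sequences Gs \<and> y = ultra_class U Gs (f y)"
    by metis
  have "x = map (ultra_class U Gs) (map f x)"
    unfolding map_map o_def by (rule map_idI[symmetric]) (use f in auto)
  then show thesis
    using map_ultra_class[of "map f x"] f that assms by (fastforce simp: tuples_def)
qed

lemma cls_append:
  assumes "xs \<in> seqs k" "ys \<in> seqs m"
  shows "(\<lambda>n. xs n @ ys n) \<in> seqs (k + m)" "cls k xs @ cls m ys = cls (k + m) (\<lambda>n. xs n @ ys n)"
proof -
  show "(\<lambda>n. xs n @ ys n) \<in> seqs (k + m)" using assms by (auto simp: seqs_def tuples_def)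
  show "cls k xs @ cls m ys = cls (k + m) (\<lambda>n. xs n @ ys n)"
    by (rule nth_equalityI) (auto simp: cls_def nth_append length_seqs[OF assms(1)])
qed

lemma cls_select:
  assumes "xs \<in> seqs N" "set js \<subseteq> {..<N}"
  shows "(\<lambda>n. map ((!) (xs n)) js) \<in> seqs (length js)"
    "map ((!) (cls N xs)) js = cls (length js) (\<lambda>n. map ((!) (xs n)) js)"
proof -
  show "(\<lambda>n. map ((!) (xs n)) js) \<in> seqs (length js)"
    using assms seqs_nth[OF assms(1)] by (auto simp: seqs_def tuples_def sequences_def subset_iff)
  have "js ! i < N" if "i < length js" for i using assms(2) nth_mem[OF that] by blast
  then show "map ((!) (cls N xs)) js = cls (length js) (\<lambda>n. map ((!) (xs n)) js)"
    by (intro nth_equalityI) (auto simp: cls_def)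
qed

definition rep :: "nat \<Rightarrow> 'a ultra list set \<Rightarrow> (nat \<Rightarrow> 'a list set) \<Rightarrow> bool" where
  "rep k X Xs \<longleftrightarrow> (\<forall>n. Xs n \<subseteq> tuples (Gs n) k) \<and> X = internal_set U Gs k Xs"

lemma internal_iff_rep: "internal U Gs k X \<longleftrightarrow> (\<exists>Xs. rep k X Xs)"
  by (simp add: internal_def rep_def)

lemma internal_set_eq: "internal_set U Gs k Xs = cls k ` {xs \<in> seqs k. \<forall>\<^sub>F n in U. xs n \<in> Xs n}"
proof (intro equalityI subsetI)
  fix x assume "x \<in> internal_set U Gs k Xs"
  then obtain gs where "x = map (ultra_class U Gs) gs" "length gs = k" "set gs \<subseteq> sequences Gs"
    "\<forall>\<^sub>F n in U. map (\<lambda>g. g n) gs \<in> Xs n" by (auto simp: internal_set_def)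
  then show "x \<in> cls k ` {xs \<in> seqs k. \<forall>\<^sub>F n in U. xs n \<in> Xs n}"
    using map_ultra_class[of gs] by auto
next
  fix x assume "x \<in> cls k ` {xs \<in> seqs k. \<forall>\<^sub>F n in U. xs n \<in> Xs n}"
  then obtain xs where xs: "xs \<in> seqs k" "\<forall>\<^sub>F n in U. xs n \<in> Xs n" "x = cls k xs" by auto
  define gs where "gs = map (\<lambda>i n. xs n ! i) [0..<k]"
  have "map (\<lambda>g. g n) gs = xs n" for n
    using length_seqs[OF xs(1)] by (auto simp: gs_def intro: nth_equalityI)
  moreover have "set gs \<subseteq> sequences Gs" using seqs_nth[OF xs(1)] by (auto simp: gs_def)
  moreover have "x = map (ultra_class U Gs) gs" "length gs = k" by (auto simp: xs(3) cls_def gs_def)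
  ultimately show "x \<in> internal_set U Gs k Xs" using xs(2) by (auto simp: internal_set_def)
qed

lemma rep_mem:
  assumes "rep k X Xs" "xs \<in> seqs k"
  shows "cls k xs \<in> X \<longleftrightarrow> (\<forall>\<^sub>F n in U. xs n \<in> Xs n)"
proof
  assume "cls k xs \<in> X"
  then obtain ys where ys: "ys \<in> seqs k" "\<forall>\<^sub>F n in U. ys n \<in> Xs n" "cls k xs = cls k ys"
    using assms by (auto simp: rep_def internal_set_eq)
  then have "\<forall>\<^sub>F n in U. xs n = ys n" using cls_eq_iff assms by blast
  with ys(2) show "\<forall>\<^sub>F n in U. xs n \<in> Xs n" by eventually_elim simp
qed (use assms in \<open>auto simp: rep_def internal_set_eq\<close>)

lemma rep_subset: "rep k X Xs \<Longrightarrow> X \<subseteq> tuples G k"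
  using cls_in_tuples by (auto simp: rep_def internal_set_eq)

lemma repI:
  assumes "\<And>n. Xs n \<subseteq> tuples (Gs n) k" "X \<subseteq> tuples G k"
    and "\<And>xs. xs \<in> seqs k \<Longrightarrow> cls k xs \<in> X \<longleftrightarrow> (\<forall>\<^sub>F n in U. xs n \<in> Xs n)"
  shows "rep k X Xs"
proof -
  have "X = internal_set U Gs k Xs"
  proof (intro equalityI subsetI)
    fix x assume x: "x \<in> X"
    then obtain xs where xs: "xs \<in> seqs k" "x = cls k xs" using assms(2) tuples_cases by blast
    then show "x \<in> internal_set U Gs k Xs" using assms(3)[of xs] x by (auto simp: internal_set_eq)
  next
    fix x assume "x \<in> internal_set U Gs k Xs"
    then show "x \<in> X" using assms(3) by (auto simp: internal_set_eq)
  qed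
  then show ?thesis using assms(1) by (simp add: rep_def)
qed

lemma rep_Int: "rep k X Xs \<Longrightarrow> rep k Y Ys \<Longrightarrow> rep k (X \<inter> Y) (\<lambda>n. Xs n \<inter> Ys n)"
  using rep_subset by (intro repI) (auto simp: rep_mem eventually_conj_iff, auto simp: rep_def)

lemma rep_Diff: "rep k X Xs \<Longrightarrow> rep k Y Ys \<Longrightarrow> rep k (X - Y) (\<lambda>n. Xs n - Ys n)"
  using rep_subset
  by (intro repI) (auto simp: rep_mem eventually_conj_iff eventually_not_iff, auto simp: rep_def)

lemma rep_tuples: "rep k (tuples G k) (\<lambda>n. tuples (Gs n) k)"
  by (rule repI) (auto simp: cls_in_tuples seqsD)

lemma rep_fibre:
  assumes "rep (k + m) Z Zs" "ys \<in> seqs m"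
  shows "rep k (fibre G k Z (cls m ys)) (\<lambda>n. fibre (Gs n) k (Zs n) (ys n))"
proof (rule repI)
  fix xs assume xs: "xs \<in> seqs k"
  show "cls k xs \<in> fibre G k Z (cls m ys) \<longleftrightarrow> (\<forall>\<^sub>F n in U. xs n \<in> fibre (Gs n) k (Zs n) (ys n))"
    using rep_mem[OF assms(1) cls_append(1)[OF xs assms(2)]] cls_append(2)[OF xs assms(2)]
      cls_in_tuples[OF xs] seqsD[OF xs] by (simp add: fibre_def)
qed (auto simp: fibre_def)

text \<open>Inverse image under the map selecting the coordinates \<open>js\<close>; permutations
  and dummy coordinates are both covered. The group is an argument because the same operation is
  applied to \<open>G\<close> and to each \<open>Gs n\<close>.\<close>

definition pull :: "'g monoid \<Rightarrow> nat \<Rightarrow> nat list \<Rightarrow> 'g list set \<Rightarrow> 'g list set" where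
  "pull H N js W = {z \<in> tuples H N. map ((!) z) js \<in> W}"

lemma rep_pull:
  assumes "rep (length js) W Ws" "set js \<subseteq> {..<N}"
  shows "rep N (pull G N js W) (\<lambda>n. pull (Gs n) N js (Ws n))"
proof (rule repI)
  fix xs assume xs: "xs \<in> seqs N"
  show "cls N xs \<in> pull G N js W \<longleftrightarrow> (\<forall>\<^sub>F n in U. xs n \<in> pull (Gs n) N js (Ws n))"
    using rep_mem[OF assms(1) cls_select(1)[OF xs assms(2)]] cls_select(2)[OF xs assms(2)]
      cls_in_tuples[OF xs] seqsD[OF xs] by (simp add: pull_def)
qed (auto simp: pull_def)

lemma finite_tuples: "finite (tuples (Gs n) k)" and card_tuples: "card (tuples (Gs n) k) = order (Gs n) ^ k"
proof -
  have "tuples (Gs n) k = {x. set x \<subseteq> carrier (Gs n) \<and> length x = k}" by (auto simp: tuples_def)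
  then show "finite (tuples (Gs n) k)" "card (tuples (Gs n) k) = order (Gs n) ^ k"
    using finite_lists_length_eq[OF finite_carrier] card_lists_length_eq[OF finite_carrier]
    by (simp_all add: order_def)
qed

lemma rep_finite: "rep k X Xs \<Longrightarrow> finite (Xs n)"
  by (rule finite_subset[OF _ finite_tuples[of n k]]) (simp add: rep_def)

section \<open>Densities: additivity, Fubini, selection of coordinates\<close>

lemma dens_tendsto:
  "rep k X Xs \<Longrightarrow> ((\<lambda>n. real (card (Xs n)) / real (order (Gs n)) ^ k) \<longlongrightarrow> dens k X) U"
  using density_tendsto[OF ns] by (auto simp: rep_def)

lemma dens_le:
  assumes "rep k X Xs" "rep m Y Ys"
    and "\<forall>\<^sub>F n in U. real (card (Xs n)) / real (order (Gs n)) ^ k \<le> c * (real (card (Ys n)) / real (order (Gs n)) ^ m)"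
  shows "dens k X \<le> c * dens m Y"
  by (rule tendsto_le[OF U_neq_bot _ dens_tendsto[OF assms(1)] assms(3)])
    (intro tendsto_intros dens_tendsto[OF assms(2)])

lemma dens_nonneg: "internal U Gs k X \<Longrightarrow> 0 \<le> dens k X"
proof -
  assume "internal U Gs k X"
  then obtain Xs where "rep k X Xs" using internal_iff_rep by blast
  then show ?thesis by (rule tendsto_lowerbound[OF dens_tendsto _ U_neq_bot]) simp
qed

lemma dens_tuples: "dens k (tuples G k) = 1"
proof -
  have "((\<lambda>n. 1) \<longlongrightarrow> dens k (tuples G k)) U"
    using dens_tendsto[OF rep_tuples[of k]] order_pos by (simp add: card_tuples less_imp_neq[THEN not_sym])
  then show ?thesis using tendsto_unique[OF U_neq_bot] tendsto_const by blast
qed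

lemma content_internal: "content (tuples G k) {X. internal U Gs k X} (dens k)"
proof
  fix P Q assume "P \<in> {X. internal U Gs k X}" "Q \<in> {X. internal U Gs k X}"
  then obtain Ps Qs where PQ: "rep k P Ps" "rep k Q Qs" by (auto simp: internal_iff_rep)
  have "((\<lambda>n. real (card (Ps n \<inter> Qs n)) / real (order (Gs n)) ^ k
      + real (card (Ps n - Qs n)) / real (order (Gs n)) ^ k) \<longlongrightarrow> dens k (P \<inter> Q) + dens k (P - Q)) U"
    by (intro tendsto_add dens_tendsto rep_Int rep_Diff PQ)
  moreover have "real (card (Ps n \<inter> Qs n)) / real (order (Gs n)) ^ k
      + real (card (Ps n - Qs n)) / real (order (Gs n)) ^ k = real (card (Ps n)) / real (order (Gs n)) ^ k" for n
    using card_Int_Diff[OF rep_finite[OF PQ(1)], of n "Qs n"] by (simp add: add_divide_distrib)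
  ultimately have "((\<lambda>n. real (card (Ps n)) / real (order (Gs n)) ^ k) \<longlongrightarrow> dens k (P \<inter> Q) + dens k (P - Q)) U"
    by simp
  then show "dens k P = dens k (P \<inter> Q) + dens k (P - Q)"
    using tendsto_unique[OF U_neq_bot dens_tendsto[OF PQ(1)]] by blast
next
  show "tuples G k \<in> {X. internal U Gs k X}" using rep_tuples internal_iff_rep by blast
next
  fix P assume "P \<in> {X. internal U Gs k X}"
  then show "P \<subseteq> tuples G k" "0 \<le> dens k P" using rep_subset dens_nonneg internal_iff_rep by blast+
next
  fix P Q assume "P \<in> {X. internal U Gs k X}" "Q \<in> {X. internal U Gs k X}"
  then show "P \<inter> Q \<in> {X. internal U Gs k X}" "P - Q \<in> {X. internal U Gs k X}"
    using rep_Int rep_Diff by (metis internal_iff_rep mem_Collect_eq)+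
qed

lemma dens_le_1: "internal U Gs k X \<Longrightarrow> dens k X \<le> 1"
  using content.mono[OF content_internal, of X k "tuples G k"] dens_tuples rep_tuples rep_subset
  by (metis internal_iff_rep mem_Collect_eq)

text \<open>If for almost all \<open>n\<close> some point of \<open>Ds n\<close> had a fibre of
  relative size below \<open>c / 2\<close>, these points would form an element of \<open>D\<close>
  with a fibre of density at most \<open>c / 2\<close>. Thus at almost every index all fibres are
  large, and pairs can be counted. Halving \<open>c\<close> is what makes the limit bound uniform at
  a single index.\<close>

lemma dens_Fubini:
  assumes Z: "internal U Gs (k + m) Z" and D: "internal U Gs m D" and c: "0 < c"
    and fib: "\<And>y. y \<in> D \<Longrightarrow> c \<le> dens k (fibre G k Z y)"
  shows "c / 2 * dens m D \<le> dens (k + m) Z"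
proof -
  obtain Zs Ds where Zs: "rep (k + m) Z Zs" and Ds: "rep m D Ds" using Z D internal_iff_rep by blast
  define bd where "bd n y \<longleftrightarrow> y \<in> Ds n \<and>
    real (card (fibre (Gs n) k (Zs n) y)) < c / 2 * real (order (Gs n)) ^ k" for n y
  have "\<forall>\<^sub>F n in U. \<not> (\<exists>y. bd n y)"
  proof (rule ccontr)
    assume "\<not> ?thesis"
    then have ev: "\<forall>\<^sub>F n in U. \<exists>y. bd n y" using eventually_not_iff by blast
    obtain zs where zs: "zs \<in> seqs m" using seqs_exists by blast
    \<comment> \<open>\<open>zs\<close> only fills in at the negligible indices without a bad
      point.\<close>
    define ys where "ys n = (if \<exists>y. bd n y then SOME y. bd n y else zs n)" for n
    have bd: "bd n (ys n)" if "\<exists>y. bd n y" for n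
      using that someI_ex[OF that] by (simp add: ys_def)
    have ys: "ys \<in> seqs m"
      unfolding seqs_def
    proof (intro CollectI allI)
      fix n show "ys n \<in> tuples (Gs n) m"
        using bd[of n] seqsD[OF zs, of n] Ds by (cases "\<exists>y. bd n y") (auto simp: bd_def rep_def ys_def)
    qed
    have "cls m ys \<in> D"
      unfolding rep_mem[OF Ds ys] using ev by eventually_elim (use bd bd_def in blast)
    then have "c \<le> dens k (fibre G k Z (cls m ys))" by (rule fib)
    also have "\<dots> \<le> c / 2"
    proof (rule tendsto_upperbound[OF dens_tendsto[OF rep_fibre[OF Zs ys]] _ U_neq_bot])
      show "\<forall>\<^sub>F n in U. real (card (fibre (Gs n) k (Zs n) (ys n))) / real (order (Gs n)) ^ k \<le> c / 2"
        using ev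
      proof eventually_elim
        case (elim n)
        then show ?case using bd[of n] order_pos[of n] by (simp add: bd_def divide_le_eq)
      qed
    qed
    finally show False using c by simp
  qed
  then have "\<forall>\<^sub>F n in U. real (card (Ds n)) / real (order (Gs n)) ^ m
    \<le> 2 / c * (real (card (Zs n)) / real (order (Gs n)) ^ (k + m))"
  proof eventually_elim
    case (elim n)
    have fin: "finite (Ds n)" "finite (Zs n)" using rep_finite Zs Ds by blast+
    have finf: "finite (fibre (Gs n) k (Zs n) y)" for y
      by (rule finite_subset[OF _ finite_tuples[of n k]]) (auto simp: fibre_def)
    let ?S = "SIGMA y:Ds n. fibre (Gs n) k (Zs n) y"
    have "real (card (Ds n)) * (c / 2 * real (order (Gs n)) ^ k)
      = (\<Sum>y\<in>Ds n. c / 2 * real (order (Gs n)) ^ k)" by simp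
    also have "\<dots> \<le> (\<Sum>y\<in>Ds n. real (card (fibre (Gs n) k (Zs n) y)))"
      by (rule sum_mono) (use elim in \<open>auto simp: bd_def not_less\<close>)
    also have "\<dots> = real (card ?S)" using fin finf by simp
    also have "card ?S \<le> card (Zs n)"
    proof (rule card_inj_on_le[of "\<lambda>(y, x). x @ y"])
      show "inj_on (\<lambda>(y, x). x @ y) ?S" by (auto simp: inj_on_def fibre_def tuples_def)
    qed (use fin in \<open>auto simp: fibre_def\<close>)
    finally have "real (card (Ds n)) * (c / 2 * real (order (Gs n)) ^ k) \<le> real (card (Zs n))" by simp
    then show ?case using c order_pos[of n] by (simp add: field_simps power_add)
  qed
  then have "dens m D \<le> 2 / c * dens (k + m) Z" by (rule dens_le[OF Ds Zs])
  then show ?thesis using c by (simp add: field_simps)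
qed

text \<open>A tuple is determined by its coordinates in \<open>js\<close> and the remaining ones, of
  which there are \<open>N - length js\<close> as \<open>js\<close> is distinct.\<close>

lemma dens_pull_le:
  assumes W: "internal U Gs (length js) W" and js: "distinct js" "set js \<subseteq> {..<N}"
  shows "dens N (pull G N js W) \<le> dens (length js) W"
proof -
  obtain Ws where Ws: "rep (length js) W Ws" using W internal_iff_rep by blast
  define rs where "rs = filter (\<lambda>i. i \<notin> set js) [0..<N]"
  have "card (set js) \<le> N" using card_mono[OF _ js(2)] by simp
  then have le: "length js \<le> N" using distinct_card[OF js(1)] by simp
  have "length rs = card ({..<N} - set js)"
    unfolding rs_def by (subst distinct_card[symmetric]) (auto intro: arg_cong[where f = card])
  then have rs: "length rs = N - length js"
    using card_Diff_subset[OF finite_set js(2)] distinct_card[OF js(1)] by simp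
  have "real (card (pull (Gs n) N js (Ws n))) / real (order (Gs n)) ^ N
    \<le> 1 * (real (card (Ws n)) / real (order (Gs n)) ^ length js)" for n
  proof -
    have "card (pull (Gs n) N js (Ws n)) \<le> card (Ws n \<times> tuples (Gs n) (length rs))"
    proof (rule card_inj_on_le[of "\<lambda>z. (map ((!) z) js, map ((!) z) rs)"])
      show "inj_on (\<lambda>z. (map ((!) z) js, map ((!) z) rs)) (pull (Gs n) N js (Ws n))"
      proof (rule inj_onI)
        fix z w assume zw: "z \<in> pull (Gs n) N js (Ws n)" "w \<in> pull (Gs n) N js (Ws n)"
          "(map ((!) z) js, map ((!) z) rs) = (map ((!) w) js, map ((!) w) rs)"
        have "z ! i = w ! i" if "i < N" for i
          using zw(3) that by (cases "i \<in> set js") (auto simp: rs_def)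
        then show "z = w" using zw(1,2) by (intro nth_equalityI) (auto simp: pull_def tuples_def)
      qed
      show "(\<lambda>z. (map ((!) z) js, map ((!) z) rs)) ` pull (Gs n) N js (Ws n) \<subseteq> Ws n \<times> tuples (Gs n) (length rs)"
        by (auto simp: pull_def tuples_def rs_def intro: nth_mem[THEN subsetD[rotated]])
      show "finite (Ws n \<times> tuples (Gs n) (length rs))" using rep_finite[OF Ws] finite_tuples by simp
    qed
    then have "card (pull (Gs n) N js (Ws n)) \<le> card (Ws n) * order (Gs n) ^ (N - length js)"
      by (simp add: card_cartesian_product card_tuples rs)
    then have "real (card (pull (Gs n) N js (Ws n))) \<le> real (card (Ws n)) * real (order (Gs n)) ^ (N - length js)"
      by (metis of_nat_le_iff of_nat_mult of_nat_power)
    moreover have "real (order (Gs n)) ^ N = real (order (Gs n)) ^ length js * real (order (Gs n)) ^ (N - length js)"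
      using le by (simp flip: power_add)
    ultimately show ?thesis using order_pos[of n] by (simp add: field_simps)
  qed
  then show ?thesis using dens_le[OF rep_pull[OF Ws js(2)] Ws, of 1] by simp
qed

section \<open>Countable saturation\<close>

text \<open>Removing finitely many null sets leaves positive density, so each \<open>A j n\<close>
  is non-empty for almost all \<open>n\<close>. Diagonally, index \<open>n\<close> gets a point of
  \<open>A j n\<close> for the largest admissible \<open>j\<close>; since the \<open>A j n\<close>
  decrease in \<open>j\<close>, the resulting class avoids every null set of the list.\<close>

lemma saturation:
  assumes C: "internal U Gs k C" "0 < dens k C"
    and Z: "countable \<Z>" "\<And>Z. Z \<in> \<Z> \<Longrightarrow> internal U Gs k Z" "\<And>Z. Z \<in> \<Z> \<Longrightarrow> dens k Z = 0"
  shows "\<exists>x\<in>C. x \<notin> \<Union>\<Z>"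
proof (cases "\<Z> = {}")
  case True
  interpret I: content "tuples G k" "{X. internal U Gs k X}" "dens k" by (rule content_internal)
  have "C \<noteq> {}" using C(2) by auto
  then show ?thesis using True by auto
next
  case False
  interpret I: content "tuples G k" "{X. internal U Gs k X}" "dens k" by (rule content_internal)
  define f where "f = from_nat_into \<Z>"
  have f: "\<Z> = range f" using range_from_nat_into[OF False Z(1)] by (simp add: f_def)
  obtain Cs where Cs: "rep k C Cs" using C internal_iff_rep by blast
  have "\<forall>i. \<exists>Zs. rep k (f i) Zs" using Z(2) f internal_iff_rep by blast
  then obtain Zs where Zs: "\<And>i. rep k (f i) (Zs i)" by metis
  define A where "A j n = Cs n - (\<Union>i<j. Zs i n)" for j n
  have dec: "A j n \<subseteq> A i n" if "i \<le> j" for i j n using that by (auto simp: A_def)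
  have repA: "rep k (C - (\<Union>i<j. f i)) (A j) \<and> 0 < dens k (C - (\<Union>i<j. f i))" for j
  proof (induction j)
    case 0
    then show ?case using Cs C by (simp add: A_def)
  next
    case (Suc j)
    have e1: "A (Suc j) = (\<lambda>n. A j n - Zs j n)" by (auto simp: A_def lessThan_Suc fun_eq_iff)
    have e2: "C - (\<Union>i<Suc j. f i) = (C - (\<Union>i<j. f i)) - f j" by (auto simp: lessThan_Suc)
    have int: "internal U Gs k (C - (\<Union>i<j. f i))" "internal U Gs k (f j)"
      using Suc Zs internal_iff_rep by blast+
    have "dens k ((C - (\<Union>i<j. f i)) \<inter> f j) \<le> dens k (f j)"
      by (rule I.mono) (use int I.Int in auto)
    then have "0 < dens k ((C - (\<Union>i<j. f i)) - f j)"
      using I.split[of "C - (\<Union>i<j. f i)" "f j"] int Suc Z(3) f by auto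
    then show ?case unfolding e1 e2 using rep_Diff Suc Zs by blast
  qed
  have ne: "\<forall>\<^sub>F n in U. A j n \<noteq> {}" for j
  proof -
    have "C - (\<Union>i<j. f i) \<noteq> {}" using repA[of j] I.measure_empty by force
    then obtain x where x: "x \<in> C - (\<Union>i<j. f i)" by blast
    then obtain xs where "xs \<in> seqs k" "x = cls k xs"
      using rep_subset repA tuples_cases by (metis subsetD)
    then have "\<forall>\<^sub>F n in U. xs n \<in> A j n" using rep_mem repA x by blast
    then show ?thesis by eventually_elim auto
  qed
  \<comment> \<open>The bound \<open>j \<le> n\<close> guarantees a maximum; for a fixed
    \<open>j\<close> it excludes finitely many \<open>n\<close> only.\<close>
  define J where "J n = {j. j \<le> n \<and> A j n \<noteq> {}}" for n
  obtain zs where zs: "zs \<in> seqs k" using seqs_exists by blast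
  define xs where "xs n = (if J n = {} then zs n else SOME x. x \<in> A (Max (J n)) n)" for n
  have finJ: "finite (J n)" for n by (simp add: J_def)
  have xsA: "xs n \<in> A (Max (J n)) n" if "J n \<noteq> {}" for n
  proof -
    have "\<forall>j\<in>J n. A j n \<noteq> {}" by (simp add: J_def)
    then have "A (Max (J n)) n \<noteq> {}" using Max_in[OF finJ that] by blast
    then show ?thesis using that by (simp add: xs_def some_in_eq)
  qed
  have xs: "xs \<in> seqs k"
    unfolding seqs_def
  proof (intro CollectI allI)
    fix n
    have "A j n \<subseteq> tuples (Gs n) k" for j using repA[of j] by (simp add: rep_def)
    then show "xs n \<in> tuples (Gs n) k"
      using xsA[of n] seqsD[OF zs, of n] by (cases "J n = {}") (auto simp: xs_def)
  qed
  have "cls k xs \<in> C - (\<Union>i<j. f i)" for j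
  proof -
    have "\<forall>\<^sub>F n in U. xs n \<in> A j n"
      using ne[of j] eventually_ge[of j]
    proof eventually_elim
      case (elim n)
      then have j: "j \<in> J n" by (simp add: J_def)
      then have "xs n \<in> A (Max (J n)) n" using xsA by blast
      moreover have "j \<le> Max (J n)" using Max_ge finJ j by blast
      ultimately show ?case using dec by blast
    qed
    then show ?thesis using rep_mem repA xs by blast
  qed
  then have "cls k xs \<in> C" "cls k xs \<notin> f i" for i
    by (blast, meson DiffD2 UN_I lessI lessThan_iff)
  then show ?thesis using f by blast
qed

end

section \<open>Tame families\<close>

lemma map_nth_middle: "map ((!) (xs @ ys @ zs)) [length xs..<length xs + length ys] = ys"
  by (rule nth_equalityI) (auto simp: nth_append)

lemma map_nth_prefix: "map ((!) (xs @ ys)) [0..<length xs] = xs"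
  using map_nth_middle[of "[]" xs ys] by simp

text \<open>Multiset inclusion counts repeated entries, so the positions can be chosen distinct,
  whatever the order.\<close>

lemma select_exists:
  assumes "mset ys \<subseteq># mset xs"
  obtains js where "distinct js" "set js \<subseteq> {..<length xs}" "map ((!) xs) js = ys"
proof -
  obtain rs where "mset xs = mset (ys @ rs)"
    using assms by (metis ex_mset mset_append subset_mset.le_iff_add)
  then have eq: "mset (ys @ rs) = mset xs" by simp
  obtain p where p: "p permutes {..<length xs}" "permute_list p xs = ys @ rs"
    using mset_eq_permutation[OF eq] by metis
  have len: "length ys \<le> length xs" using size_mset_mono[OF assms] by simp
  have "ys = take (length ys) (permute_list p xs)" by (simp add: p(2))
  also have "\<dots> = map ((!) xs) (map p [0..<length ys])"
    using len by (simp add: permute_list_def take_map)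
  finally have "map ((!) xs) (map p [0..<length ys]) = ys" by simp
  moreover have "distinct (map p [0..<length ys])"
    using permutes_inj_on[OF p(1)] by (simp add: distinct_map)
  moreover have "set (map p [0..<length ys]) \<subseteq> {..<length xs}"
  proof -
    have "p i < length xs" if "i < length ys" for i
      using permutes_in_image[OF p(1), of i] that len by simp
    then show ?thesis by auto
  qed
  ultimately show thesis using that by blast
qed

locale tame_group = nonstandard_group U Gs + tame_family U Gs F
  for U and Gs :: "nat \<Rightarrow> 'a monoid" and F +
  assumes countable_F: "countable (F i)"
begin

lemma internal_fibre:
  assumes Z: "internal U Gs (k + m) Z" and y: "y \<in> tuples G m"
  shows "internal U Gs k (fibre G k Z y)"
proof -
  obtain Zs where Zs: "rep (k + m) Z Zs" using Z internal_iff_rep by blast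
  obtain ys where ys: "ys \<in> seqs m" "y = cls m ys" using y tuples_cases by blast
  show ?thesis using rep_fibre[OF Zs ys(1)] unfolding ys(2) internal_iff_rep by blast
qed

abbreviation Def :: "'a ultra set \<Rightarrow> nat \<Rightarrow> 'a ultra list set set" where
  "Def \<equiv> defined_over G F"

lemma F_subset: "X \<in> F n \<Longrightarrow> X \<subseteq> tuples G n"
  using tame_family.internal[OF tame_family_axioms] internal_iff_rep rep_subset by blast

lemma F_tuples: "tuples G n \<in> F n"
  using words[of "[]" n] by (simp add: word_value_def)

text \<open>Up to a permutation of coordinates the inverse image is the product of \<open>W\<close>
  with a full power; \<open>js @ rs\<close> lists all positions.\<close>

lemma pull_F:
  assumes W: "W \<in> F (length js)" and js: "distinct js" "set js \<subseteq> {..<N}"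
  shows "pull G N js W \<in> F N"
proof -
  define rs where "rs = filter (\<lambda>i. i \<notin> set js) [0..<N]"
  have set_rs: "set (js @ rs) = {..<N}" using js(2) by (auto simp: rs_def)
  have dist: "distinct (js @ rs)" using js(1) by (auto simp: rs_def)
  have len: "length (js @ rs) = N" using distinct_card[OF dist] set_rs by simp
  define \<pi> where "\<pi> i = (if i < N then (js @ rs) ! i else i)" for i
  have "bij_betw ((!) (js @ rs)) {..<N} {..<N}"
    by (rule bij_betw_nth[OF dist]) (use len set_rs in auto)
  then have "bij_betw \<pi> {..<N} {..<N}"
    by (rule bij_betw_cong[THEN iffD1, rotated]) (simp add: \<pi>_def)
  then have \<pi>: "\<pi> permutes {..<N}" by (rule bij_imp_permutes) (simp add: \<pi>_def)
  have perm: "permute_list \<pi> z = map ((!) z) js @ map ((!) z) rs" if "length z = N" for z :: "'a ultra list"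
  proof -
    have "permute_list \<pi> z = map ((!) z) (map ((!) (js @ rs)) [0..<length (js @ rs)])"
      unfolding permute_list_def that len by (simp add: \<pi>_def)
    then show ?thesis by (simp only: map_nth map_append)
  qed
  let ?T = "tuples G (length rs)"
  have "pull G N js W = permute_list (inv_into UNIV \<pi>) ` pairs W ?T"
  proof (intro equalityI subsetI)
    fix z assume z: "z \<in> pull G N js W"
    then have lz: "length z = N" by (simp add: pull_def tuples_def)
    have "map ((!) z) rs \<in> ?T" using z by (auto simp: pull_def tuples_def rs_def)
    then have "permute_list \<pi> z \<in> pairs W ?T"
      using z by (auto simp: perm[OF lz] pairs_def pull_def)
    moreover have "permute_list (inv_into UNIV \<pi>) (permute_list \<pi> z) = z"
      using permute_list_compose[of "inv_into UNIV \<pi>" z \<pi>] permutes_inv[OF \<pi>] lz permutes_inv_o(1)[OF \<pi>] by simp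
    ultimately show "z \<in> permute_list (inv_into UNIV \<pi>) ` pairs W ?T" by (metis image_eqI)
  next
    fix z assume "z \<in> permute_list (inv_into UNIV \<pi>) ` pairs W ?T"
    then obtain w t where wt: "w \<in> W" "t \<in> ?T" "z = permute_list (inv_into UNIV \<pi>) (w @ t)"
      by (auto simp: pairs_def)
    have w: "w \<in> tuples G (length js)" using wt W F_subset by blast
    then have lwt: "length (w @ t) = N" using wt len by (simp add: tuples_def)
    then have lz: "length z = N" by (simp add: wt)
    have "permute_list \<pi> z = w @ t"
      using permute_list_compose[of \<pi> "w @ t" "inv_into UNIV \<pi>"] \<pi> lwt permutes_inv_o(2)[OF \<pi>] by (simp add: wt(3))
    then have "map ((!) z) js @ map ((!) z) rs = w @ t" by (simp add: perm[OF lz])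
    then have "map ((!) z) js = w" using w by (simp add: tuples_def)
    moreover have "set z = set (w @ t)"
      unfolding wt(3) using set_permute_list[of "inv_into UNIV \<pi>" "w @ t"] permutes_inv[OF \<pi>] lwt by simp
    ultimately show "z \<in> pull G N js W"
      using wt w lz by (auto simp: pull_def tuples_def)
  qed
  moreover have "pairs W ?T \<in> F N" using product[OF W F_tuples[of "length rs"]] len by simp
  ultimately show ?thesis using permutation[OF _ permutes_inv[OF \<pi>]] by simp
qed

section \<open>Sets defined over parameters\<close>

lemma Def_F: "W \<in> F n \<Longrightarrow> W \<in> Def A n"
proof -
  assume W: "W \<in> F n"
  then have "W = fibre G n W []" using F_subset by (auto simp: fibre_def)
  then show ?thesis using W unfolding defined_over_def by (intro CollectI exI[of _ W] exI[of _ "[]"]) auto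
qed

lemma Def_mono: "A \<subseteq> A' \<Longrightarrow> Def A n \<subseteq> Def A' n"
  unfolding defined_over_def by blast

lemma Def_subset: "X \<in> Def A n \<Longrightarrow> X \<subseteq> tuples G n"
  by (auto simp: defined_over_def fibre_def)

lemma countable_Def: "countable A \<Longrightarrow> countable (Def A n)"
proof -
  assume A: "countable A"
  have "Def A n = (\<lambda>(a, Y). fibre G n Y a) ` (SIGMA a:lists A. F (n + length a))"
    by (auto simp: defined_over_def image_iff)
  then show ?thesis
    by (simp only:) (intro countable_image countable_SIGMA countable_lists A countable_F)
qed

context
  fixes A assumes A: "A \<subseteq> carrier G"
begin

lemma Def_internal: "X \<in> Def A n \<Longrightarrow> internal U Gs n X"
proof -
  assume "X \<in> Def A n"
  then obtain W c where W: "W \<in> F (n + length c)" "set c \<subseteq> A" "X = fibre G n W c"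
    by (auto simp: defined_over_def)
  have "c \<in> tuples G (length c)" using W A by (auto simp: tuples_def)
  then show ?thesis
    using internal_fibre[OF tame_family.internal[OF tame_family_axioms W(1)]] W(3) by simp
qed

text \<open>Both sets receive the parameter tuple \<open>a @ b\<close>, and the coordinate lists
  skip the part belonging to the other one. Boolean operations can then be carried out in
  \<open>F\<close>.\<close>

lemma Def_common:
  assumes "X \<in> Def A n" "X' \<in> Def A n"
  obtains c W W' where "set c \<subseteq> A" "W \<in> F (n + length c)" "W' \<in> F (n + length c)"
    "X = fibre G n W c" "X' = fibre G n W' c"
proof -
  obtain V a where V: "V \<in> F (n + length a)" "set a \<subseteq> A" "X = fibre G n V a"
    using assms by (auto simp: defined_over_def)
  obtain V' b where V': "V' \<in> F (n + length b)" "set b \<subseteq> A" "X' = fibre G n V' b"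
    using assms by (auto simp: defined_over_def)
  let ?N = "n + length (a @ b)"
  let ?i = "[0..<n + length a]" and ?j = "[0..<n] @ [n + length a..<?N]"
  have 1: "pull G ?N ?i V \<in> F ?N" by (rule pull_F) (use V in auto)
  have 2: "pull G ?N ?j V' \<in> F ?N" by (rule pull_F) (use V' in auto)
  have ab: "set a \<subseteq> carrier G" "set b \<subseteq> carrier G" using V V' A by auto
  have i: "map ((!) (x @ a @ b)) ?i = x @ a" if "length x = n" for x
    using map_nth_prefix[of "x @ a" b] that by simp
  have j: "map ((!) (x @ a @ b)) ?j = x @ b" if "length x = n" for x
    using map_nth_middle[of "x @ a" b "[]"] map_nth_prefix[of x "a @ b"] that by (simp add: add.assoc)
  show thesis
  proof (rule that[OF _ 1 2])
    show "set (a @ b) \<subseteq> A" using V V' by simp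
    show "X = fibre G n (pull G ?N ?i V) (a @ b)"
      unfolding V(3) fibre_def pull_def using ab i by (auto simp: tuples_def simp del: upt_Suc map_append)
    show "X' = fibre G n (pull G ?N ?j V') (a @ b)"
      unfolding V'(3) fibre_def pull_def using ab j by (auto simp: tuples_def simp del: upt_Suc map_append)
  qed
qed

lemma Def_Int: "X \<in> Def A n \<Longrightarrow> X' \<in> Def A n \<Longrightarrow> X \<inter> X' \<in> Def A n"
  and Def_Diff: "X \<in> Def A n \<Longrightarrow> X' \<in> Def A n \<Longrightarrow> X - X' \<in> Def A n"
proof -
  assume "X \<in> Def A n" "X' \<in> Def A n"
  then obtain c W W' where W: "set c \<subseteq> A" "W \<in> F (n + length c)" "W' \<in> F (n + length c)"
    "X = fibre G n W c" "X' = fibre G n W' c" by (rule Def_common)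
  have "X \<inter> X' = fibre G n (W \<inter> W') c" using W by (auto simp: fibre_def)
  then show "X \<inter> X' \<in> Def A n" using W inter unfolding defined_over_def by blast
  have "X - X' = fibre G n (W \<inter> (tuples G (n + length c) - W')) c"
    using W A by (auto simp: fibre_def tuples_def)
  then show "X - X' \<in> Def A n" using W inter complement unfolding defined_over_def by blast
qed

lemma content_Def: "content (tuples G n) (Def A n) (dens n)"
proof -
  interpret I: content "tuples G n" "{X. internal U Gs n X}" "dens n" by (rule content_internal)
  show ?thesis
    by unfold_locales (use Def_F F_tuples Def_subset Def_Int Def_Diff Def_internal dens_nonneg I.split in auto)
qed

lemma Def_fibre:
  assumes "Z \<in> Def A (k + m)" "set y \<subseteq> B" "length y = m"
  shows "fibre G k Z y \<in> Def (B \<union> A) k"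
proof -
  obtain W c where W: "W \<in> F (k + m + length c)" "set c \<subseteq> A" "Z = fibre G (k + m) W c"
    using assms by (auto simp: defined_over_def)
  show ?thesis
  proof (cases "set y \<subseteq> carrier G")
    case True
    then have "fibre G k Z y = fibre G k W (y @ c)"
      using W assms by (auto simp: fibre_def tuples_def)
    then show ?thesis using W assms unfolding defined_over_def
      by (intro CollectI exI[of _ W] exI[of _ "y @ c"]) (auto simp: add.assoc)
  next
    case False
    then have "fibre G k Z y = {}" using W by (auto simp: fibre_def tuples_def)
    then show ?thesis
      using content.empty[OF content_Def[of k]] Def_mono[of A "B \<union> A" k] by auto
  qed
qed

lemma Def_pull:
  assumes W: "X \<in> Def A (length js)" and js: "distinct js" "set js \<subseteq> {..<N}"
  shows "pull G N js X \<in> Def A N"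
proof -
  obtain W c where W: "W \<in> F (length js + length c)" "set c \<subseteq> A" "X = fibre G (length js) W c"
    using assms by (auto simp: defined_over_def)
  let ?N = "N + length c" and ?j = "js @ [N..<N + length c]"
  have "pull G ?N ?j W \<in> F ?N" by (rule pull_F) (use W js in auto)
  moreover have "pull G N js X = fibre G N (pull G ?N ?j W) c"
  proof -
    have "map ((!) (z @ c)) ?j = map ((!) z) js @ c" if "length z = N" for z
      using map_nth_middle[of z c "[]"] js(2) that by (auto simp: nth_append)
    moreover have "map ((!) z) js \<in> tuples G (length js)" if "z \<in> tuples G N" for z
      using js(2) that by (auto simp: tuples_def subset_iff)
    ultimately show ?thesis unfolding W(3) fibre_def pull_def
      using W(2) A by (auto simp: tuples_def simp del: upt_Suc map_append)
  qed
  ultimately show ?thesis using W unfolding defined_over_def by blast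
qed

text \<open>The tame axiom places a set between the conditions \<open>> r\<close> and
  \<open>\<ge> r\<close> for rational \<open>r\<close> in the unit interval. A rational strictly
  between \<open>q\<close> and \<open>q'\<close> absorbs the boundary; if the gap reaches beyond the
  interval, the full or the empty set serves.\<close>

lemma Def_measure:
  assumes Z: "Z \<in> Def A (k + m)" and q: "q < q'"
  obtains E where "E \<in> Def A m" "\<And>y. y \<in> E \<Longrightarrow> q \<le> dens k (fibre G k Z y)"
    "\<And>y. y \<in> tuples G m \<Longrightarrow> q' \<le> dens k (fibre G k Z y) \<Longrightarrow> y \<in> E"
proof -
  obtain W c where W: "W \<in> F (k + m + length c)" "set c \<subseteq> A" "Z = fibre G (k + m) W c"
    using Z by (auto simp: defined_over_def)
  have fib: "fibre G k Z y = fibre G k W (y @ c)" if "y \<in> tuples G m" for y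
    using that W by (auto simp: fibre_def tuples_def)
  have int: "internal U Gs k (fibre G k Z y)" if "y \<in> tuples G m" for y
    using internal_fibre[OF Def_internal[OF Z] that] .
  interpret content "tuples G m" "Def A m" "dens m" by (rule content_Def)
  consider "q < 0" | "1 < q'" | "0 \<le> q" "q' \<le> 1" by linarith
  then show thesis
  proof cases
    case 1
    have "q \<le> dens k (fibre G k Z y)" if "y \<in> tuples G m" for y
      using dens_nonneg[OF int[OF that]] 1 by linarith
    then show ?thesis by (intro that[of "tuples G m"] space) auto
  next
    case 2
    have "\<not> q' \<le> dens k (fibre G k Z y)" if "y \<in> tuples G m" for y
      using dens_le_1[OF int[OF that]] 2 by linarith
    then show ?thesis by (intro that[of "{}"] empty) auto
  next
    case 3
    obtain r where r: "r \<in> \<rat>" "q < r" "r < q'" using Rats_dense_in_real[OF q] by blast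
    obtain E where E: "E \<in> F (m + length c)"
      "{y \<in> tuples G (m + length c). density U Gs k (fibre G k W y) > r} \<subseteq> E"
      "E \<subseteq> {y \<in> tuples G (m + length c). density U Gs k (fibre G k W y) \<ge> r}"
      using measure[of W k "m + length c" r] W(1) r 3 by (auto simp: add.assoc)
    show ?thesis
    proof (rule that[of "fibre G m E c"])
      show "fibre G m E c \<in> Def A m" using E W unfolding defined_over_def by blast
      show "q \<le> dens k (fibre G k Z y)" if "y \<in> fibre G m E c" for y
        using that E(3) fib[of y] r by (auto simp: fibre_def)
      show "y \<in> fibre G m E c" if y: "y \<in> tuples G m" "q' \<le> dens k (fibre G k Z y)" for y
      proof -
        have "y @ c \<in> tuples G (m + length c)" using y W A by (auto simp: tuples_def)
        then have "y @ c \<in> E" using E(2) y fib[of y] r by auto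
        then show ?thesis using y by (simp add: fibre_def)
      qed
    qed
  qed
qed

end

section \<open>Generic tuples\<close>

text \<open>The working form of density over \<open>A\<close>: it tests single sets containing
  \<open>x\<close> instead of the whole type, so Fubini and saturation can be applied to one set at
  a time.\<close>

definition generic :: "'a ultra set \<Rightarrow> 'a ultra list \<Rightarrow> bool" where
  "generic A x \<longleftrightarrow> set x \<subseteq> carrier G \<and> (\<forall>Z\<in>Def A (length x). x \<in> Z \<longrightarrow> 0 < dens (length x) Z)"

lemma generic_if_dense_over:
  assumes A: "A \<subseteq> carrier G" and b: "set b \<subseteq> carrier G" and d: "dense_over U Gs F A b"
  shows "generic A b"
  unfolding generic_def
proof (intro conjI b ballI impI)
  fix Z assume Z: "Z \<in> Def A (length b)" "b \<in> Z"
  then have "tp G F A b \<subseteq> Z" by (auto simp: tp_def)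
  moreover have "Z \<in> Def (carrier G) (length b)" using Z Def_mono[OF A] by blast
  ultimately have "dens (length b) Z \<noteq> 0" using d by (auto simp: dense_over_def dense_set_def)
  then show "0 < dens (length b) Z" using dens_nonneg[OF Def_internal[OF A Z(1)]] by simp
qed

lemma generic_exists:
  assumes "C \<in> Def (carrier G) n" "0 < dens n C" "countable A" "A \<subseteq> carrier G"
  shows "\<exists>x\<in>C. generic A x"
proof -
  let ?Z = "{Z \<in> Def A n. dens n Z = 0}"
  have "\<exists>x\<in>C. x \<notin> \<Union>?Z"
    using assms Def_internal countable_Def[of A n]
    by (intro saturation) (auto intro: countable_subset[of _ "Def A n"])
  then obtain x where x: "x \<in> C" "x \<notin> \<Union>?Z" by blast
  then have t: "x \<in> tuples G n" using assms Def_subset by blast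
  have "0 < dens n Z" if "Z \<in> Def A n" "x \<in> Z" for Z
    using x that dens_nonneg[OF Def_internal[OF assms(4) that(1)]] by fastforce
  then show ?thesis using x t by (auto simp: generic_def tuples_def)
qed

text \<open>For \<open>Z\<close> over \<open>A\<close> containing \<open>x @ y\<close> the fibre at
  \<open>y\<close> has positive density \<open>c\<close>, because \<open>x\<close> is generic over
  \<open>y\<close>. Fibres of density at least \<open>c / 2\<close> occur throughout a set
  \<open>E\<close> over \<open>A\<close> containing \<open>y\<close>, which is positive because
  \<open>y\<close> is generic. Fubini combines the two; the gap and Fubini each cost a factor
  2.\<close>

lemma generic_append:
  assumes A: "A \<subseteq> carrier G" and x: "generic (set y \<union> A) x" and y: "generic A y"
  shows "generic A (x @ y)"
  unfolding generic_def
proof (intro conjI ballI impI)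
  show "set (x @ y) \<subseteq> carrier G" using x y by (auto simp: generic_def)
next
  let ?k = "length x" and ?m = "length y"
  fix Z assume Z: "Z \<in> Def A (length (x @ y))" "x @ y \<in> Z"
  then have Z': "Z \<in> Def A (?k + ?m)" by simp
  have xy: "x \<in> tuples G ?k" "y \<in> tuples G ?m" using x y by (auto simp: generic_def tuples_def)
  define c where "c = dens ?k (fibre G ?k Z y)"
  have "fibre G ?k Z y \<in> Def (set y \<union> A) ?k" by (rule Def_fibre[OF A Z']) auto
  moreover have "x \<in> fibre G ?k Z y" using xy Z by (simp add: fibre_def)
  ultimately have c: "0 < c" using x by (simp add: generic_def c_def)
  obtain E where E: "E \<in> Def A ?m" "\<And>v. v \<in> E \<Longrightarrow> c / 2 \<le> dens ?k (fibre G ?k Z v)"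
    "\<And>v. v \<in> tuples G ?m \<Longrightarrow> c \<le> dens ?k (fibre G ?k Z v) \<Longrightarrow> v \<in> E"
    using Def_measure[OF A Z', of "c / 2" c] c by auto
  have "y \<in> E" using E(3) xy by (simp add: c_def)
  then have "0 < dens ?m E" using y E(1) by (simp add: generic_def)
  moreover have "c / 2 / 2 * dens ?m E \<le> dens (?k + ?m) Z"
    by (rule dens_Fubini) (use Def_internal[OF A] Z' E c in auto)
  moreover have "0 < c / 2 / 2 * dens ?m E" using c calculation(1) by simp
  ultimately show "0 < dens (length (x @ y)) Z" by simp
qed

text \<open>A null set containing \<open>y\<close> would pull back to a null set containing
  \<open>x\<close>. This makes joint genericity independent of the order of choice and inherited by
  subtuples.\<close>

lemma generic_mset:
  assumes A: "A \<subseteq> carrier G" and x: "generic A x" and y: "mset y \<subseteq># mset x"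
  shows "generic A y"
  unfolding generic_def
proof (intro conjI ballI impI)
  show "set y \<subseteq> carrier G" using x set_mset_mono[OF y] by (auto simp: generic_def)
next
  fix Z assume Z: "Z \<in> Def A (length y)" "y \<in> Z"
  obtain js where js: "distinct js" "set js \<subseteq> {..<length x}" "map ((!) x) js = y"
    using select_exists[OF y] by blast
  have len: "length js = length y" using js(3) by auto
  have "pull G (length x) js Z \<in> Def A (length x)" by (rule Def_pull[OF A]) (use Z js len in auto)
  moreover have "x \<in> pull G (length x) js Z" using x js Z by (simp add: pull_def tuples_def generic_def)
  ultimately have "0 < dens (length x) (pull G (length x) js Z)" using x by (simp add: generic_def)
  also have "\<dots> \<le> dens (length js) Z"
    by (rule dens_pull_le) (use Def_internal[OF A] Z len js in auto)
  finally show "0 < dens (length y) Z" by (simp add: len)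
qed

lemma generic_Nil: "A \<subseteq> carrier G \<Longrightarrow> generic A []"
proof -
  assume A: "A \<subseteq> carrier G"
  have "0 < dens 0 Z" if Z: "Z \<in> Def A 0" "[] \<in> Z" for Z
  proof -
    have "Z = tuples G 0" using Def_subset[OF Z(1)] Z(2) by (auto simp: tuples_def)
    then show ?thesis by (simp add: dens_tuples)
  qed
  then show ?thesis by (simp add: generic_def)
qed

end

section \<open>Half-graphs and richness\<close>

lemma mset_subset_if_distinct: "distinct xs \<Longrightarrow> set xs \<subseteq> set ys \<Longrightarrow> mset xs \<subseteq># mset ys"
  by (auto simp: subseteq_mset_def distinct_count_atmost_1 count_greater_eq_one_iff Suc_le_eq)

lemma mset_concat_mono:
  assumes "mset xss \<subseteq># mset yss"
  shows "mset (concat xss) \<subseteq># mset (concat yss)"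
proof -
  obtain K where "mset yss = mset xss + K" using assms by (auto simp: subset_mset.le_iff_add)
  then have "\<Sum>\<^sub># (image_mset mset (mset yss)) = \<Sum>\<^sub># (image_mset mset (mset xss)) + \<Sum>\<^sub># (image_mset mset K)"
    by simp
  then show ?thesis by (simp add: mset_concat sum_mset_sum_list[symmetric])
qed

lemma mset_concat_map2:
  "length xs = length ys \<Longrightarrow> mset (concat (map2 (@) xs ys)) = mset (concat xs @ concat ys)"
  by (induction xs ys rule: list_induct2) auto

lemma concat_blocks: "concat (map (\<lambda>i. map f [c * i..<c * i + c]) [0..<k]) = map f [0..<c * k]"
proof (induction k)
  case (Suc k)
  have "[0..<c * Suc k] = [0..<c * k] @ [c * k..<c * k + c]"
    using upt_add_eq_append[of 0 "c * k" c] by (simp add: add.commute)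
  then show ?case using Suc by (simp del: upt_Suc add: upt_Suc_append)
qed simp

lemma length_concat_map2:
  assumes "length xs = k" "length ys = k" "\<forall>x\<in>set xs. length x = n" "\<forall>y\<in>set ys. length y = m"
  shows "length (concat (map2 (@) xs ys)) = (n + m) * k"
  using assms by (induction k arbitrary: xs ys) (auto simp: length_Suc_conv)

lemma select_blocks:
  fixes z :: "'a list"
  assumes "length z = (n + m) * k"
  defines "A \<equiv> \<lambda>i. map ((!) z) [(n + m) * i..<(n + m) * i + n]"
    and "B \<equiv> \<lambda>i. map ((!) z) [(n + m) * i + n..<(n + m) * i + n + m]"
  shows "concat (map2 (@) (map A [0..<k]) (map B [0..<k])) = z"
proof -
  have "A i @ B i = map ((!) z) [(n + m) * i..<(n + m) * i + (n + m)]" for i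
    using upt_add_eq_append[of "(n + m) * i" "(n + m) * i + n" m] by (simp add: A_def B_def add.assoc flip: map_append)
  then have "concat (map2 (@) (map A [0..<k]) (map B [0..<k])) = map ((!) z) [0..<(n + m) * k]"
    by (simp add: map2_map_map concat_blocks)
  then show ?thesis using assms(1) map_nth[of z] by simp
qed

section \<open>Parameters from a rich set\<close>

locale rich_model = tame_group U Gs F
  for U and Gs :: "nat \<Rightarrow> 'a monoid" and F +
  fixes M
  assumes countable_M: "countable M" and rich_M: "rich G F M"
begin

lemma M_carrier: "M \<subseteq> carrier G"
  using rich_M by (simp add: rich_def)

lemma rich_elem: "X \<in> Def M n \<Longrightarrow> x \<in> X \<Longrightarrow> \<exists>y\<in>X. set y \<subseteq> M"
  using rich_M unfolding rich_def by blast

lemma Def_M_carrier: "X \<in> Def M n \<Longrightarrow> X \<in> Def (carrier G) n"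
  using Def_mono[OF M_carrier] by blast

definition transposed :: "nat \<Rightarrow> nat \<Rightarrow> 'a ultra list set \<Rightarrow> 'a ultra list set" where
  "transposed n m S = pull G (m + n) ([m..<m + n] @ [0..<m]) S"

lemma transposed_Def: "S \<in> Def M (n + m) \<Longrightarrow> transposed n m S \<in> Def M (m + n)"
  unfolding transposed_def by (rule Def_pull[OF M_carrier]) auto

lemma transposed_iff:
  "x \<in> tuples G n \<Longrightarrow> y \<in> tuples G m \<Longrightarrow> y @ x \<in> transposed n m S \<longleftrightarrow> x @ y \<in> S"
  using map_nth_middle[of y x "[]"] map_nth_prefix[of y x] by (auto simp: transposed_def pull_def tuples_def)

lemma fibre_transposed:
  "x \<in> tuples G n \<Longrightarrow> fibre G m (transposed n m S) x = {y \<in> tuples G m. x @ y \<in> S}"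
  by (auto simp: fibre_def transposed_iff)

text \<open>Closeness of two sections is a condition over \<open>M\<close> on the pair of parameters, so by richness a
  parameter with a positive set of close parameters may be replaced by one in \<open>M\<close>.\<close>

lemma rich_close_section:
  assumes S: "S \<in> Def M (n + m)" and B: "B \<in> Def M m"
    and D: "D \<in> Def (carrier G) m" "D \<subseteq> B" "0 < dens m D" and b: "b \<in> tuples G m" and \<eta>: "0 < \<eta>"
    and close: "\<And>y. y \<in> D \<Longrightarrow>
      dens n (fibre G n S y - fibre G n S b) + dens n (fibre G n S b - fibre G n S y) \<le> \<eta>"
  shows "\<exists>V\<in>Def M m. V \<subseteq> B \<and> 0 < dens m V \<and> (\<exists>P\<in>Def M n. \<forall>y\<in>V.
    dens n (fibre G n S y - P) + dens n (P - fibre G n S y) \<le> 2 * \<eta>)"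
proof -
  interpret I: content "tuples G n" "{X. internal U Gs n X}" "dens n" by (rule content_internal)
  interpret I2: content "tuples G m" "{X. internal U Gs m X}" "dens m" by (rule content_internal)
  let ?N = "n + (m + m)"
  define S\<^sub>1 where "S\<^sub>1 = pull G ?N [0..<n + m] S"
  define S\<^sub>2 where "S\<^sub>2 = pull G ?N ([0..<n] @ [n + m..<n + m + m]) S"
  define \<Delta> where "\<Delta> = (S\<^sub>1 - S\<^sub>2) \<union> (S\<^sub>2 - S\<^sub>1)"
  have S12: "S\<^sub>1 \<in> Def M ?N" "S\<^sub>2 \<in> Def M ?N"
    unfolding S\<^sub>1_def S\<^sub>2_def by (rule Def_pull[OF M_carrier]; use S in auto)+
  have \<Delta>: "\<Delta> \<in> Def M (n + (m + m))"
    unfolding \<Delta>_def by (intro content.Un[OF content_Def] Def_Diff S12 M_carrier)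
  have fib: "fibre G n \<Delta> (y @ y') = (fibre G n S y - fibre G n S y') \<union> (fibre G n S y' - fibre G n S y)"
    if y: "y \<in> tuples G m" "y' \<in> tuples G m" for y y'
  proof -
    have 1: "map ((!) (x @ y @ y')) [0..<n + m] = x @ y" if "length x = n" for x
      using map_nth_prefix[of "x @ y" y'] y that by (simp add: tuples_def)
    have 2: "map ((!) (x @ y @ y')) ([0..<n] @ [n + m..<n + m + m]) = x @ y'" if "length x = n" for x
      using map_nth_prefix[of x "y @ y'"] map_nth_middle[of "x @ y" y' "[]"] y that by (simp add: tuples_def)
    show ?thesis
      using y 1 2 unfolding \<Delta>_def S\<^sub>1_def S\<^sub>2_def fibre_def pull_def
      by (auto simp: tuples_def simp del: map_append upt_Suc)
  qed
  have int: "internal U Gs n (fibre G n S y)" if "y \<in> tuples G m" for y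
    using internal_fibre[OF Def_internal[OF M_carrier S] that] .
  have dist: "dens n (fibre G n \<Delta> (y @ y')) =
      dens n (fibre G n S y - fibre G n S y') + dens n (fibre G n S y' - fibre G n S y)"
    if y: "y \<in> tuples G m" "y' \<in> tuples G m" for y y'
  proof -
    let ?f = "fibre G n S y" and ?g = "fibre G n S y'"
    have "((?f - ?g) \<union> (?g - ?f)) \<inter> (?f - ?g) = ?f - ?g"
      "((?f - ?g) \<union> (?g - ?f)) - (?f - ?g) = ?g - ?f" by auto
    moreover have "?f - ?g \<in> {X. internal U Gs n X}" "(?f - ?g) \<union> (?g - ?f) \<in> {X. internal U Gs n X}"
      using int y by (auto intro!: I.Diff[simplified] I.Un[simplified])
    ultimately show ?thesis unfolding fib[OF y] using I.split by metis
  qed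
  \<comment> \<open>Both cut-offs exceed \<open>\<eta>\<close>, so \<open>y @ b\<close> avoids
    \<open>E\<close> for \<open>y\<close> in \<open>D\<close>; the upper one is the distance
    claimed.\<close>
  obtain E where E: "E \<in> Def M (m + m)" "\<And>y. y \<in> E \<Longrightarrow> 3 / 2 * \<eta> \<le> dens n (fibre G n \<Delta> y)"
    "\<And>y. y \<in> tuples G (m + m) \<Longrightarrow> 2 * \<eta> \<le> dens n (fibre G n \<Delta> y) \<Longrightarrow> y \<in> E"
    using Def_measure[OF M_carrier \<Delta>, of "3 / 2 * \<eta>" "2 * \<eta>"] \<eta> by auto
  define V where "V = pull G (m + m) [0..<m] B - E"
  have "pull G (m + m) [0..<m] B \<in> Def M (m + m)"
    by (rule Def_pull[OF M_carrier]) (use B in auto)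
  then have V: "V \<in> Def M (m + m)" unfolding V_def using E(1) by (rule Def_Diff[OF M_carrier])
  have Bt: "B \<subseteq> tuples G m" using B Def_subset by blast
  have pre: "map ((!) (y @ y')) [0..<m] = y" if "y \<in> tuples G m" for y y'
    using map_nth_prefix[of y y'] that by (simp add: tuples_def)
  have fV: "fibre G m V y' = {y \<in> B. y @ y' \<notin> E}" if "y' \<in> tuples G m" for y'
    using that Bt pre by (auto simp: V_def fibre_def pull_def tuples_def)
  have intV: "internal U Gs m (fibre G m V y')" if "y' \<in> tuples G m" for y'
    using internal_fibre[OF Def_internal[OF M_carrier V] that] .
  have "D \<subseteq> fibre G m V b"
  proof
    fix y assume y: "y \<in> D"
    then have t: "y \<in> tuples G m" using D Bt by blast
    have "y @ b \<notin> E" using E(2)[of "y @ b"] close[OF y] dist[OF t b] \<eta> by force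
    then show "y \<in> fibre G m V b" using y D fV[OF b] by blast
  qed
  then have "dens m D \<le> dens m (fibre G m V b)"
    using I2.mono[of D "fibre G m V b"] Def_internal[OF _ D(1)] intV[OF b] by simp
  \<comment> \<open>\<open>E'\<close> is over \<open>M\<close> and contains \<open>b\<close>, so it
    contains some tuple \<open>c\<close> of \<open>M\<close>. What is transferred from
    \<open>b\<close> to \<open>c\<close> is the size of the fibre of \<open>V\<close>, as
    \<open>D\<close> itself may have foreign parameters.\<close>
  moreover obtain E' where E': "E' \<in> Def M m" "\<And>y. y \<in> E' \<Longrightarrow> dens m D / 2 \<le> dens m (fibre G m V y)"
    "\<And>y. y \<in> tuples G m \<Longrightarrow> dens m D \<le> dens m (fibre G m V y) \<Longrightarrow> y \<in> E'"
    using Def_measure[OF M_carrier V, of "dens m D / 2" "dens m D"] D(3) by auto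
  ultimately have "b \<in> E'" using b by blast
  then obtain c where c: "c \<in> E'" "set c \<subseteq> M" using rich_elem[OF E'(1)] by blast
  have ct: "c \<in> tuples G m" using c E' Def_subset by blast
  then have len: "length c = m" by (simp add: tuples_def)
  have "dens n (fibre G n S y - fibre G n S c) + dens n (fibre G n S c - fibre G n S y) \<le> 2 * \<eta>"
    if "y \<in> fibre G m V c" for y
  proof -
    have y: "y \<in> tuples G m" "y @ c \<notin> E" using that fV[OF ct] Bt by auto
    then have "\<not> 2 * \<eta> \<le> dens n (fibre G n \<Delta> (y @ c))"
      using E(3)[of "y @ c"] ct by (auto simp: tuples_def)
    then show ?thesis using dist[OF y(1) ct] by simp
  qed
  moreover have "fibre G m V c \<in> Def M m" "fibre G n S c \<in> Def M n"
    using Def_fibre[OF M_carrier V c(2) len] Def_fibre[OF M_carrier S c(2) len] by simp_all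
  moreover have "fibre G m V c \<subseteq> B" using fV[OF ct] by blast
  moreover have "0 < dens m (fibre G m V c)" using E'(2)[OF c(1)] D(3) by simp
  ultimately show ?thesis by blast
qed

section \<open>Generic configurations and half-graphs\<close>

definition Gen :: "nat \<Rightarrow> nat \<Rightarrow> 'a ultra list list \<Rightarrow> 'a ultra list list \<Rightarrow> bool" where
  "Gen n m as bs \<longleftrightarrow> set as \<subseteq> tuples G n \<and> set bs \<subseteq> tuples G m \<and> generic M (concat as @ concat bs)"

lemma Gen_Nil: "Gen n m [] []"
  using generic_Nil[OF M_carrier] by (simp add: Gen_def)

lemma Gen_extend:
  assumes "generic M z" "P \<in> Def (carrier G) n" "0 < dens n P"
  shows "\<exists>a\<in>P. a \<in> tuples G n \<and> generic M (a @ z)"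
proof -
  have z: "set z \<subseteq> carrier G" using assms by (simp add: generic_def)
  obtain a where "a \<in> P" "generic (set z \<union> M) a"
    using generic_exists[OF assms(2,3), of "set z \<union> M"] z countable_M M_carrier
    by (auto intro: countable_finite)
  then show ?thesis using generic_append[OF M_carrier _ assms(1)] Def_subset[OF assms(2)] by blast
qed

lemma Gen_X:
  "Gen n m as bs \<Longrightarrow> P \<in> Def (carrier G) n \<Longrightarrow> 0 < dens n P \<Longrightarrow> \<exists>a\<in>P. Gen n m (a # as) bs"
  using Gen_extend[of "concat as @ concat bs" P n] by (auto simp: Gen_def)

lemma Gen_Y:
  assumes "Gen n m as bs" "Q \<in> Def (carrier G) m" "0 < dens m Q"
  shows "\<exists>b\<in>Q. Gen n m as (b # bs)"
proof -
  obtain b where b: "b \<in> Q" "b \<in> tuples G m" "generic M (b @ concat as @ concat bs)"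
    using Gen_extend[of "concat as @ concat bs" Q m] assms by (auto simp: Gen_def)
  have "generic M (concat as @ concat (b # bs))"
    by (rule generic_mset[OF M_carrier b(3)]) simp
  then show ?thesis using b assms by (auto simp: Gen_def)
qed

text \<open>Genericity speaks of sets over \<open>M\<close> only, so the half-graphs must be
  recognised as one. \<open>ia i\<close> and \<open>ib j\<close> are the positions of the
  \<open>i\<close>-th left and the \<open>j\<close>-th right element within the interleaved
  tuple.\<close>

lemma half_graphs_Def:
  assumes X: "X \<in> Def M n" and Y: "Y \<in> Def M m" and S: "S \<in> Def M (n + m)"
  shows "half_graphs k X Y S \<in> Def M ((n + m) * k)"
proof -
  let ?N = "(n + m) * k"
  let ?T = "tuples G ?N"
  define ia where "ia i = [(n + m) * i..<(n + m) * i + n]" for i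
  define ib where "ib i = [(n + m) * i + n..<(n + m) * i + n + m]" for i
  interpret C: content ?T "Def M ?N" "dens ?N" by (rule content_Def[OF M_carrier])
  have bound: "(n + m) * i + n + m \<le> ?N" if "i < k" for i
    using mult_le_mono2[of "Suc i" k "n + m"] that by (simp add: algebra_simps)
  have disj: "set (ia i) \<inter> set (ib j) = {}" for i j
  proof -
    consider "i = j" | "Suc i \<le> j" | "Suc j \<le> i" by linarith
    then show ?thesis
    proof cases
      case 2
      then show ?thesis using mult_le_mono2[of "Suc i" j "n + m"] by (auto simp: ia_def ib_def algebra_simps)
    next
      case 3
      then show ?thesis using mult_le_mono2[of "Suc j" i "n + m"] by (auto simp: ia_def ib_def algebra_simps)
    qed (auto simp: ia_def ib_def)
  qed
  have sub: "set (ia i) \<subseteq> {..<?N}" "set (ib i) \<subseteq> {..<?N}" if "i < k" for i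
    using bound[OF that] by (auto simp: ia_def ib_def)
  have PX: "pull G ?N (ia i) X \<in> Def M ?N" if "i < k" for i
    by (rule Def_pull[OF M_carrier]) (use X sub[OF that] in \<open>auto simp: ia_def\<close>)
  have PY: "pull G ?N (ib i) Y \<in> Def M ?N" if "i < k" for i
    by (rule Def_pull[OF M_carrier]) (use Y sub[OF that] in \<open>auto simp: ib_def\<close>)
  have PS: "pull G ?N (ia i @ ib j) S \<in> Def M ?N" if "i < k" "j < k" for i j
  proof (rule Def_pull[OF M_carrier])
    show "S \<in> Def M (length (ia i @ ib j))" using S by (simp add: ia_def ib_def)
    show "distinct (ia i @ ib j)" using disj by (simp add: ia_def ib_def)
    show "set (ia i @ ib j) \<subseteq> {..<?N}" using sub that by simp
  qed
  define Q where "Q i j = (if i \<le> j then pull G ?N (ia i @ ib j) S else ?T - pull G ?N (ia i @ ib j) S)" for i j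
  define W where "W i = pull G ?N (ia i) X \<inter> pull G ?N (ib i) Y \<inter> {z \<in> ?T. \<forall>j\<in>{..<k}. z \<in> Q i j}" for i
  have "Q i j \<in> Def M ?N" if "i < k" "j < k" for i j
    using PS[OF that] C.Diff C.space by (auto simp: Q_def)
  then have "W i \<in> Def M ?N" if "i < k" for i
    unfolding W_def using that PX PY by (intro C.Int C.Ball) auto
  then have "{z \<in> ?T. \<forall>i\<in>{..<k}. z \<in> W i} \<in> Def M ?N"
    by (intro C.Ball) auto
  moreover have "half_graphs k X Y S = {z \<in> ?T. \<forall>i\<in>{..<k}. z \<in> W i}"
  proof (intro equalityI subsetI)
    fix z assume "z \<in> half_graphs k X Y S"
    then obtain as bs where z: "z = concat (map2 (@) as bs)" and len: "length as = k" "length bs = k"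
      and ab: "set as \<subseteq> X" "set bs \<subseteq> Y" and R: "\<And>i j. i < k \<Longrightarrow> j < k \<Longrightarrow> as ! i @ bs ! j \<in> S \<longleftrightarrow> i \<le> j"
      by (auto simp: half_graphs_def)
    have t: "set as \<subseteq> tuples G n" "set bs \<subseteq> tuples G m" using ab X Y Def_subset by blast+
    then have l: "\<forall>x\<in>set as. length x = n" "\<forall>y\<in>set bs. length y = m" by (auto simp: tuples_def)
    have lz: "length z = ?N" unfolding z by (rule length_concat_map2[OF len l])
    have "set z \<subseteq> carrier G"
      using t unfolding z by (fastforce simp: tuples_def dest: set_zip_leftD set_zip_rightD)
    then have zT: "z \<in> ?T" using lz by (simp add: tuples_def)
    have eq: "concat (map2 (@) (map (\<lambda>i. map ((!) z) (ia i)) [0..<k]) (map (\<lambda>i. map ((!) z) (ib i)) [0..<k]))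
      = concat (map2 (@) as bs)"
      using select_blocks[OF lz] unfolding ia_def ib_def z by simp
    have nth: "as ! i \<in> set as" "bs ! i \<in> set bs" if "i < k" for i using len that by auto
    have eq': "map2 (@) (map (\<lambda>i. map ((!) z) (ia i)) [0..<k]) (map (\<lambda>i. map ((!) z) (ib i)) [0..<k]) = map2 (@) as bs"
    proof (rule concat_eq_concat_iff[THEN iffD1, OF _ _ eq])
      show "\<forall>(x, y)\<in>set (zip (map2 (@) (map (\<lambda>i. map ((!) z) (ia i)) [0..<k]) (map (\<lambda>i. map ((!) z) (ib i)) [0..<k]))
          (map2 (@) as bs)). length x = length y"
        using len l nth by (auto simp: set_zip ia_def ib_def)
    qed (use len in simp)
    have sel: "map ((!) z) (ia i) = as ! i \<and> map ((!) z) (ib i) = bs ! i" if i: "i < k" for i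
    proof -
      have "map ((!) z) (ia i) @ map ((!) z) (ib i) = as ! i @ bs ! i"
        using arg_cong[OF eq', of "\<lambda>xs. xs ! i"] len i by simp
      moreover have "length (map ((!) z) (ia i)) = length (as ! i)"
        using l nth[OF i] by (simp add: ia_def)
      ultimately show ?thesis by (simp only: append_eq_append_conv simp_thms)
    qed
    have "z \<in> W i" if i: "i < k" for i
    proof -
      have "z \<in> Q i j" if "j < k" for j
        using R[OF i that] sel[OF i] sel[OF that] zT by (auto simp: Q_def pull_def)
      then show ?thesis using sel[OF i] zT nth[OF i] ab by (auto simp: W_def pull_def)
    qed
    then show "z \<in> {z \<in> ?T. \<forall>i\<in>{..<k}. z \<in> W i}" using zT by simp
  next
    fix z assume z: "z \<in> {z \<in> ?T. \<forall>i\<in>{..<k}. z \<in> W i}"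
    then have lz: "length z = ?N" by (simp add: tuples_def)
    define as bs where "as = map (\<lambda>i. map ((!) z) (ia i)) [0..<k]" and "bs = map (\<lambda>i. map ((!) z) (ib i)) [0..<k]"
    have "z = concat (map2 (@) as bs)" using select_blocks[OF lz] by (simp add: as_def bs_def ia_def ib_def)
    moreover have "length as = k" "length bs = k" by (simp_all add: as_def bs_def)
    moreover have "set as \<subseteq> X" "set bs \<subseteq> Y" using z by (auto simp: as_def bs_def W_def pull_def)
    moreover have "as ! i @ bs ! j \<in> S \<longleftrightarrow> i \<le> j" if "i < k" "j < k" for i j
    proof -
      have "z \<in> Q i j" using z that by (auto simp: W_def)
      then show ?thesis using that by (auto simp: as_def bs_def Q_def pull_def split: if_splits)
    qed
    ultimately show "z \<in> half_graphs k X Y S" unfolding half_graphs_def by blast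
  qed
  ultimately show ?thesis by simp
qed

text \<open>Elements on the same side of a half-graph are distinct, since they relate differently to
  the other side. Hence set inclusion becomes multiset inclusion: up to order the half-graph is a
  subtuple of the generic tuple, so it is generic and cannot lie in a null set over
  \<open>M\<close>.\<close>

lemma Gen_no_half_graph:
  assumes X: "X \<in> Def M n" and Y: "Y \<in> Def M m" and S: "S \<in> Def M (n + m)" "S \<subseteq> pairs X Y"
    and stable: "almost_surely_stable U Gs k n m X Y S"
    and gen: "Gen n m as bs" "set as' \<subseteq> set as" "set bs' \<subseteq> set bs" "length as' = k" "length bs' = k"
  shows "\<not> (\<forall>i<k. \<forall>j<k. as' ! i @ bs' ! j \<in> S \<longleftrightarrow> i \<le> j)"
proof
  assume hg: "\<forall>i<k. \<forall>j<k. as' ! i @ bs' ! j \<in> S \<longleftrightarrow> i \<le> j"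
  have t: "set as' \<subseteq> tuples G n" "set bs' \<subseteq> tuples G m" using gen by (auto simp: Gen_def)
  have XY: "as' ! i \<in> X \<and> bs' ! i \<in> Y" if i: "i < k" for i
  proof -
    have "as' ! i @ bs' ! i \<in> pairs X Y" using hg i S(2) by blast
    then obtain x y where xy: "as' ! i @ bs' ! i = x @ y" "x \<in> X" "y \<in> Y" by (auto simp: pairs_def)
    have "as' ! i \<in> tuples G n" using t gen(4) i by (meson nth_mem subsetD)
    moreover have "x \<in> tuples G n" using xy(2) X Def_subset by blast
    ultimately show ?thesis using xy by (simp add: tuples_def)
  qed
  have "distinct as'"
    unfolding distinct_conv_nth gen(4)
  proof (intro allI impI)
    fix i j assume "i < k" "j < k" "i \<noteq> j"
    then show "as' ! i \<noteq> as' ! j"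
      using hg by (metis linorder_le_cases linorder_not_le nless_le order_refl)
  qed
  moreover have "distinct bs'"
    unfolding distinct_conv_nth gen(5)
  proof (intro allI impI)
    fix i j assume "i < k" "j < k" "i \<noteq> j"
    then show "bs' ! i \<noteq> bs' ! j"
      using hg by (metis linorder_le_cases linorder_not_le nless_le order_refl)
  qed
  ultimately have "mset (concat as') \<subseteq># mset (concat as)" "mset (concat bs') \<subseteq># mset (concat bs)"
    using gen by (auto intro: mset_concat_mono mset_subset_if_distinct)
  then have "mset (concat (map2 (@) as' bs')) \<subseteq># mset (concat as @ concat bs)"
    using gen mset_concat_map2[of as' bs'] by (simp add: subset_mset.add_mono)
  then have "generic M (concat (map2 (@) as' bs'))"
    using generic_mset[OF M_carrier] gen(1) by (auto simp: Gen_def)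
  moreover have "concat (map2 (@) as' bs') \<in> half_graphs k X Y S"
  proof -
    have "set as' \<subseteq> X" "set bs' \<subseteq> Y" using XY gen(4,5) by (auto simp: in_set_conv_nth)
    then show ?thesis using gen(4,5) hg unfolding half_graphs_def by blast
  qed
  moreover have "length (concat (map2 (@) as' bs')) = (n + m) * k"
    by (rule length_concat_map2) (use gen t in \<open>auto simp: tuples_def\<close>)
  ultimately have "0 < dens ((n + m) * k) (half_graphs k X Y S)"
    using half_graphs_Def[OF X Y S(1)] by (auto simp: generic_def)
  then show False using stable by (simp add: almost_surely_stable_def)
qed

section \<open>Definable sets as a measured relation\<close>

text \<open>\<open>H\<close> and \<open>R\<close> stay abstract so that the result serves both the
  relation and the one with its two sides exchanged.\<close>

lemma measured_relation_Def:
  assumes S: "S \<in> Def M (n + m)"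
    and R: "\<And>x y. x \<in> tuples G n \<Longrightarrow> y \<in> tuples G m \<Longrightarrow> R x y \<longleftrightarrow> x @ y \<in> S"
    and Gen: "H [] []"
      "\<And>as bs P. H as bs \<Longrightarrow> P \<in> Def (carrier G) n \<Longrightarrow> 0 < dens n P \<Longrightarrow> \<exists>a\<in>P. H (a # as) bs"
      "\<And>as bs Q. H as bs \<Longrightarrow> Q \<in> Def (carrier G) m \<Longrightarrow> 0 < dens m Q \<Longrightarrow> \<exists>b\<in>Q. H as (b # bs)"
      "\<And>as bs as' bs'. H as bs \<Longrightarrow> set as' \<subseteq> set as \<Longrightarrow> set bs' \<subseteq> set bs \<Longrightarrow>
        length as' = k \<Longrightarrow> length bs' = k \<Longrightarrow> \<not> (\<forall>i<k. \<forall>j<k. R (as' ! i) (bs' ! j) \<longleftrightarrow> i \<le> j)"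
  shows "measured_relation (tuples G n) (Def (carrier G) n) (dens n) (Def M n)
    (tuples G m) (Def (carrier G) m) (dens m) (Def M m) R (\<lambda>b. {x \<in> tuples G n. R x b}) H k"
proof -
  have sect: "{x \<in> tuples G n. R x b} = fibre G n S b" if "b \<in> tuples G m" for b
    using R that by (auto simp: fibre_def)
  have cosect: "{y \<in> tuples G m. R a y} = fibre G m (transposed n m S) a" if "a \<in> tuples G n" for a
    using R that by (auto simp: fibre_transposed)
  have def: "\<exists>E\<in>Def A m. (\<forall>b\<in>E. q \<le> dens n (P \<inter> {x \<in> tuples G n. R x b})) \<and>
      (\<forall>b\<in>tuples G m. q' \<le> dens n (P \<inter> {x \<in> tuples G n. R x b}) \<longrightarrow> b \<in> E)"
    if A: "M \<subseteq> A" "A \<subseteq> carrier G" and P: "P \<in> Def A n" and q: "q < q'" for A P q q'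
  proof -
    define Z where "Z = pull G (n + m) [0..<n] P \<inter> S"
    have "pull G (n + m) [0..<n] P \<in> Def A (n + m)" by (rule Def_pull[OF A(2)]) (use P in auto)
    then have Z: "Z \<in> Def A (n + m)"
      unfolding Z_def using S Def_mono[OF A(1)] Def_Int[OF A(2)] by blast
    have fib: "fibre G n Z b = P \<inter> {x \<in> tuples G n. R x b}" if b: "b \<in> tuples G m" for b
    proof -
      have "map ((!) (x @ b)) [0..<n] = x" if "x \<in> tuples G n" for x
        using map_nth_prefix[of x b] that by (simp add: tuples_def)
      moreover have "x @ b \<in> tuples G (n + m)" if "x \<in> tuples G n" for x
        using that b by (auto simp: tuples_def)
      ultimately show ?thesis using Def_subset[OF P] unfolding sect[OF b]
        by (auto simp: Z_def fibre_def pull_def)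
    qed
    obtain E where "E \<in> Def A m" "\<And>y. y \<in> E \<Longrightarrow> q \<le> dens n (fibre G n Z y)"
      "\<And>y. y \<in> tuples G m \<Longrightarrow> q' \<le> dens n (fibre G n Z y) \<Longrightarrow> y \<in> E"
      using Def_measure[OF A(2) Z q] by blast
    then show ?thesis using Def_subset[of E A m] by (intro bexI[of _ E]) (auto simp: fib subset_iff)
  qed
  show ?thesis
  proof (intro measured_relation.intro content_Def measured_relation_axioms.intro subset_refl M_carrier)
    show "Def M n \<subseteq> Def (carrier G) n" "Def M m \<subseteq> Def (carrier G) m" using Def_M_carrier by blast+
    show "{x \<in> tuples G n. R x b} \<in> Def (carrier G) n" if "b \<in> tuples G m" for b
      unfolding sect[OF that] using Def_fibre[OF _ Def_M_carrier[OF S], of b "carrier G"] that by (simp add: tuples_def)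
    show "{y \<in> tuples G m. R a y} \<in> Def (carrier G) m" if "a \<in> tuples G n" for a
      unfolding cosect[OF that] using Def_fibre[OF _ Def_M_carrier[OF transposed_Def[OF S]], of a "carrier G"] that
      by (simp add: tuples_def)
    show "\<exists>V\<in>Def M m. V \<subseteq> B \<and> 0 < dens m V \<and> (\<exists>P\<in>Def M n. \<forall>y\<in>V.
        dens n ({x \<in> tuples G n. R x y} - P) + dens n (P - {x \<in> tuples G n. R x y}) \<le> 2 * \<eta>)"
      if h: "B \<in> Def M m" "D \<in> Def (carrier G) m" "D \<subseteq> B" "0 < dens m D" "b \<in> tuples G m" "0 < \<eta>"
        and close: "\<And>y. y \<in> D \<Longrightarrow> dens n ({x \<in> tuples G n. R x y} - {x \<in> tuples G n. R x b}) +
          dens n ({x \<in> tuples G n. R x b} - {x \<in> tuples G n. R x y}) \<le> \<eta>" for B D b \<eta>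
    proof -
      have t: "y \<in> tuples G m" if "y \<in> B" for y using h(1) that Def_subset by blast
      have cl: "dens n (fibre G n S y - fibre G n S b) + dens n (fibre G n S b - fibre G n S y) \<le> \<eta>"
        if "y \<in> D" for y
        using close[OF that] sect[OF h(5)] sect[OF t[of y]] h(3) that by auto
      obtain V P where V: "V \<in> Def M m" "V \<subseteq> B" "0 < dens m V" "P \<in> Def M n"
        "\<And>y. y \<in> V \<Longrightarrow> dens n (fibre G n S y - P) + dens n (P - fibre G n S y) \<le> 2 * \<eta>"
        using rich_close_section[OF S h cl] by blast
      then show ?thesis using t sect by (intro bexI[of _ V] conjI bexI[of _ P]) (auto simp: subset_iff)
    qed
  qed (use def[of M] def[of "carrier G"] M_carrier Gen in auto)
qed

section \<open>Types and good position\<close>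

text \<open>At \<open>a'\<close> the fibre is positive because it contains the generic
  \<open>b'\<close>. A lower bound on the density of the fibre is, up to a gap, a condition over
  \<open>M\<close>, so it passes to \<open>a\<close>, which lies in the same sets over
  \<open>M\<close>. Thus any pair in good position informs on the given representatives.\<close>

lemma positive_section_transfer:
  assumes S: "S \<in> Def M (n + m)"
    and a: "a \<in> tuples G n" "a' \<in> tuples G n" "\<And>Z. Z \<in> Def M n \<Longrightarrow> a \<in> Z \<longleftrightarrow> a' \<in> Z"
    and b: "b' \<in> tuples G m" "generic (set a' \<union> M) b'" and S': "a' @ b' \<in> S"
    and Q: "Q \<in> Def M m" "b' \<in> Q"
  shows "0 < dens m (Q \<inter> {y \<in> tuples G m. a @ y \<in> S})"
proof -
  define Z where "Z = pull G (m + n) [0..<m] Q \<inter> transposed n m S"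
  have "pull G (m + n) [0..<m] Q \<in> Def M (m + n)" by (rule Def_pull[OF M_carrier]) (use Q in auto)
  then have Z: "Z \<in> Def M (m + n)"
    unfolding Z_def using transposed_Def[OF S] by (rule Def_Int[OF M_carrier])
  have fib: "fibre G m Z x = Q \<inter> {y \<in> tuples G m. x @ y \<in> S}" if x: "x \<in> tuples G n" for x
  proof -
    have "map ((!) (y @ x)) [0..<m] = y" if "y \<in> tuples G m" for y
      using map_nth_prefix[of y x] that by (simp add: tuples_def)
    moreover have "y @ x \<in> tuples G (m + n)" if "y \<in> tuples G m" for y
      using that x by (auto simp: tuples_def)
    ultimately show ?thesis using Def_subset[OF Q(1)] unfolding fibre_transposed[OF x, symmetric]
      by (auto simp: Z_def fibre_def pull_def)
  qed
  let ?c = "dens m (fibre G m Z a')"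
  have "fibre G m Z a' \<in> Def (set a' \<union> M) m"
    by (rule Def_fibre[OF M_carrier Z]) (use a in \<open>auto simp: tuples_def\<close>)
  moreover have "b' \<in> fibre G m Z a'" using fib[OF a(2)] b S' Q by simp
  moreover have "length b' = m" using b by (simp add: tuples_def)
  ultimately have c: "0 < ?c" using b by (auto simp: generic_def)
  obtain E where E: "E \<in> Def M n" "\<And>x. x \<in> E \<Longrightarrow> ?c / 2 \<le> dens m (fibre G m Z x)"
    "\<And>x. x \<in> tuples G n \<Longrightarrow> ?c \<le> dens m (fibre G m Z x) \<Longrightarrow> x \<in> E"
    using Def_measure[OF M_carrier Z, of "?c / 2" ?c] c by auto
  have "a \<in> E" using E a by blast
  then show ?thesis using E(2)[of a] c fib[OF a(1)] by simp
qed

text \<open>Sets over \<open>M\<close> are closed under complement, so one inclusion already gives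
  equality of types.\<close>

lemma tp_iff:
  assumes "a \<in> tuples G n" "a' \<in> tp G F M a"
  shows "a' \<in> tuples G n" "\<And>Z. Z \<in> Def M n \<Longrightarrow> a \<in> Z \<longleftrightarrow> a' \<in> Z"
proof -
  have len: "length a = n" using assms by (simp add: tuples_def)
  have 1: "a' \<in> Z" if "Z \<in> Def M n" "a \<in> Z" for Z using assms that by (auto simp: tp_def len)
  interpret content "tuples G n" "Def M n" "dens n" by (rule content_Def[OF M_carrier])
  show a': "a' \<in> tuples G n" using 1 space assms by blast
  show "a \<in> Z \<longleftrightarrow> a' \<in> Z" if "Z \<in> Def M n" for Z
    using 1[OF that] 1[OF Diff[OF space that]] assms by blast
qed

lemma GP_cases:
  assumes a: "a \<in> tuples G n" and b: "b \<in> tuples G m" and z: "z \<in> GP U Gs F M (tp G F M a) (tp G F M b)"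
  obtains a' b' where "z = a' @ b'" "a' \<in> tp G F M a" "b' \<in> tp G F M b"
    "generic (set a' \<union> M) b' \<or> generic (set b' \<union> M) a'"
proof -
  obtain a' b' where z: "z = a' @ b'" "a' \<in> tp G F M a" "b' \<in> tp G F M b"
    and gp: "good_position U Gs F M [a', b'] \<or> good_position U Gs F M [b', a']"
    using z by (auto simp: GP_def)
  have c: "set a' \<subseteq> carrier G" "set b' \<subseteq> carrier G"
    using tp_iff(1)[OF a z(2)] tp_iff(1)[OF b z(3)] by (auto simp: tuples_def)
  have "dense_over U Gs F (set u \<union> M) v" if gp: "good_position U Gs F M [u, v]" for u v
  proof -
    have "(\<Union>j<Suc 0. set ([u, v] ! j)) = set u" by (simp add: lessThan_Suc)
    then show ?thesis using gp[unfolded good_position_def, rule_format, of 1] by (simp add: Un_commute)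
  qed
  then have "generic (set a' \<union> M) b' \<or> generic (set b' \<union> M) a'"
    using gp c M_carrier generic_if_dense_over by (metis Un_least)
  then show thesis using that z by blast
qed

lemma GP_in_or_disjoint:
  assumes X: "X \<in> Def M n" and Y: "Y \<in> Def M m" and S: "S \<in> Def M (n + m)" "S \<subseteq> pairs X Y"
    and stable: "almost_surely_stable U Gs k n m X Y S"
    and a: "a \<in> tuples G n" "dense_over U Gs F M a" and b: "b \<in> tuples G m" "dense_over U Gs F M b"
  defines "P \<equiv> GP U Gs F M (tp G F M a) (tp G F M b)"
  shows "P \<subseteq> S \<or> P \<inter> S = {}"
proof (rule ccontr)
  assume "\<not> ?thesis"
  then obtain u v where u: "u \<in> P" "u \<in> S" and v: "v \<in> P" "v \<notin> S" by blast
  note no_half = Gen_no_half_graph[OF X Y S stable]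
  \<comment> \<open>With the sides exchanged, the half-graph pattern is the original one for the
    reversed lists.\<close>
  have no_half': "\<not> (\<forall>i<k. \<forall>j<k. as' ! j @ bs' ! i \<in> S \<longleftrightarrow> i \<le> j)"
    if "Gen n m as bs" "set as' \<subseteq> set as" "set bs' \<subseteq> set bs" "length as' = k" "length bs' = k" for as bs as' bs'
  proof
    assume "\<forall>i<k. \<forall>j<k. as' ! j @ bs' ! i \<in> S \<longleftrightarrow> i \<le> j"
    then have "\<forall>i<k. \<forall>j<k. rev as' ! i @ rev bs' ! j \<in> S \<longleftrightarrow> i \<le> j"
      using that by (auto simp: rev_nth)
    then show False using no_half[of as bs "rev as'" "rev bs'"] that by simp
  qed
  let ?sect = "\<lambda>b. {x \<in> tuples G n. x @ b \<in> S}" and ?cosect = "\<lambda>a. {y \<in> tuples G m. a @ y \<in> S}"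
  have l: "measured_relation (tuples G n) (Def (carrier G) n) (dens n) (Def M n)
    (tuples G m) (Def (carrier G) m) (dens m) (Def M m) (\<lambda>x y. x @ y \<in> S) ?sect (Gen n m) k"
    by (rule measured_relation_Def[OF S(1)]) (use Gen_Nil Gen_X Gen_Y no_half in auto)
  have r: "measured_relation (tuples G m) (Def (carrier G) m) (dens m) (Def M m)
    (tuples G n) (Def (carrier G) n) (dens n) (Def M n) (\<lambda>y x. x @ y \<in> S) ?cosect (\<lambda>bs as. Gen n m as bs) k"
    by (rule measured_relation_Def[OF transposed_Def[OF S(1)]])
      (use Gen_Nil Gen_X Gen_Y no_half' transposed_iff in auto)
  interpret stable_relation "tuples G n" "Def (carrier G) n" "dens n" "Def M n"
    "tuples G m" "Def (carrier G) m" "dens m" "Def M m" "\<lambda>x y. x @ y \<in> S" ?sect ?cosect "Gen n m" k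
    by (intro stable_relation.intro l r)
  have carr: "set a \<subseteq> carrier G" "set b \<subseteq> carrier G" and len: "length a = n" "length b = m"
    using a b by (auto simp: tuples_def)
  have "generic M a" "generic M b" using generic_if_dense_over M_carrier carr a b by blast+
  then have tps: "r.typical a" "l.typical b"
    using a b len by (auto simp: generic_def l.typical_def r.typical_def)
  \<comment> \<open>To be applied to \<open>S\<close> and to its complement. The order in which the
    pair is in good position decides which of the two sections is shown to be positive.\<close>
  have main: "(\<forall>Q\<in>Def M m. b \<in> Q \<longrightarrow> 0 < dens m (Q \<inter> {y \<in> tuples G m. a @ y \<in> T})) \<or>
      (\<forall>P\<in>Def M n. a \<in> P \<longrightarrow> 0 < dens n (P \<inter> {x \<in> tuples G n. x @ b \<in> T}))"
    if T: "T \<in> Def M (n + m)" and z: "z \<in> P" "z \<in> T" for T z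
  proof -
    obtain a' b' where z': "z = a' @ b'" "a' \<in> tp G F M a" "b' \<in> tp G F M b"
      "generic (set a' \<union> M) b' \<or> generic (set b' \<union> M) a'"
      using GP_cases[OF a(1) b(1)] z(1) unfolding P_def by blast
    note a' = tp_iff[OF a(1) z'(2)] and b' = tp_iff[OF b(1) z'(3)]
    from z'(4) show ?thesis
    proof
      assume g: "generic (set a' \<union> M) b'"
      then show ?thesis
        using positive_section_transfer[OF T a(1) a' b'(1) g] z z' b'(2) by blast
    next
      assume g: "generic (set b' \<union> M) a'"
      have "b' @ a' \<in> transposed n m T" using transposed_iff[OF a'(1) b'(1)] z z' by simp
      moreover have "{x \<in> tuples G n. b @ x \<in> transposed n m T} = {x \<in> tuples G n. x @ b \<in> T}"
        using transposed_iff b(1) by blast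
      ultimately show ?thesis
        using positive_section_transfer[OF transposed_Def[OF T] b(1) b' a'(1) g] a'(2) by auto
    qed
  qed
  let ?T = "tuples G (n + m) - S"
  have T: "?T \<in> Def M (n + m)" using Def_Diff M_carrier Def_F[OF F_tuples] S by blast
  obtain a' b' where ab: "v = a' @ b'" "a' \<in> tp G F M a" "b' \<in> tp G F M b"
    using GP_cases[OF a(1) b(1)] v(1) unfolding P_def by blast
  have "v \<in> tuples G (n + m)"
    using tp_iff(1)[OF a(1) ab(2)] tp_iff(1)[OF b(1) ab(3)] ab(1) by (auto simp: tuples_def)
  then have "v \<in> ?T" using v by blast
  have "Q \<inter> {y \<in> tuples G m. a @ y \<in> ?T} = Q - ?cosect a" if "Q \<in> Def M m" for Q
    using Def_subset[OF that] a by (auto simp: tuples_def)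
  moreover have "Q \<inter> {x \<in> tuples G n. x @ b \<in> ?T} = Q - ?sect b" if "Q \<in> Def M n" for Q
    using Def_subset[OF that] b by (auto simp: tuples_def)
  ultimately show False
    using sections_determined[OF tps main[OF S(1) u]] main[OF T v(1) \<open>v \<in> ?T\<close>] by simp
qed

end

theorem theorem4p11:
  fixes U :: "nat filter" and Gs :: "nat \<Rightarrow> 'a monoid"
    and F :: "nat \<Rightarrow> 'a ultra list set set"
    and M :: "'a ultra set"
    and X Y S :: "'a ultra list set"
    and n m k :: nat
  assumes "nonstandard_finite_group U Gs"
    and "tame_family U Gs F" and "\<forall>i. countable (F i)"
    and "countable M" and "rich (ultraproduct U Gs) F M"
    and "X \<in> defined_over (ultraproduct U Gs) F M n"
    and "Y \<in> defined_over (ultraproduct U Gs) F M m"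
    and "S \<in> defined_over (ultraproduct U Gs) F M (n + m)"
    and "S \<subseteq> pairs X Y"
    and "k \<ge> 1" and "almost_surely_stable U Gs k n m X Y S"
  shows "\<forall>a \<in> tuples (ultraproduct U Gs) n. \<forall>b \<in> tuples (ultraproduct U Gs) m.
      dense_over U Gs F M a \<and> dense_over U Gs F M b \<longrightarrow>
      (let P = GP U Gs F M (tp (ultraproduct U Gs) F M a) (tp (ultraproduct U Gs) F M b)
       in P \<subseteq> S \<or> P \<inter> S = {})"
proof -
  interpret tame_family U Gs F by fact
  interpret rich_model U Gs F M
    by unfold_locales (use assms in auto)
  show ?thesis using GP_in_or_disjoint[OF assms(6-9,11)] by (simp add: Let_def)
qed

end
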